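(* Let $G$ be a connected graph (loops and multiple edges allowed) with minimum degree at least $3$, let $v$ be a vertex of $G$ with $\deg_G(v)\geqslant 4$, and let $G^{*}$ be a graph obtained from $G$ by splitting $v$ into two adjacent vertices $v'$ and $v''$. Suppose that the $v$-local subgraph $G_{loc}(v)$ is connected. Then $G$ is upper embeddable if and only if $G^{*}$ is upper embeddable.
   Context: The Betti number of a connected graph $G$ is $\beta(G)=|E(G)|-|V(G)|+1$. The maximum genus $\gamma_M(G)$ of a connected graph $G$ is the largest integer $k$ such that $G$ has a (cellular) embedding in the orientable surface of genus $k$. $G$ is upper embeddable if $\gamma_M(G)=\lfloor \beta(G)/2\rfloor$. For a vertex $v$, $N_G(v)$ is the set of vertices adjacent to $v$, and the $v$-local subgraph $G_{loc}(v)$ is the subgraph of $G$ induced by $N_G(v)$. A vertex splitting on a vertex $v$ with $\deg_G(v)\geqslant 4$ replaces $v$ by two adjacent vertices $v'$ and $v''$ (joined by a new edge $v'v''$, the splitting-edge) and replaces each edge $e=vu$ incident to $v$ either by the edge $v'u$ or by the edge $v''u$ (the choice for each edge is arbitrary).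
   Formalization: Each loop at v is required to become an edge joining v' and v'' in the splitting (if a loop may stay a loop at v' or v'', the claim is false); cellular embeddings are represented by rotation systems. *)

theory Defs
  imports "Graph_Theory.Graph_Theory" "HOL-Combinatorics.Orbits"
begin

text \<open>
  A finite undirected graph with loops and multiple edges is a finite digraph together with a
  fixed-point-free involution \<open>r\<close> of its arcs that exchanges tail and head. An undirected edge is
  a pair \<open>{a, r a}\<close>; this includes loops, which consist of two distinct arcs. Hence the degree
  of a vertex (a loop counting twice) is its \<^const>\<open>out_degree\<close>.
\<close>

locale multigraph = fin_digraph G + bidirected_digraph G r
  for G :: "('a, 'b) pre_digraph" and r :: "'b \<Rightarrow> 'b"

definition num_edges :: "('a, 'b) pre_digraph \<Rightarrow> nat" where
  "num_edges G = card (arcs G) div 2"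

definition betti :: "('a, 'b) pre_digraph \<Rightarrow> int" where
  "betti G = int (num_edges G) - int (card (verts G)) + 1"

definition neighbours :: "('a, 'b) pre_digraph \<Rightarrow> 'a \<Rightarrow> 'a set" where
  "neighbours G v = {u \<in> verts G. v \<rightarrow>\<^bsub>G\<^esub> u}"

definition local_subgraph :: "('a, 'b) pre_digraph \<Rightarrow> 'a \<Rightarrow> ('a, 'b) pre_digraph" where
  "local_subgraph G v = G \<restriction> neighbours G v"

text \<open>
  Cellular embeddings of a connected graph in closed oriented surfaces are given by rotation
  systems: for every vertex, a cyclic order \<open>s\<close> of the arcs leaving it. The boundary walks of the
  faces are the orbits of \<open>s \<circ> r\<close> on the arcs, and attaching a disc to each of them yields
  the surface. Its genus \<open>k\<close> is determined by its Euler characteristic \<open>2 - 2 k\<close>.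
\<close>

definition rotation_system :: "('a, 'b) pre_digraph \<Rightarrow> ('b \<Rightarrow> 'b) \<Rightarrow> bool" where
  "rotation_system G s \<longleftrightarrow> s permutes arcs G \<and>
     (\<forall>v \<in> verts G. out_arcs G v \<noteq> {} \<longrightarrow> cyclic_on s (out_arcs G v))"

definition faces :: "('a, 'b) pre_digraph \<Rightarrow> ('b \<Rightarrow> 'b) \<Rightarrow> ('b \<Rightarrow> 'b) \<Rightarrow> 'b set set" where
  "faces G r s = orbit (s \<circ> r) ` arcs G"

text \<open>The one-vertex graph without edges has one face (in the sphere), which no arc witnesses.\<close>

definition num_faces :: "('a, 'b) pre_digraph \<Rightarrow> ('b \<Rightarrow> 'b) \<Rightarrow> ('b \<Rightarrow> 'b) \<Rightarrow> nat" where
  "num_faces G r s = (if arcs G = {} then 1 else card (faces G r s))"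

definition embeds_in_genus :: "('a, 'b) pre_digraph \<Rightarrow> ('b \<Rightarrow> 'b) \<Rightarrow> nat \<Rightarrow> bool" where
  "embeds_in_genus G r k \<longleftrightarrow> (\<exists>s. rotation_system G s \<and>
     int (card (verts G)) - int (num_edges G) + int (num_faces G r s) = 2 - 2 * int k)"

definition max_genus :: "('a, 'b) pre_digraph \<Rightarrow> ('b \<Rightarrow> 'b) \<Rightarrow> nat" where
  "max_genus G r = (GREATEST k. embeds_in_genus G r k)"

definition upper_embeddable :: "('a, 'b) pre_digraph \<Rightarrow> ('b \<Rightarrow> 'b) \<Rightarrow> bool" where
  "upper_embeddable G r \<longleftrightarrow> int (max_genus G r) = betti G div 2"

text \<open>
  \<open>(H, q)\<close> arises from \<open>(G, r)\<close> by splitting \<open>v\<close> into \<open>v'\<close> and \<open>v''\<close>. The arcs of \<open>G\<close> are kept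
  as arcs of \<open>H\<close> with possibly new ends, and \<open>{d, d'}\<close> is the splitting-edge. Prescribing the
  arcs with tail \<open>v\<close> suffices, since \<open>H\<close> is again a graph with arc reversal \<open>q\<close>. One end of a
  loop at \<open>v\<close> goes to \<open>v'\<close> and the other one to \<open>v''\<close>. Loops at \<open>v\<close> must not survive as loops at
  \<open>v'\<close> or \<open>v''\<close>: a vertex with two loops that is joined by three edges to a vertex \<open>u\<close> is upper
  embeddable with connected local subgraph, but ceases to be upper embeddable if \<open>v'\<close> receives
  one loop and nothing else.
\<close>

definition vertex_splitting ::
  "('a, 'b) pre_digraph \<Rightarrow> ('b \<Rightarrow> 'b) \<Rightarrow> 'a \<Rightarrow> ('a, 'b) pre_digraph \<Rightarrow> ('b \<Rightarrow> 'b) \<Rightarrow> 'a \<Rightarrow> 'a \<Rightarrow> bool"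
where
  "vertex_splitting G r v H q v' v'' \<longleftrightarrow>
     multigraph G r \<and> multigraph H q \<and>
     v \<in> verts G \<and> 4 \<le> out_degree G v \<and>
     v' \<noteq> v'' \<and> v' \<notin> verts G - {v} \<and> v'' \<notin> verts G - {v} \<and>
     verts H = (verts G - {v}) \<union> {v', v''} \<and>
     (\<exists>d d'. d \<noteq> d' \<and> d \<notin> arcs G \<and> d' \<notin> arcs G \<and>
        arcs H = arcs G \<union> {d, d'} \<and> q = r(d := d', d' := d) \<and>
        tail H d = v' \<and> head H d = v'') \<and>
     (\<forall>a \<in> arcs G. tail G a \<noteq> v \<and> head G a \<noteq> v \<longrightarrow>
        tail H a = tail G a \<and> head H a = head G a) \<and>
     (\<forall>a \<in> arcs G. tail G a = v \<and> head G a \<noteq> v \<longrightarrow>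
        (tail H a = v' \<or> tail H a = v'') \<and> head H a = head G a) \<and>
     (\<forall>a \<in> arcs G. tail G a = v \<and> head G a = v \<longrightarrow>
        {tail H a, head H a} = {v', v''})"

end

theory Submission
  imports Defs Complex_Main "HOL-Library.Function_Algebras"
begin

text \<open>
  A \<^emph>\<open>local form\<close> is a skew form on the space \<open>Z\<close> of real cycles (flows) that is a combination of
  wedges of arcs with a common tail. A rotation system defines such a form, whose radical consists
  of the functions on the faces modulo constants. Conversely, from a local form of corank at most
  one one can select disjoint pairs of arcs with common tails that form coordinates of \<open>Z\<close> up to
  codimension one, and a rotation in which the arcs of every pair are consecutive (in a suitable
  order) then has at most two faces. Hence a connected graph is upper embeddable iff it has a
  local form of corank at most one.

  Contracting the splitting-edge identifies the cycle spaces of \<open>H\<close> and \<open>G\<close> and turns local forms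
  of \<open>H\<close> into local forms of \<open>G\<close>. For the other direction, the pairs of arcs of \<open>G\<close> yield a local
  form of \<open>H\<close> of corank at most three, together with arcs \<open>a\<close> at \<open>v'\<close> and \<open>b\<close> at \<open>v''\<close> that are independent
  on the radical. Suppose that no local form of \<open>H\<close> has corank at most one and choose one as
  generic as possible. Then arcs with a common tail are dependent on its radical, and an arc \<open>g\<close> that
  vanishes on the radical but starts at a vertex where the radical does not is represented by
  a vector \<open>u\<close> that is, on each component of the support of the radical, proportional to the radical.
  Let \<open>n\<close> be the number of these components that meet \<open>v'\<close>, \<open>v''\<close> and the neighbours of \<open>v\<close>. The
  splitting-edge and one spoke for each component other than those of \<open>v'\<close> and \<open>v''\<close> are \<open>n - 1\<close>
  arcs, which together with two independent vectors of the radical leave \<open>n + 1\<close> unknowns for \<open>n\<close>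
  equations; a solution is a combination of these arcs that is a cut near \<open>v\<close>. But a connected
  local subgraph makes the potential of this cut constant.
\<close>

subsection \<open>Linear algebra\<close>

text \<open>The form of a rotation is, up to a factor, the intersection form of the ribbon surface
  that thickens the graph. Its radical is spanned by the boundary circles, subject to one relation,
  so its dimension is the number of faces minus one, and Euler's formula makes "at most two faces"
  the same as "largest conceivable genus". The obstacle is that in \<open>H\<close> an arc at
  \<open>v'\<close> can no longer be paired with an arc at \<open>v''\<close>. The selected arcs at
  \<open>v\<close> can be paired anew inside the two sides except for at most one on each side;
  giving these two up raises the corank from at most one to at most three and makes them independent
  on the radical. Forms with real coefficients replace rotations because a wedge may be added with
  any multiple: all but finitely many multiples preserve what already holds. "As generic as
  possible" has two stages: the support of the radical is largest, and then the form restricted to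
  the cycles on this support has the smallest radical. The second stage is there because a
  representing vector \<open>u\<close> lives on the support without having to lie in the radical
  itself.\<close>

instantiation "fun" :: (type, real_vector) real_vector
begin

definition scaleR_fun :: "real \<Rightarrow> ('a \<Rightarrow> 'b) \<Rightarrow> 'a \<Rightarrow> 'b" where
  "scaleR_fun c f = (\<lambda>x. c *\<^sub>R f x)"

instance
  by standard (simp_all add: scaleR_fun_def plus_fun_def fun_eq_iff scaleR_add_right scaleR_add_left)

end

lemma scaleR_fun_apply [simp]: "(c *\<^sub>R f) x = c *\<^sub>R f x"
  by (simp add: scaleR_fun_def)

lemma sum_fun_apply: "(\<Sum>i\<in>I. f i) x = (\<Sum>i\<in>I. f i x)"
  by (induction I rule: infinite_finite_induct) auto

lemma linear_apply: "linear (\<lambda>z. z a)"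
  by (rule linearI) auto

text \<open>Gaussian elimination: the equation \<open>j\<close> is solved for an unknown
  \<open>i0\<close> that occurs in it and substituted into the others, which costs one equation and
  one unknown.\<close>

lemma homogeneous_system_nontrivial_solution:
  fixes M :: "'i \<Rightarrow> 'j \<Rightarrow> real"
  assumes "finite J" "finite I" "card J < card I"
  shows "\<exists>c. (\<exists>i\<in>I. c i \<noteq> 0) \<and> (\<forall>j\<in>J. (\<Sum>i\<in>I. c i * M i j) = 0)"
  using assms
proof (induction J arbitrary: I M rule: finite_induct)
  case empty
  then have "I \<noteq> {}" by auto
  then show ?case by (intro exI[of _ "\<lambda>_. 1"]) auto
next
  case (insert j J)
  show ?case
  proof (cases "\<forall>i\<in>I. M i j = 0")
    case True
    have "card J < card I" using insert.prems insert.hyps by simp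
    with insert.IH[of I M] insert.prems(1) obtain c
      where "\<exists>i\<in>I. c i \<noteq> 0" "\<forall>j\<in>J. (\<Sum>i\<in>I. c i * M i j) = 0" by blast
    with True show ?thesis by (intro exI[of _ c]) simp
  next
    case False
    then obtain i0 where i0: "i0 \<in> I" "M i0 j \<noteq> 0" by blast
    define I' where "I' = I - {i0}"
    have I': "finite I'" "card J < card I'" "I = insert i0 I'" "i0 \<notin> I'"
      using insert.prems insert.hyps i0 by (auto simp: I'_def)
    obtain c where c: "\<exists>i\<in>I'. c i \<noteq> 0"
      "\<And>k. k \<in> J \<Longrightarrow> (\<Sum>i\<in>I'. c i * (M i k - M i j / M i0 j * M i0 k)) = 0"
      using insert.IH[of I' "\<lambda>i k. M i k - M i j / M i0 j * M i0 k"] I' by blast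
    define e where "e = c(i0 := - (\<Sum>i\<in>I'. c i * M i j / M i0 j))"
    have e: "(\<Sum>i\<in>I. e i * M i k) = (\<Sum>i\<in>I'. c i * (M i k - M i j / M i0 j * M i0 k))" for k
    proof -
      have "(\<Sum>i\<in>I. e i * M i k) = - (\<Sum>i\<in>I'. c i * M i j / M i0 j) * M i0 k + (\<Sum>i\<in>I'. e i * M i k)"
        using I' by (simp add: e_def)
      also have "(\<Sum>i\<in>I'. e i * M i k) = (\<Sum>i\<in>I'. c i * M i k)"
        using I' by (intro sum.cong) (auto simp: e_def)
      finally show ?thesis
        by (simp add: right_diff_distrib sum_subtractf sum_distrib_right mult.assoc)
    qed
    show ?thesis
    proof (intro exI[of _ e] conjI ballI)
      show "\<exists>i\<in>I. e i \<noteq> 0" using c(1) I' by (auto simp: e_def)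
      fix k assume "k \<in> insert j J"
      then show "(\<Sum>i\<in>I. e i * M i k) = 0"
        unfolding e using c(2) i0(2) by auto
    qed
  qed
qed

text \<open>On the kernel \<open>V'\<close> of the new functional the induction hypothesis applies.
  \<open>V\<close> exceeds \<open>V'\<close> by at most one direction \<open>p\<close>, and the
  missing coefficient \<open>k\<close> is fitted there. This lemma later produces both representing
  vectors of skew forms and potentials of cuts.\<close>

lemma functional_in_span:
  fixes l :: "'i \<Rightarrow> 'v::real_vector \<Rightarrow> real"
  assumes "finite I" "subspace V" "linear h" "\<And>i. i \<in> I \<Longrightarrow> linear (l i)"
    and "\<And>z. z \<in> V \<Longrightarrow> (\<forall>i\<in>I. l i z = 0) \<Longrightarrow> h z = 0"
  shows "\<exists>c. \<forall>z\<in>V. h z = (\<Sum>i\<in>I. c i * l i z)"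
  using assms
proof (induction I arbitrary: V rule: finite_induct)
  case empty
  then show ?case by auto
next
  case (insert j I)
  define V' where "V' = {z \<in> V. l j z = 0}"
  have lj: "linear (l j)" using insert.prems by auto
  have V': "subspace V'"
    using \<open>subspace V\<close> lj unfolding V'_def subspace_def
    by (auto simp: linear_add linear_scale linear_0)
  obtain c where c: "\<And>z. z \<in> V' \<Longrightarrow> h z = (\<Sum>i\<in>I. c i * l i z)"
    using insert.IH[OF V'] insert.prems by (auto simp: V'_def)
  show ?case
  proof (cases "\<exists>p\<in>V. l j p \<noteq> 0")
    case False
    then have "V' = V" by (auto simp: V'_def)
    with c insert.hyps False show ?thesis
      by (intro exI[of _ c]) auto
  next
    case True
    then obtain p where p: "p \<in> V" "l j p \<noteq> 0" by blast
    define k where "k = (h p - (\<Sum>i\<in>I. c i * l i p)) / l j p"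
    have *: "h z = (\<Sum>i\<in>I. c i * l i z) + k * l j z" if z: "z \<in> V" for z
    proof -
      define t where "t = l j z / l j p"
      have "z - t *\<^sub>R p \<in> V'"
        using z p \<open>subspace V\<close> lj
        by (auto simp: V'_def subspace_diff subspace_scale linear_diff linear_scale t_def)
      from c[OF this] have "h z - t * h p = (\<Sum>i\<in>I. c i * (l i z - t * l i p))"
        using insert.prems by (simp add: linear_diff linear_scale)
      also have "\<dots> = (\<Sum>i\<in>I. c i * l i z) - t * (\<Sum>i\<in>I. c i * l i p)"
        by (simp add: right_diff_distrib sum_subtractf sum_distrib_left algebra_simps)
      finally have "h z = (\<Sum>i\<in>I. c i * l i z) + t * (h p - (\<Sum>i\<in>I. c i * l i p))"
        by (simp add: algebra_simps)
      then show ?thesis using p by (simp add: t_def k_def)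
    qed
    show ?thesis
    proof (intro exI[of _ "c(j := k)"] ballI)
      fix z assume "z \<in> V"
      have "(\<Sum>i\<in>I. (c(j := k)) i * l i z) = (\<Sum>i\<in>I. c i * l i z)"
        using insert.hyps by (intro sum.cong) auto
      with *[OF \<open>z \<in> V\<close>] insert.hyps
      show "h z = (\<Sum>i\<in>insert j I. (c(j := k)) i * l i z)" by simp
    qed
  qed
qed

lemma subspace_finitely_spanned:
  fixes V :: "('b \<Rightarrow> real) set"
  assumes "subspace V" "finite A" "\<And>z a. z \<in> V \<Longrightarrow> a \<notin> A \<Longrightarrow> z a = 0"
  obtains B where "finite B" "B \<subseteq> V" "V = span B"
proof -
  define E where "E = (\<lambda>a b. if b = a then 1 else (0::real)) ` A"
  have "V \<subseteq> span E"
  proof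
    fix z assume z: "z \<in> V"
    have "z = (\<Sum>a\<in>A. z a *\<^sub>R (\<lambda>b. if b = a then 1 else 0))"
      using assms(2,3) z
      by (auto simp: fun_eq_iff sum_fun_apply if_distrib[of "\<lambda>x. _ * x"] cong: if_cong)
    also have "\<dots> \<in> span E"
      by (intro span_sum span_scale span_base) (auto simp: E_def)
    finally show "z \<in> span E" .
  qed
  moreover have "finite E" using assms by (simp add: E_def)
  moreover obtain B where B: "B \<subseteq> V" "independent B" "V \<subseteq> span B"
    using maximal_independent_subset by blast
  ultimately have "finite B"
    using independent_span_bound[of E B] by blast
  moreover have "V = span B"
    using B assms(1) by (simp add: span_minimal subset_antisym)
  ultimately show ?thesis using B that by blast
qed

text \<open>Stating the bound by dependence of families, rather than by \<open>dim\<close>, lets it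
  pass to arbitrary subsets and linear images, which is how coranks are compared.\<close>

definition dim_at_most :: "nat \<Rightarrow> 'v::real_vector set \<Rightarrow> bool" where
  "dim_at_most n V \<longleftrightarrow> (\<forall>z::nat \<Rightarrow> 'v. (\<forall>i\<le>n. z i \<in> V) \<longrightarrow>
     (\<exists>c. (\<exists>i\<le>n. c i \<noteq> 0) \<and> (\<Sum>i\<le>n. c i *\<^sub>R z i) = 0))"

lemma dim_at_mostE:
  assumes "dim_at_most n V" "\<And>i. i \<le> n \<Longrightarrow> z i \<in> V"
  obtains c where "\<exists>i\<le>n. c i \<noteq> 0" "(\<Sum>i\<le>n. c i *\<^sub>R z i) = 0"
  using assms unfolding dim_at_most_def by blast

lemma dim_at_most_subset: "dim_at_most n V \<Longrightarrow> U \<subseteq> V \<Longrightarrow> dim_at_most n U"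
  unfolding dim_at_most_def by blast

lemma dim_at_most_linear_image:
  assumes "linear T" "dim_at_most n V"
  shows "dim_at_most n (T ` V)"
  unfolding dim_at_most_def
proof (intro allI impI)
  fix z :: "nat \<Rightarrow> _" assume "\<forall>i\<le>n. z i \<in> T ` V"
  then obtain y where y: "\<And>i. i \<le> n \<Longrightarrow> z i = T (y i) \<and> y i \<in> V"
    unfolding image_iff by metis
  then obtain c where c: "\<exists>i\<le>n. c i \<noteq> 0" "(\<Sum>i\<le>n. c i *\<^sub>R y i) = 0"
    using assms(2) unfolding dim_at_most_def by blast
  have "(\<Sum>i\<le>n. c i *\<^sub>R z i) = T (\<Sum>i\<le>n. c i *\<^sub>R y i)"
    using assms(1) y by (simp add: linear_sum linear_scale)
  also have "\<dots> = 0" using c assms(1) by (simp add: linear_0)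
  finally show "\<exists>c. (\<exists>i\<le>n. c i \<noteq> 0) \<and> (\<Sum>i\<le>n. c i *\<^sub>R z i) = 0"
    using c(1) by blast
qed

lemma dim_at_most_1_iff:
  "dim_at_most (Suc 0) V \<longleftrightarrow> (\<forall>z\<in>V. \<forall>w\<in>V. \<exists>c d. (c \<noteq> 0 \<or> d \<noteq> 0) \<and> c *\<^sub>R z + d *\<^sub>R w = 0)"
    (is "?l = ?r")
proof
  assume ?l
  show ?r
  proof (intro ballI)
    fix z w assume "z \<in> V" "w \<in> V"
    define y where "y i = (if i = 0 then z else w)" for i :: nat
    have "y i \<in> V" for i using \<open>z \<in> V\<close> \<open>w \<in> V\<close> by (simp add: y_def)
    then obtain c where "\<exists>i\<le>Suc 0. c i \<noteq> 0" "(\<Sum>i\<le>Suc 0. c i *\<^sub>R y i) = 0"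
      using dim_at_mostE[OF \<open>?l\<close>, of y] by blast
    then show "\<exists>c d. (c \<noteq> 0 \<or> d \<noteq> 0) \<and> c *\<^sub>R z + d *\<^sub>R w = 0"
      by (intro exI[of _ "c 0"] exI[of _ "c (Suc 0)"]) (auto simp: le_Suc_eq y_def)
  qed
next
  assume r: ?r
  show ?l
    unfolding dim_at_most_def
  proof (intro allI impI)
    fix z :: "nat \<Rightarrow> _" assume "\<forall>i\<le>Suc 0. z i \<in> V"
    then obtain c d where "c \<noteq> 0 \<or> d \<noteq> 0" "c *\<^sub>R z 0 + d *\<^sub>R z (Suc 0) = 0"
      using r by (metis le0 order_refl)
    then show "\<exists>c. (\<exists>i\<le>Suc 0. c i \<noteq> 0) \<and> (\<Sum>i\<le>Suc 0. c i *\<^sub>R z i) = 0"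
      by (intro exI[of _ "\<lambda>i. if i = 0 then c else d"]) (auto simp: le_Suc_eq)
  qed
qed

text \<open>\<open>f\<close> embeds \<open>U\<close> into the real line:
  \<open>f w *\<^sub>R z - f z *\<^sub>R w\<close> lies in its kernel.\<close>

lemma dim_at_most_codim_one:
  fixes f :: "'v::real_vector \<Rightarrow> real"
  assumes "subspace U" "linear f" "\<And>y. y \<in> U \<Longrightarrow> f y = 0 \<Longrightarrow> y = 0"
  shows "dim_at_most (Suc 0) U"
  unfolding dim_at_most_1_iff
proof (intro ballI)
  fix z w assume zw: "z \<in> U" "w \<in> U"
  note triv = assms(3)
  show "\<exists>c d. (c \<noteq> 0 \<or> d \<noteq> 0) \<and> c *\<^sub>R z + d *\<^sub>R w = 0"
  proof (cases "f z = 0")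
    case True
    with triv zw have "z = 0" by blast
    then show ?thesis by (intro exI[of _ 1] exI[of _ 0]) auto
  next
    case False
    have "f w *\<^sub>R z + (- f z) *\<^sub>R w = 0"
      using assms zw
      by (intro triv) (auto simp: subspace_diff subspace_scale linear_diff linear_scale)
    with False show ?thesis by (intro exI[of _ "f w"] exI[of _ "- f z"]) auto
  qed
qed

text \<open>A nonzero two-by-two minor; for a subspace this is linear independence of the two
  restricted functionals.\<close>

definition independent_on :: "'v set \<Rightarrow> ('v \<Rightarrow> real) \<Rightarrow> ('v \<Rightarrow> real) \<Rightarrow> bool" where
  "independent_on V f g \<longleftrightarrow> (\<exists>z\<in>V. \<exists>w\<in>V. f z * g w \<noteq> f w * g z)"

text \<open>Two vectors \<open>p\<close>, \<open>q\<close> with a nonzero minor are appended to the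
  given vectors of the kernel. Applying \<open>f\<close> and \<open>g\<close> to a relation among
  all of them gives a regular two-by-two system for the coefficients of \<open>p\<close> and
  \<open>q\<close>, so these vanish.\<close>

lemma dim_at_most_kernel:
  assumes "linear f" "linear g" "independent_on V f g" "dim_at_most (Suc (Suc n)) V"
  shows "dim_at_most n {z \<in> V. f z = 0 \<and> g z = 0}"
  unfolding dim_at_most_def
proof (intro allI impI)
  obtain p q where pq: "p \<in> V" "q \<in> V" "f p * g q \<noteq> f q * g p"
    using assms(3) unfolding independent_on_def by blast
  fix z :: "nat \<Rightarrow> 'a" assume z: "\<forall>i\<le>n. z i \<in> {z \<in> V. f z = 0 \<and> g z = 0}"
  define y where "y i = (if i \<le> n then z i else if i = Suc n then p else q)" for i
  have yV: "\<forall>i\<le>Suc (Suc n). y i \<in> V" using z pq by (auto simp: y_def)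
  obtain c where c: "\<exists>i\<le>Suc (Suc n). c i \<noteq> 0" "(\<Sum>i\<le>Suc (Suc n). c i *\<^sub>R y i) = 0"
    using assms(4) yV unfolding dim_at_most_def by blast
  have "(\<Sum>i\<le>n. c i *\<^sub>R y i) = (\<Sum>i\<le>n. c i *\<^sub>R z i)"
    by (intro sum.cong) (auto simp: y_def)
  then have eq: "(\<Sum>i\<le>n. c i *\<^sub>R z i) + c (Suc n) *\<^sub>R p + c (Suc (Suc n)) *\<^sub>R q = 0"
    using c(2) by (simp add: y_def)
  have "h ((\<Sum>i\<le>n. c i *\<^sub>R z i) + c (Suc n) *\<^sub>R p + c (Suc (Suc n)) *\<^sub>R q)
      = (\<Sum>i\<le>n. c i * h (z i)) + c (Suc n) * h p + c (Suc (Suc n)) * h q" if "linear h" for h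
    using that by (simp add: linear_add linear_sum linear_scale)
  from this[OF assms(1)] this[OF assms(2)]
  have "c (Suc n) * f p + c (Suc (Suc n)) * f q = 0" "c (Suc n) * g p + c (Suc (Suc n)) * g q = 0"
    using z eq assms(1,2) by (auto simp: linear_0)
  then have "c (Suc n) * (f p * g q - f q * g p) = 0" "c (Suc (Suc n)) * (f p * g q - f q * g p) = 0"
    by algebra+
  with pq have c0: "c (Suc n) = 0" "c (Suc (Suc n)) = 0" by auto
  with eq have "(\<Sum>i\<le>n. c i *\<^sub>R z i) = 0" by simp
  moreover have "\<exists>i\<le>n. c i \<noteq> 0" using c(1) c0 by (auto simp: le_Suc_eq)
  ultimately show "\<exists>c. (\<exists>i\<le>n. c i \<noteq> 0) \<and> (\<Sum>i\<le>n. c i *\<^sub>R z i) = 0" by blast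
qed

text \<open>Needed so that a least dimension bound can be lowered by two: the vectors of a nonzero
  minor are already two independent ones.\<close>

lemma independent_on_not_dim_at_most_1:
  assumes "linear f" "linear g" "independent_on V f g" "dim_at_most n V"
  shows "\<exists>m. n = Suc (Suc m)"
proof (rule ccontr)
  assume "\<not> ?thesis"
  then have n: "n \<le> Suc 0" by (metis Suc_le_mono le0 not_less_eq_eq old.nat.exhaust)
  obtain p q where pq: "p \<in> V" "q \<in> V" "f p * g q \<noteq> f q * g p"
    using assms(3) unfolding independent_on_def by blast
  define y where "y i = (if i = 0 then p else q)" for i :: nat
  have "y i \<in> V" for i using pq by (simp add: y_def)
  then obtain c where c: "\<exists>i\<le>n. c i \<noteq> 0" "(\<Sum>i\<le>n. c i *\<^sub>R y i) = 0"
    using dim_at_mostE[OF assms(4), of y] by blast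
  obtain a b :: real where ab: "a \<noteq> 0 \<or> b \<noteq> 0" "a *\<^sub>R p + b *\<^sub>R q = 0"
  proof (cases "n = 0")
    case True
    with c show ?thesis by (intro that[of "c 0" 0]) (auto simp: y_def)
  next
    case False
    with n have "n = Suc 0" by simp
    with c show ?thesis by (intro that[of "c 0" "c (Suc 0)"]) (auto simp: le_Suc_eq y_def)
  qed
  have "h (a *\<^sub>R p + b *\<^sub>R q) = a * h p + b * h q" if "linear h" for h
    using that by (simp add: linear_add linear_scale)
  from this[OF assms(1)] this[OF assms(2)]
  have "a * f p + b * f q = 0" "a * g p + b * g q = 0"
    using ab(2) assms(1,2) by (auto simp: linear_0)
  then have "a * (f p * g q - f q * g p) = 0" "b * (f p * g q - f q * g p) = 0" by algebra+
  with pq ab(1) show False by auto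
qed

subsection \<open>Skew forms\<close>

definition skew_form :: "('v::real_vector \<Rightarrow> 'v \<Rightarrow> real) \<Rightarrow> bool" where
  "skew_form \<omega> \<longleftrightarrow> (\<forall>z. linear (\<omega> z)) \<and> (\<forall>z w. \<omega> z w = - \<omega> w z)"

definition radical :: "('v \<Rightarrow> 'v \<Rightarrow> real) \<Rightarrow> 'v set \<Rightarrow> 'v set" where
  "radical \<omega> V = {z \<in> V. \<forall>w\<in>V. \<omega> z w = 0}"

definition wedge :: "('v \<Rightarrow> real) \<Rightarrow> ('v \<Rightarrow> real) \<Rightarrow> 'v \<Rightarrow> 'v \<Rightarrow> real" where
  "wedge f g z w = f z * g w - g z * f w"

lemma skew_form_linear_right: "skew_form \<omega> \<Longrightarrow> linear (\<omega> z)"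
  and skew_form_swap: "skew_form \<omega> \<Longrightarrow> \<omega> z w = - \<omega> w z"
  unfolding skew_form_def by blast+

lemma skew_form_linear_left:
  assumes "skew_form \<omega>"
  shows "linear (\<lambda>z. \<omega> z w)"
proof -
  have "(\<lambda>z. \<omega> z w) = (\<lambda>z. - \<omega> w z)" using skew_form_swap[OF assms] by blast
  then show ?thesis using linear_compose_neg[OF skew_form_linear_right[OF assms]] by simp
qed

lemma skew_form_self: "skew_form \<omega> \<Longrightarrow> \<omega> z z = 0"
  using skew_form_swap[of \<omega> z z] by simp

lemma skew_formI:
  assumes "\<And>z. linear (\<omega> z)" "\<And>z w. \<omega> z w = - \<omega> w z"
  shows "skew_form \<omega>"
  unfolding skew_form_def using assms by blast

lemma skew_form_wedge:
  assumes "linear f" "linear g"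
  shows "skew_form (wedge f g)"
proof (rule skew_formI)
  show "linear (wedge f g z)" for z
    using assms by (intro linearI) (simp_all add: wedge_def linear_add linear_scale algebra_simps)
qed (simp add: wedge_def)

lemma skew_form_add_scaled:
  assumes "skew_form \<omega>" "skew_form \<eta>"
  shows "skew_form (\<lambda>z w. \<omega> z w + s * \<eta> z w)"
proof (rule skew_formI)
  note lin = skew_form_linear_right[OF assms(1)] skew_form_linear_right[OF assms(2)]
  show "linear (\<lambda>w. \<omega> z w + s * \<eta> z w)" for z
    using lin[of z] by (intro linearI) (simp_all add: linear_add linear_scale algebra_simps)
  show "\<omega> z w + s * \<eta> z w = - (\<omega> w z + s * \<eta> w z)" for z w
    using skew_form_swap[OF assms(1), of z w] skew_form_swap[OF assms(2), of z w] by simp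
qed

lemma skew_form_sum:
  assumes "\<And>i. i \<in> I \<Longrightarrow> skew_form (\<omega> i)"
  shows "skew_form (\<lambda>z w. \<Sum>i\<in>I. c i * \<omega> i z w)"
proof (rule skew_formI)
  fix z w
  note lin = skew_form_linear_right[OF assms]
  show "linear (\<lambda>w. \<Sum>i\<in>I. c i * \<omega> i z w)"
    by (intro linearI)
      (simp_all add: linear_add[OF lin] linear_scale[OF lin] sum.distrib distrib_left
        sum_distrib_left mult.left_commute)
  show "(\<Sum>i\<in>I. c i * \<omega> i z w) = - (\<Sum>i\<in>I. c i * \<omega> i w z)"
    unfolding sum_negf[symmetric]
  proof (rule sum.cong)
    fix i assume "i \<in> I"
    then show "c i * \<omega> i z w = - (c i * \<omega> i w z)"
      using skew_form_swap[OF assms, of i z w] by simp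
  qed simp
qed

lemma subspace_radical:
  assumes "skew_form \<omega>" "subspace V"
  shows "subspace (radical \<omega> V)"
proof -
  note lin = skew_form_linear_left[OF assms(1)]
  show ?thesis
    using assms(2) linear_0[OF lin] linear_add[OF lin] linear_scale[OF lin]
    unfolding subspace_def radical_def by simp
qed

text \<open>A vector \<open>t\<close> of the old radical pairs with \<open>y\<close> only through
  the wedge, hence \<open>f y * g t = g y * f t\<close>. Two such \<open>t\<close> with a nonzero
  minor force \<open>f y = g y = 0\<close>. So a wedge that survives on the radical lowers the
  corank by two.\<close>

lemma radical_add_wedge_subset:
  assumes "skew_form \<omega>" "s \<noteq> 0" "independent_on (radical \<omega> V) f g"
  shows "radical (\<lambda>z w. \<omega> z w + s * wedge f g z w) V \<subseteq> {z \<in> radical \<omega> V. f z = 0 \<and> g z = 0}"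
proof
  fix y assume y: "y \<in> radical (\<lambda>z w. \<omega> z w + s * wedge f g z w) V"
  obtain p q where pq: "p \<in> radical \<omega> V" "q \<in> radical \<omega> V" "f p * g q \<noteq> f q * g p"
    using assms(3) unfolding independent_on_def by blast
  have "f y * g t = g y * f t" if t: "t \<in> radical \<omega> V" for t
  proof -
    have "\<omega> y t = 0" using t y skew_form_swap[OF assms(1), of y t] by (auto simp: radical_def)
    then show ?thesis using y t assms(2) by (auto simp: radical_def wedge_def)
  qed
  from this[OF pq(1)] this[OF pq(2)]
  have "f y * (f p * g q - f q * g p) = 0" "g y * (f p * g q - f q * g p) = 0" by algebra+
  with pq(3) have "f y = 0" "g y = 0" by auto
  with y show "y \<in> {z \<in> radical \<omega> V. f z = 0 \<and> g z = 0}"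
    by (auto simp: radical_def wedge_def)
qed

text \<open>The complementary case, in which \<open>g\<close> is \<open>k\<close> times
  \<open>f\<close> on the radical. The wedge is then also that of \<open>f\<close> with
  \<open>g - k * f\<close>, and the latter is represented by \<open>u\<close>, so subtracting
  \<open>(s * f z) *\<^sub>R u\<close> from \<open>z\<close> cancels the new term. Since
  \<open>f u = 0\<close>, this map is injective: the radical moves, but its dimension stays.\<close>

lemma radical_add_wedge_shear:
  assumes "skew_form \<omega>" "subspace V" "linear f" "s \<noteq> 0"
    and u: "u \<in> V" "f u = 0" "\<And>w. w \<in> V \<Longrightarrow> \<omega> u w = g w - k * f w"
    and p: "p \<in> radical \<omega> V" "f p \<noteq> 0"
    and vanish: "\<And>z. z \<in> radical \<omega> V \<Longrightarrow> g z = k * f z"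
  shows "radical (\<lambda>z w. \<omega> z w + s * wedge f g z w) V = (\<lambda>z. z - (s * f z) *\<^sub>R u) ` radical \<omega> V"
    (is "?L = ?R")
proof -
  let ?\<omega> = "\<lambda>z w. \<omega> z w + s * wedge f g z w"
  note lin = skew_form_linear_left[OF assms(1)]
  have wedge: "wedge f g z w = f z * (g w - k * f w) - (g z - k * f z) * f w" for z w
    by (simp add: wedge_def algebra_simps)
  show ?thesis
  proof (intro equalityI subsetI)
    fix y assume y: "y \<in> ?L"
    then have yV: "y \<in> V" and yw: "\<And>w. w \<in> V \<Longrightarrow> ?\<omega> y w = 0" by (auto simp: radical_def)
    have "p \<in> V" using p by (simp add: radical_def)
    moreover have "\<omega> y p = 0"
      using p yV skew_form_swap[OF assms(1), of y p] by (auto simp: radical_def)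
    \<comment> \<open>Testing against the radical vector \<open>p\<close> leaves only the wedge, and
      of it only the term with \<open>f p\<close>.\<close>
    ultimately have "(g y - k * f y) * f p = 0"
      using yw[of p] vanish[OF p(1)] assms(4) by (simp add: wedge)
    with p have gy: "g y - k * f y = 0" by simp
    define z where "z = y + (s * f y) *\<^sub>R u"
    have fz: "f z = f y" using assms(3) u by (simp add: z_def linear_add linear_scale)
    have "z \<in> radical \<omega> V"
      unfolding radical_def
    proof (intro CollectI conjI ballI)
      show "z \<in> V" using yV u assms(2) by (simp add: z_def subspace_add subspace_scale)
      fix w assume "w \<in> V"
      then show "\<omega> z w = 0"
        using yw[of w] u(3)[of w] gy linear_add[OF lin] linear_scale[OF lin]
        by (simp add: z_def wedge)
    qed
    moreover have "y = z - (s * f z) *\<^sub>R u" by (simp add: fz) (simp add: z_def)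
    ultimately show "y \<in> ?R" by blast
  next
    fix y assume "y \<in> ?R"
    then obtain z where z: "z \<in> radical \<omega> V" "y = z - (s * f z) *\<^sub>R u" by blast
    show "y \<in> ?L"
      unfolding radical_def
    proof (intro CollectI conjI ballI)
      show "y \<in> V" using z u assms(2) by (simp add: radical_def subspace_diff subspace_scale)
      fix w assume w: "w \<in> V"
      have \<omega>y: "\<omega> y w = - (s * f z) * (g w - k * f w)"
        using z w u(3)[of w] linear_diff[OF lin] linear_scale[OF lin]
        by (simp add: radical_def)
      have fy: "f y = f z" using z u assms(3) by (simp add: linear_diff linear_scale)
      have "\<omega> u y = 0"
        using u(1) z skew_form_swap[OF assms(1), of u z] skew_form_self[OF assms(1), of u]
          skew_form_linear_right[OF assms(1), of u]
        by (simp add: radical_def linear_diff linear_scale)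
      with u(3)[OF \<open>y \<in> V\<close>] have "g y - k * f y = 0" by simp
      then show "?\<omega> y w = 0" unfolding \<omega>y wedge fy by (simp add: algebra_simps)
    qed
  qed
qed

text \<open>The functionals \<open>\<omega> b\<close> for \<open>b\<close> in a finite spanning set
  have the radical as their common kernel, so \<open>h\<close> is a combination of them; the same
  combination of the vectors \<open>b\<close> is \<open>u\<close>.\<close>

lemma functional_representable:
  assumes "skew_form \<omega>" "finite B" "V = span B" "linear h"
    and "\<And>z. z \<in> radical \<omega> V \<Longrightarrow> h z = 0"
  shows "\<exists>u\<in>V. \<forall>w\<in>V. \<omega> u w = h w"
proof -
  have V: "subspace V" using assms(3) by simp
  note lin = skew_form_linear_left[OF assms(1)]
  have "h z = 0" if z: "z \<in> V" "\<forall>b\<in>B. \<omega> b z = 0" for z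
  proof -
    have "\<omega> w z = 0" if "w \<in> V" for w
      using that unfolding assms(3)
      by (induction rule: span_induct_alt)
        (use z linear_0[OF lin] linear_add[OF lin] linear_scale[OF lin] in auto)
    then have "z \<in> radical \<omega> V"
      using z skew_form_swap[OF assms(1), of z] by (simp add: radical_def)
    then show ?thesis by (rule assms(5))
  qed
  then obtain c where c: "\<forall>z\<in>V. h z = (\<Sum>b\<in>B. c b * \<omega> b z)"
    using functional_in_span[of B V h \<omega>] assms(2,4) V skew_form_linear_right[OF assms(1)] by blast
  define u where "u = (\<Sum>b\<in>B. c b *\<^sub>R b)"
  have "u \<in> V" unfolding u_def assms(3) by (intro span_sum span_scale span_base)
  moreover have "\<omega> u w = (\<Sum>b\<in>B. c b * \<omega> b w)" for w
    unfolding u_def by (simp add: linear_sum[OF lin] linear_scale[OF lin])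
  ultimately show ?thesis using c by auto
qed

section \<open>Coordinates selected from nondegenerate sums of wedges\<close>

definition coordinates_on :: "('b \<Rightarrow> real) set \<Rightarrow> 'b set \<Rightarrow> bool" where
  "coordinates_on U I \<longleftrightarrow>
     (\<forall>t. \<exists>z\<in>U. \<forall>i\<in>I. z i = t i) \<and> (\<forall>z\<in>U. (\<forall>i\<in>I. z i = 0) \<longrightarrow> z = 0)"

text \<open>By Cramer's rule a combination of \<open>r\<close> and \<open>y\<close> takes prescribed
  values at \<open>f\<close> and \<open>g\<close>; the values on \<open>I\<close> are then corrected
  inside the common kernel.\<close>

lemma coordinates_on_insert_two:
  assumes "subspace U" "coordinates_on {z \<in> U. z f = 0 \<and> z g = 0} I"
    and "r \<in> U" "y \<in> U" "r f * y g \<noteq> y f * r g"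
  shows "coordinates_on U (insert f (insert g I))" "f \<notin> I" "g \<notin> I" "f \<noteq> g"
proof -
  let ?U = "{z \<in> U. z f = 0 \<and> z g = 0}"
  have surj: "\<exists>z\<in>?U. \<forall>i\<in>I. z i = t i" for t
    using assms(2) unfolding coordinates_on_def by blast
  \<comment> \<open>On vectors that vanish at \<open>f\<close> and \<open>g\<close>, all coordinates
    in \<open>I\<close> can still be made equal to 1.\<close>
  show "f \<notin> I" using surj[of "\<lambda>_. 1"] by fastforce
  show "g \<notin> I" using surj[of "\<lambda>_. 1"] by fastforce
  show "f \<noteq> g" using assms(5) by auto
  show "coordinates_on U (insert f (insert g I))"
    unfolding coordinates_on_def
  proof (intro conjI allI ballI impI)
    fix t
    define \<Delta> where "\<Delta> = r f * y g - y f * r g"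
    have \<Delta>: "\<Delta> \<noteq> 0" using assms(5) by (simp add: \<Delta>_def)
    define \<alpha> where "\<alpha> = (t f * y g - y f * t g) / \<Delta>"
    define \<beta> where "\<beta> = (r f * t g - t f * r g) / \<Delta>"
    define p where "p = \<alpha> *\<^sub>R r + \<beta> *\<^sub>R y"
    have "\<Delta> * p f = \<Delta> * t f" "\<Delta> * p g = \<Delta> * t g"
      using \<Delta> by (auto simp: p_def \<alpha>_def \<beta>_def field_simps) (auto simp: \<Delta>_def algebra_simps)
    then have pt: "p f = t f" "p g = t g" using \<Delta> by auto
    obtain z where z: "z \<in> ?U" "\<forall>i\<in>I. z i = t i - p i" using surj[of "\<lambda>i. t i - p i"] by blast
    have "p \<in> U" using assms by (simp add: p_def subspace_add subspace_scale)
    with z assms(1) have "z + p \<in> U" by (auto intro: subspace_add)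
    with z pt show "\<exists>z\<in>U. \<forall>i\<in>insert f (insert g I). z i = t i"
      by (intro bexI[of _ "z + p"]) auto
  next
    fix z assume "z \<in> U" "\<forall>i\<in>insert f (insert g I). z i = 0"
    then show "z = 0" using assms(2) unfolding coordinates_on_def by auto
  qed
qed

definition nondegenerate_on :: "('v::zero \<Rightarrow> 'v \<Rightarrow> real) \<Rightarrow> 'v set \<Rightarrow> bool" where
  "nondegenerate_on \<omega> U \<longleftrightarrow> radical \<omega> U \<subseteq> {0}"

text \<open>In terms of Pfaffians: a nonzero Pfaffian of a sum of wedges contains a nonzero term,
  which is a product of disjoint pairs. The induction removes one wedge of \<open>f\<close> and
  \<open>g\<close>. If nondegeneracy is lost, a radical vector \<open>r\<close> of the remainder
  sees the removed wedge only, and the remainder is nondegenerate on the common kernel of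
  \<open>f\<close> and \<open>g\<close>; so both join the coordinates found there.\<close>

lemma coordinates_from_nondegenerate_sum:
  fixes c :: "'b \<times> 'b \<Rightarrow> real" and U :: "('b \<Rightarrow> real) set"
  assumes "finite P" "\<And>a b. (a, b) \<in> P \<Longrightarrow> \<tau> a = \<tau> b" "subspace U"
    and "nondegenerate_on (\<lambda>z w. \<Sum>(a, b)\<in>P. c (a, b) * wedge (\<lambda>z. z a) (\<lambda>z. z b) z w) U"
  shows "\<exists>I. finite I \<and> I \<subseteq> fst ` P \<union> snd ` P \<and> coordinates_on U I \<and>
    (\<forall>v. even (card {i \<in> I. \<tau> i = v}))"
  using assms
proof (induction P arbitrary: U rule: finite_induct)
  case empty
  then have "U \<subseteq> {0}" by (simp add: nondegenerate_on_def radical_def)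
  moreover have "0 \<in> U" using empty(2) by (rule subspace_0)
  ultimately show ?case by (intro exI[of _ "{}"]) (auto simp: coordinates_on_def)
next
  case (insert e P)
  obtain f g where e: "e = (f, g)" by (cases e)
  let ?w = "\<lambda>P z w. \<Sum>(a, b)\<in>P. c (a, b) * wedge (\<lambda>z. z a) (\<lambda>z. z b) z (w :: 'b \<Rightarrow> real)"
  let ?k = "c (f, g)"
  have skew: "skew_form (?w P)" for P
    unfolding case_prod_unfold prod.collapse
    by (intro skew_form_sum skew_form_wedge linear_apply)
  note lin = skew_form_linear_left[OF skew[of "insert e P"]]
    and linR = skew_form_linear_right[OF skew[of "insert e P"]]
  have step: "?w (insert e P) z w = ?w P z w + ?k * wedge (\<lambda>z. z f) (\<lambda>z. z g) z w" for z w
    using insert.hyps by (simp add: e)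
  have nondeg: "z = 0" if "z \<in> U" "\<And>w. w \<in> U \<Longrightarrow> ?w (insert e P) z w = 0" for z
    using insert.prems(3) that unfolding nondegenerate_on_def radical_def by blast
  show ?case
  proof (cases "nondegenerate_on (?w P) U")
    case True
    then obtain I where "finite I" "I \<subseteq> fst ` P \<union> snd ` P" "coordinates_on U I"
      "\<forall>v. even (card {i \<in> I. \<tau> i = v})"
      using insert.IH[of U] insert.prems by auto
    then show ?thesis by (intro exI[of _ I]) auto
  next
    case False
    then obtain r where r: "r \<in> U" "r \<noteq> 0" "\<And>w. w \<in> U \<Longrightarrow> ?w P r w = 0"
      by (auto simp: nondegenerate_on_def radical_def)
    have rw: "?w (insert e P) r w = ?k * (r f * w g - r g * w f)" if "w \<in> U" for w
      unfolding step using r(3)[OF that] by (simp add: wedge_def)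
    obtain y where y: "y \<in> U" "?w (insert e P) r y \<noteq> 0" using nondeg[of r] r by blast
    then have k: "?k \<noteq> 0" and \<Delta>: "r f * y g \<noteq> y f * r g" using rw[of y] by auto
    define U' where "U' = {z \<in> U. z f = 0 \<and> z g = 0}"
    have U': "subspace U'" using insert.prems(2) by (auto simp: U'_def subspace_def)
    have "nondegenerate_on (?w P) U'"
      unfolding nondegenerate_on_def
    proof
      fix z assume z: "z \<in> radical (?w P) U'"
      then have zU: "z \<in> U" "z f = 0" "z g = 0" by (auto simp: radical_def U'_def)
      have zw: "?w (insert e P) z w = ?w P z w" for w
        unfolding step by (simp add: wedge_def zU)
      have zr: "?w (insert e P) z r = 0"
        using rw[OF zU(1)] zU skew_form_swap[OF skew[of "insert e P"], of z r] by simp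
      have zU': "?w (insert e P) z w = 0" if "w \<in> U'" for w
        unfolding zw using z that by (simp add: radical_def)
      define t where "t = ?w (insert e P) z y / ?w (insert e P) r y"
      \<comment> \<open>Both forms vanish on \<open>U'\<close> and on \<open>r\<close>, hence are proportional.\<close>
      have "?w (insert e P) (z - t *\<^sub>R r) w = 0" if w: "w \<in> U" for w
      proof -
        define \<Delta>' where "\<Delta>' = r f * y g - y f * r g"
        define \<alpha> where "\<alpha> = (w f * y g - y f * w g) / \<Delta>'"
        define \<beta> where "\<beta> = (r f * w g - w f * r g) / \<Delta>'"
        have \<Delta>': "\<Delta>' \<noteq> 0" using \<Delta> by (simp add: \<Delta>'_def)
        define w' where "w' = w - \<alpha> *\<^sub>R r - \<beta> *\<^sub>R y"
        have "\<Delta>' * w' f = 0" "\<Delta>' * w' g = 0"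
          using \<Delta>' by (auto simp: w'_def \<alpha>_def \<beta>_def field_simps) (auto simp: \<Delta>'_def algebra_simps)
        with \<Delta>' have f0: "w' f = 0" "w' g = 0" by auto
        moreover have "w' \<in> U"
          using w r(1) y(1) insert.prems(2) by (simp add: w'_def subspace_diff subspace_scale)
        ultimately have w'U: "w' \<in> U'" by (simp add: U'_def)
        have weq: "w = w' + \<alpha> *\<^sub>R r + \<beta> *\<^sub>R y" by (simp add: w'_def)
        have "?w (insert e P) z w = \<beta> * ?w (insert e P) z y"
          unfolding weq linear_add[OF linR] linear_scale[OF linR] using zr zU'[OF w'U] by simp
        moreover have "?w (insert e P) r w' = 0" using rw[of w'] f0 \<open>w' \<in> U\<close> by simp
        then have "?w (insert e P) r w = \<beta> * ?w (insert e P) r y"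
          unfolding weq linear_add[OF linR] linear_scale[OF linR]
          using skew_form_self[OF skew[of "insert e P"], of r] by simp
        ultimately show ?thesis
          using y(2) unfolding linear_diff[OF lin] linear_scale[OF lin] t_def
          by (simp del: sum.insert)
      qed
      then have "z - t *\<^sub>R r = 0"
        using nondeg[of "z - t *\<^sub>R r"] zU r(1) insert.prems(2)
        by (simp add: subspace_diff subspace_scale)
      then have eq: "z = t *\<^sub>R r" by simp
      with zU(2,3) \<Delta> have "t = 0" by auto
      with eq show "z \<in> {0}" by simp
    qed
    then obtain I where I: "finite I" "I \<subseteq> fst ` P \<union> snd ` P" "coordinates_on U' I"
      "\<forall>v. even (card {i \<in> I. \<tau> i = v})"
      using insert.IH[OF _ U'] insert.prems by auto
    note ins = coordinates_on_insert_two[OF insert.prems(2) I(3)[unfolded U'_def] r(1) y(1) \<Delta>]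
    have \<tau>: "\<tau> f = \<tau> g" using insert.prems(1)[of f g] by (simp add: e)
    have "even (card {i \<in> insert f (insert g I). \<tau> i = v})" for v
    proof (cases "\<tau> f = v")
      case True
      then have "{i \<in> insert f (insert g I). \<tau> i = v} = insert f (insert g {i \<in> I. \<tau> i = v})"
        using \<tau> by auto
      then show ?thesis using I ins by simp
    next
      case False
      then have "{i \<in> insert f (insert g I). \<tau> i = v} = {i \<in> I. \<tau> i = v}" using \<tau> by auto
      then show ?thesis using I by simp
    qed
    then show ?thesis
      using I ins(1) by (intro exI[of _ "insert f (insert g I)"]) (auto simp: e)
  qed
qed

text \<open>As a function of a single sign the Pfaffian is affine, and its slope is the Pfaffian on
  the common kernel of the pair, nonzero by induction. It cannot vanish at both 1 and -1. The proof
  phrases this with radical vectors \<open>p\<close> and \<open>q\<close> of the two supposedly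
  degenerate forms.\<close>

lemma nondegenerate_signs:
  fixes U :: "('b \<Rightarrow> real) set" and P :: "('b \<times> 'b) set"
  assumes "finite P" "inj_on fst P" "inj_on snd P" "fst ` P \<inter> snd ` P = {}"
    and "skew_form \<omega>" "subspace U" "coordinates_on U (fst ` P \<union> snd ` P)"
  shows "\<exists>\<epsilon>. (\<forall>p. \<epsilon> p = 1 \<or> \<epsilon> p = - 1) \<and>
    nondegenerate_on (\<lambda>z w. \<omega> z w + (\<Sum>(a, b)\<in>P. \<epsilon> (a, b) * wedge (\<lambda>z. z a) (\<lambda>z. z b) z w)) U"
  using assms
proof (induction P arbitrary: U rule: finite_induct)
  case empty
  then have "U \<subseteq> {0}" unfolding coordinates_on_def by auto
  then show ?case by (auto simp: nondegenerate_on_def radical_def intro!: exI[of _ "\<lambda>_. 1"])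
next
  case (insert e P)
  obtain f g where e: "e = (f, g)" by (cases e)
  define I where "I = fst ` P \<union> snd ` P"
  have fg: "f \<notin> I" "g \<notin> I" "f \<noteq> g"
    using insert.prems(1-3) insert.hyps(2) by (auto simp: I_def e)
  define U' where "U' = {z \<in> U. z f = 0 \<and> z g = 0}"
  have U': "subspace U'" using insert.prems(5) by (auto simp: U'_def subspace_def)
  have co: "coordinates_on U (insert f (insert g I))"
    using insert.prems(6) by (simp add: e I_def insert_commute)
  have surj: "\<exists>z\<in>U. \<forall>i\<in>insert f (insert g I). z i = t i" for t
    using co unfolding coordinates_on_def by blast
  have "coordinates_on U' I"
    unfolding coordinates_on_def
  proof (intro conjI allI ballI impI)
    fix t
    obtain z where "z \<in> U" "\<forall>i\<in>insert f (insert g I). z i = (t(f := 0, g := 0)) i"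
      using surj[of "t(f := 0, g := 0)"] by blast
    then show "\<exists>z\<in>U'. \<forall>i\<in>I. z i = t i"
      using fg by (intro bexI[of _ z]) (auto simp: U'_def)
  next
    fix z assume "z \<in> U'" "\<forall>i\<in>I. z i = 0"
    then show "z = 0" using co unfolding coordinates_on_def U'_def by auto
  qed
  then obtain \<epsilon> where \<epsilon>: "\<forall>p. \<epsilon> p = 1 \<or> \<epsilon> p = - 1"
    and nd: "nondegenerate_on (\<lambda>z w. \<omega> z w + (\<Sum>(a, b)\<in>P. \<epsilon> (a, b) * wedge (\<lambda>z. z a) (\<lambda>z. z b) z w)) U'"
    using insert.IH[OF _ _ _ insert.prems(4) U'] insert.prems(1-3) by (auto simp: I_def)
  define \<eta> where "\<eta> = (\<lambda>z w. \<omega> z w + (\<Sum>(a, b)\<in>P. \<epsilon> (a, b) * wedge (\<lambda>z. z a) (\<lambda>z. z b) z w))"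
  have skew: "skew_form \<eta>"
  proof -
    have "skew_form (\<lambda>z w. \<Sum>p\<in>P. \<epsilon> p * wedge (\<lambda>z. z (fst p)) (\<lambda>z. z (snd p)) z w)"
      by (intro skew_form_sum skew_form_wedge linear_apply)
    from skew_form_add_scaled[OF insert.prems(4) this, of 1] show ?thesis
      by (simp add: \<eta>_def case_prod_unfold)
  qed
  note lin = skew_form_linear_left[OF skew]
  let ?\<eta> = "\<lambda>s z w. \<eta> z w + s * (z f * w g - z g * w f)"
  have "\<exists>s\<in>{1, - 1}. nondegenerate_on (?\<eta> s) U"
  proof (rule ccontr)
    assume "\<not> ?thesis"
    then obtain p q where p: "p \<in> radical (?\<eta> 1) U" "p \<noteq> 0" and q: "q \<in> radical (?\<eta> (- 1)) U" "q \<noteq> 0"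
      by (auto simp: nondegenerate_on_def radical_def)
    have pU: "p \<in> U" "q \<in> U" using p q by (auto simp: radical_def)
    have pw: "\<eta> p w = - (p f * w g - p g * w f)" and qw: "\<eta> q w = q f * w g - q g * w f" if "w \<in> U" for w
      using p(1) q(1) that by (auto simp: radical_def algebra_simps)
    have nz: "z f \<noteq> 0 \<or> z g \<noteq> 0" if z: "z = p \<or> z = q" for z
    proof (rule ccontr)
      assume "\<not> ?thesis"
      then have "z \<in> radical \<eta> U'"
        using z pw qw pU by (auto simp: radical_def U'_def)
      then have "z = 0" using nd unfolding \<eta>_def nondegenerate_on_def by blast
      then show False using z p q by auto
    qed
    \<comment> \<open>Because the wedge enters with opposite signs for \<open>p\<close> and
      \<open>q\<close>, skewness of \<open>\<eta>\<close> forces their minor at \<open>f\<close> and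
      \<open>g\<close> to vanish.\<close>
    have "\<eta> p q = - \<eta> q p" by (rule skew_form_swap[OF skew])
    then have par: "p f * q g = p g * q f"
      using pw[of q] qw[of p] pU by (simp add: algebra_simps)
    obtain c where c: "p f = c * q f" "p g = c * q g"
    proof (cases "q f = 0")
      case True
      then have "q g \<noteq> 0" using nz[of q] by simp
      with True par show ?thesis by (intro that[of "p g / q g"]) auto
    next
      case False
      with par show ?thesis by (intro that[of "p f / q f"]) (auto simp: field_simps)
    qed
    have "p - c *\<^sub>R q \<in> U'"
      using c pU insert.prems(5) by (auto simp: U'_def subspace_diff subspace_scale)
    moreover have "\<eta> (p - c *\<^sub>R q) w = 0" if "w \<in> U'" for w
      using that pw[of w] qw[of w] linear_diff[OF lin] linear_scale[OF lin] by (simp add: U'_def)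
    ultimately have "p - c *\<^sub>R q = 0" using nd unfolding \<eta>_def nondegenerate_on_def radical_def by blast
    then have "\<eta> p w = c * \<eta> q w" for w using linear_scale[OF lin] by simp
    then have "p f * w g = p g * w f" if "w \<in> U" for w
      using pw[OF that] qw[OF that] c by (simp add: algebra_simps)
    moreover obtain w1 where "w1 \<in> U" "w1 f = 1" "w1 g = 0"
      using surj[of "\<lambda>i. if i = f then 1 else 0"] fg by auto
    moreover obtain w2 where "w2 \<in> U" "w2 f = 0" "w2 g = 1"
      using surj[of "\<lambda>i. if i = g then 1 else 0"] fg by auto
    ultimately have "p f = 0 \<and> p g = 0" by force
    then show False using nz by blast
  qed
  then obtain s where s: "s \<in> {1, - 1}" "nondegenerate_on (?\<eta> s) U" by blast
  have "\<omega> z w + (\<Sum>(a, b)\<in>insert e P. (\<epsilon>(e := s)) (a, b) * wedge (\<lambda>z. z a) (\<lambda>z. z b) z w) = ?\<eta> s z w" for z w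
  proof -
    have "(\<Sum>(a, b)\<in>P. (\<epsilon>(e := s)) (a, b) * wedge (\<lambda>z. z a) (\<lambda>z. z b) z w)
        = (\<Sum>(a, b)\<in>P. \<epsilon> (a, b) * wedge (\<lambda>z. z a) (\<lambda>z. z b) z w)"
      using insert.hyps(2) by (intro sum.cong) auto
    then show ?thesis using insert.hyps by (simp add: \<eta>_def e wedge_def)
  qed
  with s \<epsilon> show ?case by (intro exI[of _ "\<epsilon>(e := s)"]) auto
qed

subsection \<open>Cycle space and local forms\<close>

text \<open>Makes the kernel of \<open>f\<close> a complement of \<open>K\<close>: it meets
  \<open>K\<close> in 0 only, and as \<open>f\<close> takes all its values on \<open>K\<close>,
  every vector lies in the kernel up to an element of \<open>K\<close>. \<open>f\<close> is zero or
  the value at one arc.\<close>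

lemma dim_at_most_1_functional:
  fixes K :: "('b \<Rightarrow> real) set"
  assumes "subspace K" "dim_at_most (Suc 0) K"
  obtains f :: "('b \<Rightarrow> real) \<Rightarrow> real" where "linear f" "\<And>y. y \<in> K \<Longrightarrow> f y = 0 \<Longrightarrow> y = 0" "\<And>z. \<exists>k\<in>K. f z = f k"
proof (cases "K \<subseteq> {0}")
  case True
  then show ?thesis
    using subspace_0[OF assms(1)] by (intro that[of "\<lambda>_. 0"]) (auto simp: linear_zero)
next
  case False
  then obtain \<kappa> where \<kappa>: "\<kappa> \<in> K" "\<kappa> \<noteq> 0" by blast
  then obtain a where a: "\<kappa> a \<noteq> 0" by (auto simp: fun_eq_iff)
  show ?thesis
  proof (rule that[of "\<lambda>z. z a"])
    fix y assume y: "y \<in> K" "y a = 0"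
    then obtain c e where ce: "c \<noteq> 0 \<or> e \<noteq> 0" "c *\<^sub>R y + e *\<^sub>R \<kappa> = 0"
      using assms(2) \<kappa>(1) unfolding dim_at_most_1_iff by blast
    have "c * y a + e * \<kappa> a = 0" using fun_cong[OF ce(2), of a] by simp
    then have "e = 0" using y a by simp
    then show "y = 0" using ce by simp
  next
    fix z :: "'b \<Rightarrow> real"
    show "\<exists>k\<in>K. z a = k a"
      using a subspace_scale[OF assms(1) \<kappa>(1)] by (intro bexI[of _ "(z a / \<kappa> a) *\<^sub>R \<kappa>"]) auto
  qed (rule linear_apply)
qed

definition cycle_space :: "('a, 'b) pre_digraph \<Rightarrow> ('b \<Rightarrow> 'b) \<Rightarrow> ('b \<Rightarrow> real) set" where
  "cycle_space G r = {z. (\<forall>a. a \<notin> arcs G \<longrightarrow> z a = 0) \<and> (\<forall>a\<in>arcs G. z (r a) = - z a) \<and>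
     (\<forall>v\<in>verts G. (\<Sum>a\<in>out_arcs G v. z a) = 0)}"

definition local_form :: "('a, 'b) pre_digraph \<Rightarrow> ('b \<Rightarrow> 'b \<Rightarrow> real) \<Rightarrow> bool" where
  "local_form G x \<longleftrightarrow> (\<forall>a b. x b a = - x a b) \<and>
     (\<forall>a b. x a b \<noteq> 0 \<longrightarrow> a \<in> arcs G \<and> b \<in> arcs G \<and> tail G a = tail G b)"

definition form_of ::
  "('a, 'b) pre_digraph \<Rightarrow> ('b \<Rightarrow> 'b \<Rightarrow> real) \<Rightarrow> ('b \<Rightarrow> real) \<Rightarrow> ('b \<Rightarrow> real) \<Rightarrow> real" where
  "form_of G x z w = (\<Sum>a\<in>arcs G. \<Sum>b\<in>arcs G. x a b * z a * w b)"

definition form_radical ::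
  "('a, 'b) pre_digraph \<Rightarrow> ('b \<Rightarrow> 'b) \<Rightarrow> ('b \<Rightarrow> 'b \<Rightarrow> real) \<Rightarrow> ('b \<Rightarrow> real) set" where
  "form_radical G r x = radical (form_of G x) (cycle_space G r)"

text \<open>For a connected graph, \<open>I\<close> orients all edges outside some spanning tree,
  with at most one exception. The parity condition says that they can be grouped into pairs with a
  common tail, as in Xuong's characterisation of the maximum genus.\<close>

definition even_coordinates :: "('a, 'b) pre_digraph \<Rightarrow> ('b \<Rightarrow> 'b) \<Rightarrow> 'b set \<Rightarrow> bool" where
  "even_coordinates G r I \<longleftrightarrow> I \<subseteq> arcs G \<and>
     (\<forall>t. \<exists>z\<in>cycle_space G r. \<forall>i\<in>I. z i = t i) \<and>
     dim_at_most (Suc 0) {z \<in> cycle_space G r. \<forall>i\<in>I. z i = 0} \<and>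
     (\<forall>v. even (card {i \<in> I. tail G i = v}))"

lemma local_form_swap: "local_form G x \<Longrightarrow> x b a = - x a b"
  unfolding local_form_def by blast

lemma local_form_nonzeroD:
  "local_form G x \<Longrightarrow> x a b \<noteq> 0 \<Longrightarrow> a \<in> arcs G \<and> b \<in> arcs G \<and> tail G a = tail G b"
  unfolding local_form_def by blast

lemma subspace_cycle_space: "subspace (cycle_space G r)"
  unfolding subspace_def cycle_space_def
  by (auto simp: sum.distrib sum_distrib_left[symmetric])

lemma cycle_space_outside: "z \<in> cycle_space G r \<Longrightarrow> a \<notin> arcs G \<Longrightarrow> z a = 0"
  and cycle_space_rev: "z \<in> cycle_space G r \<Longrightarrow> a \<in> arcs G \<Longrightarrow> z (r a) = - z a"
  and cycle_space_sum: "z \<in> cycle_space G r \<Longrightarrow> v \<in> verts G \<Longrightarrow> (\<Sum>a\<in>out_arcs G v. z a) = 0"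
  by (auto simp: cycle_space_def)

lemma skew_form_form_of:
  assumes "local_form G x"
  shows "skew_form (form_of G x)"
proof (rule skew_formI)
  show "linear (form_of G x z)" for z
    by (rule linearI)
      (simp_all add: form_of_def sum.distrib distrib_left sum_distrib_left mult.left_commute mult.commute)
  fix z w
  have "form_of G x z w = (\<Sum>b\<in>arcs G. \<Sum>a\<in>arcs G. x a b * z a * w b)"
    unfolding form_of_def by (rule sum.swap)
  also have "\<dots> = (\<Sum>b\<in>arcs G. \<Sum>a\<in>arcs G. - (x b a * w b * z a))"
  proof (intro sum.cong refl)
    fix a b
    show "x a b * z a * w b = - (x b a * w b * z a)"
      using local_form_swap[OF assms, of a b] by simp
  qed
  finally show "form_of G x z w = - form_of G x w z"
    by (simp add: form_of_def sum_negf)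
qed

lemma form_of_add: "form_of G (\<lambda>a b. x a b + y a b) z w = form_of G x z w + form_of G y z w"
  by (simp add: form_of_def sum.distrib distrib_right)

lemma form_of_sum: "form_of G (\<lambda>a b. \<Sum>p\<in>P. x p a b) z w = (\<Sum>p\<in>P. form_of G (x p) z w)"
proof -
  have "form_of G (\<lambda>a b. \<Sum>p\<in>P. x p a b) z w = (\<Sum>a\<in>arcs G. \<Sum>b\<in>arcs G. \<Sum>p\<in>P. x p a b * z a * w b)"
    by (simp add: form_of_def sum_distrib_right)
  also have "\<dots> = (\<Sum>a\<in>arcs G. \<Sum>p\<in>P. \<Sum>b\<in>arcs G. x p a b * z a * w b)"
    by (intro sum.cong refl sum.swap)
  also have "\<dots> = (\<Sum>p\<in>P. \<Sum>a\<in>arcs G. \<Sum>b\<in>arcs G. x p a b * z a * w b)"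
    by (rule sum.swap)
  finally show ?thesis by (simp add: form_of_def)
qed

lemma local_form_sum:
  assumes "\<And>p. p \<in> P \<Longrightarrow> local_form G (x p)"
  shows "local_form G (\<lambda>a b. \<Sum>p\<in>P. x p a b)"
  unfolding local_form_def
proof (intro conjI allI impI)
  fix a b
  show "(\<Sum>p\<in>P. x p b a) = - (\<Sum>p\<in>P. x p a b)"
    unfolding sum_negf[symmetric]
  proof (rule sum.cong)
    show "x p b a = - x p a b" if "p \<in> P" for p by (rule local_form_swap[OF assms[OF that]])
  qed simp
  assume "(\<Sum>p\<in>P. x p a b) \<noteq> 0"
  then obtain p where "p \<in> P" "x p a b \<noteq> 0" by (meson sum.neutral)
  then show "a \<in> arcs G" "b \<in> arcs G" "tail G a = tail G b"
    using local_form_nonzeroD[OF assms] by blast+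
qed

definition arc_wedge :: "'b \<Rightarrow> 'b \<Rightarrow> 'b \<Rightarrow> 'b \<Rightarrow> real" where
  "arc_wedge f g a b = of_bool (a = f \<and> b = g) - of_bool (a = g \<and> b = f)"

lemma local_form_add_wedge:
  assumes "local_form G x" "f \<in> arcs G" "g \<in> arcs G" "tail G f = tail G g"
  shows "local_form G (\<lambda>a b. x a b + s * arc_wedge f g a b)"
  unfolding local_form_def
proof (intro conjI allI impI)
  fix a b
  show "x b a + s * arc_wedge f g b a = - (x a b + s * arc_wedge f g a b)"
    using local_form_swap[OF assms(1), of b a] by (simp add: arc_wedge_def conj_commute algebra_simps)
  assume "x a b + s * arc_wedge f g a b \<noteq> 0"
  then have "x a b \<noteq> 0 \<or> arc_wedge f g a b \<noteq> 0" by auto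
  then show "a \<in> arcs G" "b \<in> arcs G" "tail G a = tail G b"
    using local_form_nonzeroD[OF assms(1), of a b] assms(2-)
    by (auto simp: arc_wedge_def of_bool_def split: if_splits)
qed

lemma form_of_arc_wedge:
  assumes "finite (arcs G)" "f \<in> arcs G" "g \<in> arcs G"
  shows "form_of G (\<lambda>a b. s * arc_wedge f g a b) z w = s * wedge (\<lambda>z. z f) (\<lambda>z. z g) z w"
proof -
  have *: "(\<Sum>a\<in>arcs G. \<Sum>b\<in>arcs G. of_bool (a = f \<and> b = g) * (z a * w b)) = z f * w g"
    if "f \<in> arcs G" "g \<in> arcs G" for f g
  proof -
    have "(\<Sum>a\<in>arcs G. \<Sum>b\<in>arcs G. of_bool (a = f \<and> b = g) * (z a * w b))
        = (\<Sum>a\<in>arcs G. of_bool (a = f) * (\<Sum>b\<in>arcs G. of_bool (b = g) * (z a * w b)))"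
      by (simp add: sum_distrib_left of_bool_conj mult.assoc)
    also have "\<dots> = z f * w g"
      using that assms(1) by (simp add: of_bool_def if_distrib[of "\<lambda>c. c * _"] sum.delta cong: if_cong)
    finally show ?thesis .
  qed
  have "form_of G (\<lambda>a b. s * arc_wedge f g a b) z w
      = s * ((\<Sum>a\<in>arcs G. \<Sum>b\<in>arcs G. of_bool (a = f \<and> b = g) * (z a * w b))
        - (\<Sum>a\<in>arcs G. \<Sum>b\<in>arcs G. of_bool (a = g \<and> b = f) * (z a * w b)))"
    by (simp add: form_of_def arc_wedge_def sum_distrib_left sum_subtractf[symmetric] algebra_simps)
  then show ?thesis unfolding *[OF assms(2,3)] *[OF assms(3,2)] by (simp add: wedge_def)
qed

lemma form_of_add_wedge:
  assumes "finite (arcs G)" "f \<in> arcs G" "g \<in> arcs G"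
  shows "form_of G (\<lambda>a b. x a b + s * arc_wedge f g a b)
    = (\<lambda>z w. form_of G x z w + s * wedge (\<lambda>z. z f) (\<lambda>z. z g) z w)"
  by (intro ext) (simp add: form_of_add form_of_arc_wedge[OF assms])

text \<open>The linear algebra delivers parities only; this turns them back into disjoint pairs at
  common vertices.\<close>

lemma even_set_paired:
  assumes "finite I" "\<And>v. even (card {i \<in> I. \<tau> i = v})"
  shows "\<exists>P. finite P \<and> inj_on fst P \<and> inj_on snd P \<and> fst ` P \<inter> snd ` P = {} \<and>
    fst ` P \<union> snd ` P = I \<and> (\<forall>(a, b)\<in>P. \<tau> a = \<tau> b)"
  using assms
proof (induction "card I" arbitrary: I rule: less_induct)
  case less
  show ?case
  proof (cases "I = {}")
    case True
    then show ?thesis by (intro exI[of _ "{}"]) auto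
  next
    case False
    then obtain f where f: "f \<in> I" by blast
    let ?S = "{i \<in> I. \<tau> i = \<tau> f}"
    have "f \<in> ?S" "finite ?S" using f less.prems by auto
    moreover have "?S \<noteq> {f}"
    proof
      assume S: "?S = {f}"
      show False using less.prems(2)[of "\<tau> f"] unfolding S by simp
    qed
    ultimately obtain g where g: "g \<in> I" "\<tau> g = \<tau> f" "g \<noteq> f" by blast
    define J where "J = I - {f, g}"
    have I: "I = insert f (insert g J)" "f \<notin> J" "g \<notin> J" using f g by (auto simp: J_def)
    have "finite J" using less.prems by (simp add: J_def)
    have "even (card {i \<in> J. \<tau> i = v})" for v
    proof (cases "\<tau> f = v")
      case True
      then have "{i \<in> I. \<tau> i = v} = insert f (insert g {i \<in> J. \<tau> i = v})"
        unfolding I using g by auto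
      then show ?thesis using less.prems(2)[of v] I g \<open>finite J\<close> by simp
    next
      case False
      then have "{i \<in> I. \<tau> i = v} = {i \<in> J. \<tau> i = v}" unfolding I using g by auto
      then show ?thesis using less.prems(2)[of v] by simp
    qed
    moreover have "card J < card I" unfolding I(1) using I g \<open>finite J\<close> by simp
    ultimately obtain P where P: "finite P" "inj_on fst P" "inj_on snd P" "fst ` P \<inter> snd ` P = {}"
      "fst ` P \<union> snd ` P = J" "\<forall>(a, b)\<in>P. \<tau> a = \<tau> b"
      using less.hyps[of J] \<open>finite J\<close> by blast
    have fg: "f \<notin> fst ` P" "f \<notin> snd ` P" "g \<notin> fst ` P" "g \<notin> snd ` P"
      using P(5) I by blast+
    have "(f, g) \<notin> P" using fg by force
    then show ?thesis
      using P g I fg by (intro exI[of _ "insert (f, g) P"]) auto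
  qed
qed

section \<open>Orthogonality of cuts and cycles\<close>

context multigraph
begin

lemma cut_orthogonal_cycle:
  assumes "w \<in> cycle_space G r"
  shows "(\<Sum>p\<in>arcs G. \<phi> (tail G p) * w p) = 0"
proof -
  have "(\<Sum>p\<in>arcs G. \<phi> (tail G p) * w p) = (\<Sum>v\<in>verts G. \<Sum>p\<in>{p \<in> arcs G. tail G p = v}. \<phi> (tail G p) * w p)"
    by (rule sum.group[symmetric]) auto
  also have "\<dots> = (\<Sum>v\<in>verts G. \<phi> v * (\<Sum>p\<in>out_arcs G v. w p))"
    unfolding sum_distrib_left by (intro sum.cong) (auto simp: out_arcs_def)
  also have "\<dots> = 0" using cycle_space_sum[OF assms] by simp
  finally show ?thesis .
qed

lemma sum_arcs_reverse: "(\<Sum>p\<in>arcs G. h (r p)) = (\<Sum>p\<in>arcs G. h p)"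
  by (rule sum.reindex_bij_witness[of _ r r]) auto

lemma sum_reverse_cycle:
  assumes "w \<in> cycle_space G r"
  shows "(\<Sum>p\<in>arcs G. M (r p) * w p) = - (\<Sum>p\<in>arcs G. M p * w p)"
proof -
  have "(\<Sum>p\<in>arcs G. M p * w p) = (\<Sum>p\<in>arcs G. M (r p) * w (r p))"
    by (rule sum_arcs_reverse[symmetric])
  also have "\<dots> = (\<Sum>p\<in>arcs G. - (M (r p) * w p))"
    by (intro sum.cong) (auto simp: cycle_space_rev[OF assms])
  finally show ?thesis by (simp add: sum_negf)
qed

text \<open>Among antisymmetric functions the cycles are the common kernel of the vertex sums, so
  \<open>M\<close> acts there as a combination of vertex sums, with coefficients
  \<open>\<phi>\<close>. Testing on the function that is 1 at \<open>p\<close> and -1 at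
  \<open>r p\<close> reads off the difference; such functions see only the antisymmetric part of
  \<open>M\<close>.\<close>

lemma orthogonal_to_cycles_imp_cut:
  assumes "\<And>w. w \<in> cycle_space G r \<Longrightarrow> (\<Sum>p\<in>arcs G. M p * w p) = 0"
  shows "\<exists>\<phi>. \<forall>p\<in>arcs G. M p - M (r p) = \<phi> (tail G p) - \<phi> (head G p)"
proof -
  define W where "W = {w :: 'b \<Rightarrow> real. (\<forall>a. a \<notin> arcs G \<longrightarrow> w a = 0) \<and> (\<forall>a\<in>arcs G. w (r a) = - w a)}"
  define l where "l v w = (\<Sum>a\<in>out_arcs G v. w a)" for v and w :: "'b \<Rightarrow> real"
  have "subspace W" by (auto simp: W_def subspace_def)
  moreover have "linear (\<lambda>w. \<Sum>p\<in>arcs G. M p * w p)"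
    by (rule linearI) (simp_all add: sum.distrib distrib_left sum_distrib_left mult.left_commute)
  moreover have "linear (l v)" for v
    unfolding l_def by (rule linearI) (simp_all add: sum.distrib sum_distrib_left)
  moreover have "(\<Sum>p\<in>arcs G. M p * w p) = 0" if "w \<in> W" "\<forall>v\<in>verts G. l v w = 0" for w
    using that by (intro assms) (auto simp: cycle_space_def W_def l_def)
  ultimately obtain \<phi> where \<phi>: "\<And>w. w \<in> W \<Longrightarrow> (\<Sum>p\<in>arcs G. M p * w p) = (\<Sum>v\<in>verts G. \<phi> v * l v w)"
    using functional_in_span[of "verts G" W "\<lambda>w. \<Sum>p\<in>arcs G. M p * w p" l] by auto
  have "M p - M (r p) = \<phi> (tail G p) - \<phi> (head G p)" if p: "p \<in> arcs G" for p
  proof -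
    define w where "w a = of_bool (a = p) - (of_bool (a = r p) :: real)" for a
    have rp: "r p \<in> arcs G" using p by simp
    have "w \<in> W" using p rp by (auto simp: W_def w_def arev_eq_iff)
    have sw: "(\<Sum>a\<in>S. h a * w a) = (if p \<in> S then h p else 0) - (if r p \<in> S then h (r p) else 0)"
      if "finite S" for S h
      using that
      by (simp add: w_def right_diff_distrib sum_subtractf of_bool_def
          if_distrib[of "\<lambda>c. _ * c"] sum.delta cong: if_cong)
    have "(\<Sum>v\<in>verts G. \<phi> v * l v w)
        = (\<Sum>v\<in>verts G. \<phi> v * (of_bool (v = tail G p) - of_bool (v = head G p)))"
      using sw[of _ "\<lambda>_. 1"] p rp unfolding l_def by (intro sum.cong) (auto simp: finite_out_arcs)
    also have "\<dots> = \<phi> (tail G p) - \<phi> (head G p)"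
      using p by (simp add: right_diff_distrib sum_subtractf of_bool_def
          if_distrib[of "\<lambda>c. _ * c"] sum.delta cong: if_cong)
    finally show ?thesis using \<phi>[OF \<open>w \<in> W\<close>] sw[of "arcs G" M] p rp by simp
  qed
  then show ?thesis by blast
qed

text \<open>The factor 1/2 compensates for every pair of arcs occurring in both orders.\<close>

lemma form_of_eq_sum_wedge:
  assumes "local_form G x"
  shows "form_of G x = (\<lambda>z w. \<Sum>(a, b)\<in>{(a, b). a \<in> arcs G \<and> b \<in> arcs G \<and> tail G a = tail G b}.
    (\<lambda>(a, b). x a b / 2) (a, b) * wedge (\<lambda>z. z a) (\<lambda>z. z b) z w)"
proof (intro ext)
  fix z w
  let ?P = "{(a, b). a \<in> arcs G \<and> b \<in> arcs G \<and> tail G a = tail G b}"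
  have "finite ?P" by (rule finite_subset[of _ "arcs G \<times> arcs G"]) auto
  have 1: "form_of G x z w = (\<Sum>(a, b)\<in>?P. x a b * z a * w b)"
    unfolding form_of_def sum.cartesian_product
    by (rule sum.mono_neutral_cong_right)
      (use local_form_nonzeroD[OF assms] in \<open>auto simp: split_def\<close>)
  also have "\<dots> = (\<Sum>(a, b)\<in>?P. - (x a b * z b * w a))"
  proof (rule sum.reindex_bij_witness[of _ prod.swap prod.swap])
    fix p assume "p \<in> ?P"
    then show "(case prod.swap p of (a, b) \<Rightarrow> - (x a b * z b * w a)) = (case p of (a, b) \<Rightarrow> x a b * z a * w b)"
      using local_form_swap[OF assms, of "snd p" "fst p"] by (auto simp: split_def)
  qed auto
  finally have "2 * form_of G x z w = (\<Sum>(a, b)\<in>?P. x a b * z a * w b) + (\<Sum>(a, b)\<in>?P. - (x a b * z b * w a))"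
    using 1 by simp
  also have "\<dots> = 2 * (\<Sum>(a, b)\<in>?P. (\<lambda>(a, b). x a b / 2) (a, b) * wedge (\<lambda>z. z a) (\<lambda>z. z b) z w)"
    unfolding sum.distrib[symmetric] sum_distrib_left
    by (rule sum.cong) (auto simp: wedge_def algebra_simps)
  finally show "form_of G x z w = (\<Sum>(a, b)\<in>?P. (\<lambda>(a, b). x a b / 2) (a, b) * wedge (\<lambda>z. z a) (\<lambda>z. z b) z w)"
    by simp
qed

text \<open>The form is nondegenerate on the complement \<open>U\<close> of its radical. Coordinates
  of \<open>U\<close> leave, in the whole cycle space, only a space on which \<open>f\<close> is
  injective.\<close>

lemma even_coordinates_if_form:
  assumes x: "local_form G x" and d: "dim_at_most (Suc 0) (form_radical G r x)"
  shows "\<exists>I. even_coordinates G r I"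
proof -
  let ?Z = "cycle_space G r" and ?\<omega> = "form_of G x"
  have skew: "skew_form ?\<omega>" by (rule skew_form_form_of[OF x])
  have "subspace (form_radical G r x)"
    unfolding form_radical_def by (rule subspace_radical[OF skew subspace_cycle_space])
  then obtain f :: "('b \<Rightarrow> real) \<Rightarrow> real" where f: "linear f"
    "\<And>y. y \<in> form_radical G r x \<Longrightarrow> f y = 0 \<Longrightarrow> y = 0" "\<And>z. \<exists>k\<in>form_radical G r x. f z = f k"
    using d by (rule dim_at_most_1_functional) blast
  define U where "U = {z \<in> ?Z. f z = 0}"
  have U: "subspace U"
    using subspace_cycle_space[of G r] f(1)
    unfolding subspace_def U_def by (auto simp: linear_add linear_scale linear_0)
  have nd: "nondegenerate_on ?\<omega> U"
    unfolding nondegenerate_on_def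
  proof
    fix u assume u: "u \<in> radical ?\<omega> U"
    have "u \<in> form_radical G r x"
      unfolding form_radical_def radical_def
    proof (intro CollectI conjI ballI)
      show "u \<in> ?Z" using u by (simp add: radical_def U_def)
      fix w assume w: "w \<in> ?Z"
      obtain k where k: "k \<in> form_radical G r x" "f w = f k" using f(3) by blast
      then have "w - k \<in> U"
        using w f(1) subspace_diff[OF subspace_cycle_space w]
        by (auto simp: U_def form_radical_def radical_def linear_diff)
      then have "?\<omega> u (w - k) = 0" using u by (simp add: radical_def)
      moreover have "?\<omega> u k = 0"
        using k(1) \<open>u \<in> ?Z\<close> skew_form_swap[OF skew, of u k] by (simp add: form_radical_def radical_def)
      ultimately show "?\<omega> u w = 0"
        using skew_form_linear_right[OF skew, of u] by (simp add: linear_diff)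
    qed
    then show "u \<in> {0}" using f(2) u by (simp add: radical_def U_def)
  qed
  let ?P = "{(a, b). a \<in> arcs G \<and> b \<in> arcs G \<and> tail G a = tail G b}"
  have "finite ?P" by (rule finite_subset[of _ "arcs G \<times> arcs G"]) auto
  then obtain I where I: "finite I" "I \<subseteq> fst ` ?P \<union> snd ` ?P" "coordinates_on U I"
    "\<forall>v. even (card {i \<in> I. tail G i = v})"
    using coordinates_from_nondegenerate_sum[of ?P "tail G" U "\<lambda>(a, b). x a b / 2"] U nd
    unfolding form_of_eq_sum_wedge[OF x] by blast
  have "dim_at_most (Suc 0) {z \<in> ?Z. \<forall>i\<in>I. z i = 0}"
  proof (rule dim_at_most_codim_one[OF _ f(1)])
    show "subspace {z \<in> ?Z. \<forall>i\<in>I. z i = 0}"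
      using subspace_cycle_space[of G r] unfolding subspace_def by auto
  next
    fix y assume "y \<in> {z \<in> ?Z. \<forall>i\<in>I. z i = 0}" "f y = 0"
    then show "y = 0" using I(3) unfolding coordinates_on_def U_def by auto
  qed
  moreover have "I \<subseteq> arcs G" using I(2) by auto
  moreover have "\<exists>z\<in>?Z. \<forall>i\<in>I. z i = t i" for t
  proof -
    obtain z where "z \<in> U" "\<forall>i\<in>I. z i = t i" using I(3) unfolding coordinates_on_def by blast
    then show ?thesis unfolding U_def by blast
  qed
  ultimately show ?thesis using I(4) unfolding even_coordinates_def by blast
qed

end

subsection \<open>Rotations and faces\<close>

text \<open>The sum of the wedges of all \<open>a\<close>, \<open>b\<close> at a common vertex with
  \<open>a\<close> before \<open>b\<close>. On cycles it is, up to a constant factor, the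
  intersection form of the ribbon surface: two cycles crossing at a vertex contribute, two touching
  ones do not.\<close>

definition key_form :: "('a, 'b) pre_digraph \<Rightarrow> ('b \<Rightarrow> int) \<Rightarrow> 'b \<Rightarrow> 'b \<Rightarrow> real" where
  "key_form G key a b =
     (if a \<in> arcs G \<and> b \<in> arcs G \<and> tail G a = tail G b then of_int (sgn (key b - key a)) else 0)"

text \<open>The rotation visits the arcs at every vertex by increasing key and then starts over.\<close>

definition rotation_key :: "('a, 'b) pre_digraph \<Rightarrow> ('b \<Rightarrow> 'b) \<Rightarrow> ('b \<Rightarrow> int) \<Rightarrow> bool" where
  "rotation_key G s key \<longleftrightarrow> (\<forall>v\<in>verts G. inj_on key (out_arcs G v)) \<and>
     (\<forall>a\<in>arcs G. (\<forall>b\<in>out_arcs G (tail G a). key b < key (s a) \<longleftrightarrow> key b \<le> key a) \<or>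
        (\<forall>b\<in>out_arcs G (tail G a). key (s a) \<le> key b \<and> key b \<le> key a))"

text \<open>Connectedness in the form in which it is used, namely that a potential without jumps is
  constant; it also transfers directly to the split graph.\<close>

definition cut_connected :: "('a, 'b) pre_digraph \<Rightarrow> bool" where
  "cut_connected G \<longleftrightarrow>
     (\<forall>S. (\<forall>a\<in>arcs G. tail G a \<in> S \<longleftrightarrow> head G a \<in> S) \<longrightarrow> verts G \<subseteq> S \<or> verts G \<inter> S = {})"

lemma local_form_key_form: "local_form G (key_form G key)"
  unfolding local_form_def
proof (intro conjI allI impI)
  fix a b
  have "sgn (key a - key b) = - sgn (key b - key a)"
    by (cases "key a" "key b" rule: linorder_cases) auto
  then show "key_form G key b a = - key_form G key a b" unfolding key_form_def by auto
qed (auto simp: key_form_def split: if_splits)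

lemma cut_connectedD:
  assumes "cut_connected G" "u \<in> verts G" "v \<in> verts G"
    and "\<And>a. a \<in> arcs G \<Longrightarrow> \<phi> (tail G a) = \<phi> (head G a)"
  shows "\<phi> u = \<phi> v"
proof -
  have "\<forall>a\<in>arcs G. tail G a \<in> {x. \<phi> x = \<phi> u} \<longleftrightarrow> head G a \<in> {x. \<phi> x = \<phi> u}"
    using assms(4) by simp
  then have "verts G \<subseteq> {x. \<phi> x = \<phi> u} \<or> verts G \<inter> {x. \<phi> x = \<phi> u} = {}"
    using assms(1) unfolding cut_connected_def by blast
  then show ?thesis using assms(2,3) by force
qed

lemma cut_connected_if_connected:
  assumes "connected K"
  shows "cut_connected K"
  unfolding cut_connected_def
proof (intro allI impI)
  fix S assume S: "\<forall>a\<in>arcs K. tail K a \<in> S \<longleftrightarrow> head K a \<in> S"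
  have "u \<in> S \<longleftrightarrow> w \<in> S" if uw: "u \<in> verts K" "w \<in> verts K" for u w
  proof -
    have "u \<rightarrow>\<^sup>*\<^bsub>mk_symmetric K\<^esub> w"
      using assms uw unfolding connected_def strongly_connected_def by simp
    then have "(u, w) \<in> (parcs (mk_symmetric K))\<^sup>*"
      unfolding reachable_def by (auto dest: rtrancl_on_rtranclI)
    then show ?thesis
    proof (induction rule: rtrancl_induct)
      case (step p q)
      then obtain e where "e \<in> arcs K" "(p, q) = (tail K e, head K e) \<or> (p, q) = (head K e, tail K e)"
        unfolding parcs_mk_symmetric by blast
      then have "p \<in> S \<longleftrightarrow> q \<in> S" using S by auto
      with step.IH show ?case by simp
    qed simp
  qed
  then show "verts K \<subseteq> S \<or> verts K \<inter> S = {}" by blast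
qed

lemma orbit_invariant: "b \<in> orbit f a \<Longrightarrow> (\<And>x. x \<in> A \<Longrightarrow> \<psi> (f x) = \<psi> x \<and> f x \<in> A) \<Longrightarrow> a \<in> A \<Longrightarrow> \<psi> b = \<psi> a \<and> b \<in> A"
  by (induction rule: orbit.induct) auto

context multigraph
begin

lemma finite_out[simp]: "finite (out_arcs G v)"
  by (rule finite_subset[OF _ finite_arcs]) auto

text \<open>A discrete primitive of \<open>z\<close> around each vertex. It is consistent when the
  rotation starts over because the values of a cycle at a vertex sum to zero.\<close>

definition before :: "('b \<Rightarrow> int) \<Rightarrow> ('b \<Rightarrow> real) \<Rightarrow> 'b \<Rightarrow> real" where
  "before key z a = (\<Sum>b\<in>{b \<in> out_arcs G (tail G a). key b < key a}. z b)"

lemma rotation_cyclic: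
  assumes "rotation_system G s" "a \<in> arcs G"
  shows "cyclic_on s (out_arcs G (tail G a))"
proof -
  have "a \<in> out_arcs G (tail G a)" "tail G a \<in> verts G" using assms(2) by auto
  then show ?thesis using assms(1) unfolding rotation_system_def by blast
qed

lemma rotation_tail:
  assumes "rotation_system G s" "a \<in> arcs G"
  shows "s a \<in> arcs G" "tail G (s a) = tail G a"
proof -
  have "s a \<in> out_arcs G (tail G a)"
    using assms(2) by (intro cyclic_on_inI[OF rotation_cyclic[OF assms]]) simp
  then show "s a \<in> arcs G" "tail G (s a) = tail G a" by auto
qed

lemma rotation_invariant:
  assumes "rotation_system G s" "\<And>a. a \<in> arcs G \<Longrightarrow> \<psi> (s a) = \<psi> a"
    and "a \<in> arcs G" "b \<in> arcs G" "tail G a = tail G b"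
  shows "\<psi> a = \<psi> b"
proof -
  have "a \<in> out_arcs G (tail G a)" "b \<in> out_arcs G (tail G a)" using assms(3-5) by auto
  then have "b \<in> orbit s a"
    using rotation_cyclic[OF assms(1,3)] unfolding cyclic_on_alldef by blast
  from orbit_invariant[OF this, of "arcs G" \<psi>] show ?thesis
    using assms rotation_tail by auto
qed

text \<open>Arcs before \<open>b\<close> count positively and those after \<open>b\<close>
  negatively; as the total at the vertex is zero, the latter are expressed by the former.\<close>

lemma key_form_eq:
  assumes "rotation_key G s key" "z \<in> cycle_space G r"
  shows "form_of G (key_form G key) z w = (\<Sum>b\<in>arcs G. (2 * before key z b + z b) * w b)"
proof -
  have "form_of G (key_form G key) z w = (\<Sum>b\<in>arcs G. \<Sum>a\<in>arcs G. key_form G key a b * z a * w b)"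
    unfolding form_of_def by (rule sum.swap)
  also have "\<dots> = (\<Sum>b\<in>arcs G. (2 * before key z b + z b) * w b)"
  proof (intro sum.cong refl)
    fix b assume b: "b \<in> arcs G"
    let ?O = "out_arcs G (tail G b)"
    have inj: "inj_on key ?O" using assms(1) b unfolding rotation_key_def by auto
    have bO: "b \<in> ?O" using b by simp
    have eq: "key a = key b \<longleftrightarrow> a = b" if "a \<in> ?O" for a
      using inj_onD[OF inj _ that bO] by auto
    have "(\<Sum>a\<in>arcs G. key_form G key a b * z a) = (\<Sum>a\<in>?O. of_int (sgn (key b - key a)) * z a)"
      using b by (intro sum.mono_neutral_cong_right) (auto simp: key_form_def)
    also have "\<dots> = (\<Sum>a\<in>?O. 2 * (if key a < key b then z a else 0) + (if a = b then z a else 0) - z a)"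
    proof (rule sum.cong)
      fix a assume "a \<in> ?O"
      then show "of_int (sgn (key b - key a)) * z a
          = 2 * (if key a < key b then z a else 0) + (if a = b then z a else 0) - z a"
        using eq[of a] by (cases "key a" "key b" rule: linorder_cases) auto
    qed simp
    also have "\<dots> = 2 * (\<Sum>a\<in>?O. if key a < key b then z a else 0) + (\<Sum>a\<in>?O. if a = b then z a else 0) - (\<Sum>a\<in>?O. z a)"
      by (simp only: sum_subtractf sum.distrib sum_distrib_left)
    also have "(\<Sum>a\<in>?O. if key a < key b then z a else 0) = before key z b"
      unfolding before_def by (rule sum.inter_filter[symmetric]) simp
    also have "(\<Sum>a\<in>?O. if a = b then z a else 0) = z b"
      using bO by (simp add: sum.delta)
    also have "(\<Sum>a\<in>?O. z a) = 0" using cycle_space_sum[OF assms(2)] b by simp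
    finally have "(\<Sum>a\<in>arcs G. key_form G key a b * z a) = 2 * before key z b + z b" by simp
    then show "(\<Sum>a\<in>arcs G. key_form G key a b * z a * w b) = (2 * before key z b + z b) * w b"
      by (simp add: sum_distrib_right[symmetric])
  qed
  finally show ?thesis .
qed

lemma before_step:
  assumes "rotation_system G s" "rotation_key G s key" "z \<in> cycle_space G r" "a \<in> arcs G"
  shows "before key z (s a) = before key z a + z a"
proof -
  let ?O = "out_arcs G (tail G a)"
  have inj: "inj_on key ?O" using assms(2,4) unfolding rotation_key_def by auto
  have aO: "a \<in> ?O" using assms(4) by simp
  have le: "{b \<in> ?O. key b \<le> key a} = insert a {b \<in> ?O. key b < key a}"
  proof (intro equalityI subsetI)
    fix b assume b: "b \<in> {b \<in> ?O. key b \<le> key a}"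
    then have "key b < key a \<or> b = a" using inj_onD[OF inj _ _ aO, of b] by fastforce
    then show "b \<in> insert a {b \<in> ?O. key b < key a}" using b by blast
  qed (use aO in auto)
  have s: "(\<Sum>b\<in>{b \<in> ?O. key b \<le> key a}. z b) = before key z a + z a"
    unfolding le before_def by simp
  note tl = rotation_tail[OF assms(1,4)]
  consider "\<forall>b\<in>?O. key b < key (s a) \<longleftrightarrow> key b \<le> key a" | "\<forall>b\<in>?O. key (s a) \<le> key b \<and> key b \<le> key a"
    using assms(2,4) unfolding rotation_key_def by blast
  then show ?thesis
  proof cases
    case 1
    then have "{b \<in> ?O. key b < key (s a)} = {b \<in> ?O. key b \<le> key a}" by auto
    then show ?thesis using s by (simp add: before_def tl)
  next
    case 2
    then have "{b \<in> ?O. key b < key (s a)} = {}" "{b \<in> ?O. key b \<le> key a} = ?O" by force+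
    moreover have "(\<Sum>b\<in>?O. z b) = 0" using cycle_space_sum[OF assms(3)] assms(4) by simp
    ultimately show ?thesis using s by (simp only: before_def tl) simp
  qed
qed

text \<open>Membership in the radical makes \<open>2 * before key z b + z b\<close> orthogonal to
  all cycles, so its antisymmetric part is a potential difference. Half of the potential corrects
  \<open>before\<close> to a function that is constant along faces, and \<open>z\<close> is the jump
  of this function across an edge.\<close>

lemma radical_key_form_face_function:
  assumes "rotation_system G s" "rotation_key G s key" "z \<in> form_radical G r (key_form G key)"
  shows "\<exists>\<psi>. \<forall>a\<in>arcs G. \<psi> (s (r a)) = \<psi> a \<and> z a = \<psi> (s a) - \<psi> a"
proof -
  have z: "z \<in> cycle_space G r" using assms(3) by (simp add: form_radical_def radical_def)
  have "(\<Sum>b\<in>arcs G. (2 * before key z b + z b) * w b) = 0" if "w \<in> cycle_space G r" for w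
    using assms(3) that key_form_eq[OF assms(2) z, of w] by (simp add: form_radical_def radical_def)
  then obtain \<phi> where \<phi>: "\<And>p. p \<in> arcs G \<Longrightarrow> (2 * before key z p + z p) - (2 * before key z (r p) + z (r p))
      = \<phi> (tail G p) - \<phi> (head G p)"
    using orthogonal_to_cycles_imp_cut[of "\<lambda>b. 2 * before key z b + z b"] by blast
  define \<psi> where "\<psi> a = before key z a - \<phi> (tail G a) / 2" for a
  have step: "\<psi> (s a) = \<psi> a + z a" if "a \<in> arcs G" for a
    using before_step[OF assms(1,2) z that] rotation_tail[OF assms(1) that] by (simp add: \<psi>_def)
  have "\<psi> (s (r a)) = \<psi> a" if a: "a \<in> arcs G" for a
    using step[of "r a"] \<phi>[OF a] cycle_space_rev[OF z a] a by (simp add: \<psi>_def field_simps)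
  with step show ?thesis by (intro exI[of _ \<psi>]) auto
qed

text \<open>\<open>before\<close> differs from \<open>\<psi>\<close> by a vertex function, since
  both have the increment \<open>z\<close> along the rotation. The functional of \<open>z\<close> is
  therefore a cut plus the function \<open>\<psi> b + \<psi> (r b)\<close>, which is symmetric under
  reversal; both vanish on cycles.\<close>

lemma face_function_radical:
  assumes "rotation_system G s" "rotation_key G s key" "\<And>a. a \<in> arcs G \<Longrightarrow> \<psi> (s (r a)) = \<psi> a"
  shows "(\<lambda>a. if a \<in> arcs G then \<psi> (s a) - \<psi> a else 0) \<in> form_radical G r (key_form G key)"
proof -
  let ?z = "\<lambda>a. if a \<in> arcs G then \<psi> (s a) - \<psi> a else (0::real)"
  have \<psi>r: "\<psi> (s a) = \<psi> (r a)" if "a \<in> arcs G" for a using assms(3)[of "r a"] that by simp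
  have z: "?z \<in> cycle_space G r"
    unfolding cycle_space_def
  proof (intro CollectI conjI allI ballI impI)
    fix a assume a: "a \<in> arcs G"
    then show "?z (r a) = - ?z a" using \<psi>r[of a] \<psi>r[of "r a"] by simp
  next
    fix v assume v: "v \<in> verts G"
    have "s permutes arcs G" using assms(1) by (simp add: rotation_system_def)
    then have "inj_on s (out_arcs G v)" by (meson permutes_inj inj_on_subset subset_UNIV)
    moreover have "s ` out_arcs G v \<subseteq> out_arcs G v" using rotation_tail[OF assms(1)] by auto
    ultimately have "s ` out_arcs G v = out_arcs G v" by (simp add: endo_inj_surj)
    with \<open>inj_on s (out_arcs G v)\<close> have "(\<Sum>a\<in>out_arcs G v. \<psi> (s a)) = (\<Sum>a\<in>out_arcs G v. \<psi> a)"
      using sum.reindex[of s "out_arcs G v" \<psi>] by simp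
    then show "(\<Sum>a\<in>out_arcs G v. ?z a) = 0"
      by (simp add: sum_subtractf out_arcs_def)
  qed auto
  define \<Delta> where "\<Delta> a = before key ?z a - \<psi> a" for a
  have inv: "\<Delta> (s a) = \<Delta> a" if "a \<in> arcs G" for a
    using before_step[OF assms(1,2) z that] that by (simp add: \<Delta>_def)
  define \<phi> where "\<phi> v = \<Delta> (SOME a. a \<in> out_arcs G v)" for v
  have \<phi>: "before key ?z a = \<phi> (tail G a) + \<psi> a" if a: "a \<in> arcs G" for a
  proof -
    define b where "b = (SOME b. b \<in> out_arcs G (tail G a))"
    have b: "b \<in> out_arcs G (tail G a)" unfolding b_def by (rule someI[of "\<lambda>b. b \<in> out_arcs G (tail G a)" a]) (simp add: a)
    have "\<Delta> b = \<Delta> a"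
      by (rule rotation_invariant[OF assms(1), where \<psi> = \<Delta>]) (use a b inv in auto)
    then show ?thesis by (simp add: \<phi>_def b_def \<Delta>_def)
  qed
  have "form_of G (key_form G key) ?z w = 0" if w: "w \<in> cycle_space G r" for w
  proof -
    have "form_of G (key_form G key) ?z w
        = (\<Sum>b\<in>arcs G. 2 * (\<phi> (tail G b) * w b) + (\<psi> b * w b + \<psi> (r b) * w b))"
      unfolding key_form_eq[OF assms(2) z]
      using \<phi> \<psi>r by (intro sum.cong) (auto simp: algebra_simps)
    also have "\<dots> = 2 * (\<Sum>b\<in>arcs G. \<phi> (tail G b) * w b)
        + ((\<Sum>b\<in>arcs G. \<psi> b * w b) + (\<Sum>b\<in>arcs G. \<psi> (r b) * w b))"
      by (simp only: sum.distrib sum_distrib_left)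
    also have "\<dots> = 0" using cut_orthogonal_cycle[OF w] sum_reverse_cycle[OF w] by simp
    finally show ?thesis .
  qed
  with z show ?thesis by (simp add: form_radical_def radical_def)
qed

lemma face_perm_permutes:
  assumes "rotation_system G s"
  shows "s \<circ> r permutes arcs G"
  using assms arev_permutes_arcs unfolding rotation_system_def by (auto intro: permutes_compose)

lemma face_perm_permutation:
  assumes "rotation_system G s"
  shows "permutation (s \<circ> r)"
  using face_perm_permutes[OF assms] finite_arcs permutation_permutes by blast

lemma face_function_const:
  assumes "rotation_system G s" "\<And>a. a \<in> arcs G \<Longrightarrow> \<psi> (s (r a)) = \<psi> a"
    and "a \<in> arcs G" "b \<in> arcs G" "orbit (s \<circ> r) a = orbit (s \<circ> r) b"
  shows "\<psi> a = \<psi> b"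
proof -
  have "a \<in> orbit (s \<circ> r) b"
    using permutation_self_in_orbit[OF face_perm_permutation[OF assms(1)], of a] assms(5) by simp
  from orbit_invariant[OF this, of "arcs G" \<psi>] show ?thesis
    using assms rotation_tail[OF assms(1)] by auto
qed

text \<open>Jumps of a face function depend only on the difference of its two values. The faces
  \<open>X\<close> and \<open>Y\<close> may coincide, and then all jumps vanish.\<close>

lemma dim_radical_if_two_faces:
  assumes "rotation_system G s" "rotation_key G s key" "card (faces G r s) \<le> 2" "arcs G \<noteq> {}"
  shows "dim_at_most (Suc 0) (form_radical G r (key_form G key))"
  unfolding dim_at_most_1_iff
proof (intro ballI)
  have "finite (faces G r s)" by (simp add: faces_def)
  then have "card (faces G r s) \<noteq> 0" using assms(4) by (simp add: faces_def)
  with assms(3) have "card (faces G r s) = 1 \<or> card (faces G r s) = 2" by linarith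
  then obtain X Y where XY: "faces G r s = {X, Y}"
    by (auto simp: card_1_singleton_iff card_2_iff)
  then have "X \<in> faces G r s" "Y \<in> faces G r s" by simp_all
  then obtain p q where pq: "p \<in> arcs G" "q \<in> arcs G" "X = orbit (s \<circ> r) p" "Y = orbit (s \<circ> r) q"
    unfolding faces_def by blast
  have pq3: "orbit (s \<circ> r) a = orbit (s \<circ> r) p \<or> orbit (s \<circ> r) a = orbit (s \<circ> r) q" if "a \<in> arcs G" for a
  proof -
    have "orbit (s \<circ> r) a \<in> {X, Y}" using that unfolding XY[symmetric] faces_def by blast
    then show ?thesis using pq by simp
  qed
  fix z w assume zw: "z \<in> form_radical G r (key_form G key)" "w \<in> form_radical G r (key_form G key)"
  obtain \<psi> \<chi> where \<psi>: "\<And>a. a \<in> arcs G \<Longrightarrow> \<psi> (s (r a)) = \<psi> a" "\<And>a. a \<in> arcs G \<Longrightarrow> z a = \<psi> (s a) - \<psi> a"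
    and \<chi>: "\<And>a. a \<in> arcs G \<Longrightarrow> \<chi> (s (r a)) = \<chi> a" "\<And>a. a \<in> arcs G \<Longrightarrow> w a = \<chi> (s a) - \<chi> a"
    using radical_key_form_face_function[OF assms(1,2) zw(1)] radical_key_form_face_function[OF assms(1,2) zw(2)]
    by blast
  have out: "z a = 0" "w a = 0" if "a \<notin> arcs G" for a
    using zw that by (auto simp: form_radical_def radical_def cycle_space_def)
  obtain c d where cd: "c \<noteq> 0 \<or> d \<noteq> 0" "c * (\<psi> p - \<psi> q) + d * (\<chi> p - \<chi> q) = 0"
  proof (cases "\<psi> p = \<psi> q")
    case True
    then show ?thesis by (intro that[of 1 0]) auto
  next
    case False
    then show ?thesis by (intro that[of "\<chi> p - \<chi> q" "- (\<psi> p - \<psi> q)"]) (auto simp: algebra_simps)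
  qed
  have cp: "c * \<psi> a + d * \<chi> a = c * \<psi> p + d * \<chi> p" if a: "a \<in> arcs G" for a
    using pq3[OF a]
  proof
    assume o: "orbit (s \<circ> r) a = orbit (s \<circ> r) p"
    show ?thesis
      using face_function_const[of s \<psi>, OF assms(1) \<psi>(1) a pq(1) o] face_function_const[of s \<chi>, OF assms(1) \<chi>(1) a pq(1) o]
      by simp
  next
    assume o: "orbit (s \<circ> r) a = orbit (s \<circ> r) q"
    show ?thesis
      using face_function_const[of s \<psi>, OF assms(1) \<psi>(1) a pq(2) o] face_function_const[of s \<chi>, OF assms(1) \<chi>(1) a pq(2) o] cd(2)
      by (simp add: algebra_simps)
  qed
  have "c * z a + d * w a = 0" for a
  proof (cases "a \<in> arcs G")
    case True
    have "c * z a + d * w a = (c * \<psi> (s a) + d * \<chi> (s a)) - (c * \<psi> a + d * \<chi> a)"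
      using \<psi>(2)[OF True] \<chi>(2)[OF True] by (simp add: right_diff_distrib)
    then show ?thesis using cp[of a] cp[of "s a"] True rotation_tail[OF assms(1)] by simp
  qed (simp add: out)
  with cd(1) show "\<exists>c d. (c \<noteq> 0 \<or> d \<noteq> 0) \<and> c *\<^sub>R z + d *\<^sub>R w = 0"
    by (intro exI[of _ c] exI[of _ d]) (auto simp: fun_eq_iff)
qed

text \<open>Invariance under \<open>s\<close> and under \<open>s \<circ> r\<close> gives invariance
  under \<open>r\<close>; so \<open>\<chi>\<close> descends to a vertex function without
  jumps.\<close>

lemma rotation_face_invariant_const:
  assumes "cut_connected G" "rotation_system G s"
    and s: "\<And>a. a \<in> arcs G \<Longrightarrow> \<chi> (s a) = \<chi> a"
    and f: "\<And>a. a \<in> arcs G \<Longrightarrow> \<chi> (s (r a)) = \<chi> a"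
    and ab: "a \<in> arcs G" "b \<in> arcs G"
  shows "\<chi> a = \<chi> b"
proof -
  have rr: "\<chi> (r a) = \<chi> a" if "a \<in> arcs G" for a
    using s[of "r a"] f[of a] that by simp
  define \<phi> where "\<phi> v = \<chi> (SOME a. a \<in> out_arcs G v)" for v
  have \<phi>: "\<phi> (tail G a) = \<chi> a" if a: "a \<in> arcs G" for a
  proof -
    define b where "b = (SOME b. b \<in> out_arcs G (tail G a))"
    have b: "b \<in> out_arcs G (tail G a)"
      unfolding b_def by (rule someI[of "\<lambda>b. b \<in> out_arcs G (tail G a)" a]) (simp add: a)
    have "\<chi> b = \<chi> a" by (rule rotation_invariant[OF assms(2), where \<psi> = \<chi>]) (use a b s in auto)
    then show ?thesis by (simp add: \<phi>_def b_def)
  qed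
  have "\<phi> (tail G a) = \<phi> (tail G b)"
  proof (rule cut_connectedD[OF assms(1), where \<phi> = \<phi>])
    fix p assume p: "p \<in> arcs G"
    then show "\<phi> (tail G p) = \<phi> (head G p)"
      using \<phi>[OF p] \<phi>[of "r p"] rr[OF p] by simp
  qed (use ab in auto)
  then show ?thesis using \<phi> ab by simp
qed

text \<open>Of three faces, the boundaries of two are independent: a relation is a face function
  that is also invariant under the rotation, hence constant, and it is 0 on the third face.\<close>

lemma two_faces_if_dim_radical:
  assumes "cut_connected G" "rotation_system G s" "rotation_key G s key"
    and d: "dim_at_most (Suc 0) (form_radical G r (key_form G key))"
  shows "card (faces G r s) \<le> 2"
proof (rule ccontr)
  assume "\<not> ?thesis"
  then obtain F where F: "F \<subseteq> faces G r s" "card F = 3"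
    using obtain_subset_with_card_n[of 3 "faces G r s"] by auto
  obtain X Y W where "F = {X, Y, W}" and XYW: "X \<noteq> Y" "Y \<noteq> W" "X \<noteq> W"
    using F(2) by (auto simp: card_3_iff)
  then have XYWF: "X \<in> faces G r s" "Y \<in> faces G r s" "W \<in> faces G r s" using F(1) by auto
  let ?f = "s \<circ> r"
  define \<psi> where "\<psi> Q a = (of_bool (orbit ?f a = Q) :: real)" for Q a
  define z where "z Q a = (if a \<in> arcs G then \<psi> Q (s a) - \<psi> Q a else 0)" for Q a
  have inv: "\<psi> Q (s (r a)) = \<psi> Q a" for Q a
    using permutation_orbit_step[OF face_perm_permutation[OF assms(2)], of a] by (simp add: \<psi>_def)
  have "z Q \<in> form_radical G r (key_form G key)" for Q
    unfolding z_def by (rule face_function_radical[OF assms(2,3), where \<psi> = "\<psi> Q"]) (rule inv)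
  then obtain c e where ce: "c \<noteq> 0 \<or> e \<noteq> 0" "c *\<^sub>R z X + e *\<^sub>R z Y = 0"
    using d unfolding dim_at_most_1_iff by blast
  define \<chi> where "\<chi> a = c * \<psi> X a + e * \<psi> Y a" for a
  have s: "\<chi> (s a) = \<chi> a" if "a \<in> arcs G" for a
    using fun_cong[OF ce(2), of a] that by (simp add: z_def \<chi>_def algebra_simps)
  note const = rotation_face_invariant_const[OF assms(1,2), where \<chi> = \<chi>]
  have inv\<chi>: "\<chi> (s (r a)) = \<chi> a" if "a \<in> arcs G" for a
    using inv by (simp add: \<chi>_def)
  obtain x y w where xyw: "x \<in> arcs G" "y \<in> arcs G" "w \<in> arcs G"
    "orbit ?f x = X" "orbit ?f y = Y" "orbit ?f w = W"
    using XYWF unfolding faces_def by (auto elim!: imageE)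
  have vals: "\<chi> x = c" "\<chi> y = e" "\<chi> w = 0" using xyw XYW by (auto simp: \<chi>_def \<psi>_def)
  have "c = 0" using const[OF s inv\<chi> xyw(1,3)] unfolding vals by simp
  moreover have "e = 0" using const[OF s inv\<chi> xyw(2,3)] unfolding vals by simp
  ultimately show False using ce(1) by blast
qed

end

section \<open>The sign of a permutation and its number of cycles\<close>

lemma orbit_transpose_skip:
  assumes "p permutes A" "p a \<noteq> a"
  defines "q \<equiv> transpose a (p a) \<circ> p"
  shows "orbit q a = {a}" "x \<noteq> a \<Longrightarrow> orbit q x = orbit p x - {a}"
proof -
  have inj: "p y = p a \<longleftrightarrow> y = a" for y using assms(1) by (simp add: permutes_inj inj_eq)
  have qa: "q a = a" by (simp add: q_def)
  have q1: "q y = p a" if "p y = a" for y using that by (simp add: q_def)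
  have q2: "q y = p y" if "p y \<noteq> a" "y \<noteq> a" for y using that inj by (simp add: q_def transpose_def)
  show "orbit q a = {a}" using qa by (simp add: orbit_eq_singleton_iff)
  assume x: "x \<noteq> a"
  have step: "q y \<in> orbit p x - {a}" if "p y \<in> orbit p x" "y \<noteq> a" for y
  proof (cases "p y = a")
    case True
    then show ?thesis using q1[OF True] assms(2) orbit.step[OF that(1)] by simp
  next
    case False
    then show ?thesis using q2[OF False] that by simp
  qed
  show "orbit q x = orbit p x - {a}"
  proof (intro equalityI subsetI)
    fix y assume "y \<in> orbit q x"
    then show "y \<in> orbit p x - {a}"
    proof induction
      case base
      show ?case using step[of x] x orbit.base[of p x] by blast
    next
      case (step y)
      then show ?case using \<open>\<And>y. _ \<Longrightarrow> _ \<Longrightarrow> q y \<in> _\<close>[of y] orbit.step[of y p x] by blast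
    qed
  next
    fix y assume y: "y \<in> orbit p x - {a}"
    have "(z \<noteq> a \<longrightarrow> z \<in> orbit q x) \<and> (z = a \<longrightarrow> p a \<in> orbit q x)" if "z \<in> orbit p x" for z
      using that
    proof induction
      case base
      show ?case using orbit.base[of q x] q1[of x] q2[of x] x by (cases "p x = a") auto
    next
      case (step z)
      show ?case
      proof (cases "z = a")
        case True
        then show ?thesis using step.IH assms(2) by simp
      next
        case False
        then have "q z \<in> orbit q x" using step.IH orbit.step[of z q x] by blast
        then show ?thesis using q1[of z] q2[of z] False by (cases "p z = a") auto
      qed
    qed
    then show "y \<in> orbit q x" using y by blast
  qed
qed

text \<open>\<open>q\<close> bypasses \<open>a\<close>: the cycle of \<open>a\<close> falls apart
  into the fixed point \<open>a\<close> and a remainder, which is nonempty because it contains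
  \<open>p a\<close>. All other cycles are kept.\<close>

lemma card_orbits_transpose_skip:
  assumes "p permutes A" "finite A" "p a \<noteq> a"
  defines "q \<equiv> transpose a (p a) \<circ> p"
  shows "card (orbit q ` A) = Suc (card (orbit p ` A))"
proof -
  note skip = orbit_transpose_skip[OF assms(1,3), folded q_def]
  have perm: "permutation p" using assms(1,2) permutation_permutes by blast
  have a: "a \<in> A" "p a \<in> A" using assms(1,3) permutes_not_in[of p A a] permutes_in_image[of p A a] by auto
  have "orbit q ` A = insert {a} ((\<lambda>X. X - {a}) ` (orbit p ` A))"
  proof (intro equalityI subsetI)
    fix X assume "X \<in> orbit q ` A"
    then obtain x where "x \<in> A" "X = orbit q x" by blast
    then show "X \<in> insert {a} ((\<lambda>X. X - {a}) ` (orbit p ` A))"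
      using skip by (cases "x = a") auto
  next
    fix X assume "X \<in> insert {a} ((\<lambda>X. X - {a}) ` (orbit p ` A))"
    then consider "X = {a}" | x where "x \<in> A" "X = orbit p x - {a}" by blast
    then show "X \<in> orbit q ` A"
    proof cases
      case 1
      then show ?thesis using skip(1) a by blast
    next
      case 2
      show ?thesis
      proof (cases "x = a")
        case True
        then have "X = orbit q (p a)"
          using 2 skip(2)[OF assms(3)] permutation_orbit_step[OF perm, of a] by simp
        then show ?thesis using a by blast
      next
        case False
        then show ?thesis using 2 skip(2) by blast
      qed
    qed
  qed
  moreover have "inj_on (\<lambda>X. X - {a}) (orbit p ` A)"
  proof (rule inj_onI)
    fix X Y assume XY: "X \<in> orbit p ` A" "Y \<in> orbit p ` A" "X - {a} = Y - {a}"
    obtain x where x: "X = orbit p x" using XY by blast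
    obtain y where y: "Y = orbit p y" using XY by blast
    have "\<exists>w\<in>X. w \<noteq> a"
    proof (cases "x = a")
      case True
      then show ?thesis using x assms(3) orbit.base[of p a] by blast
    next
      case False
      then show ?thesis using x permutation_self_in_orbit[OF perm, of x] by blast
    qed
    then obtain w where "w \<in> X" "w \<in> Y" using XY(3) by blast
    then show "X = Y"
      using cyclic_on_orbit'[OF perm, of x] cyclic_on_orbit'[OF perm, of y] x y
      unfolding cyclic_on_alldef by metis
  qed
  moreover have "{a} \<notin> (\<lambda>X. X - {a}) ` (orbit p ` A)" by blast
  ultimately show ?thesis using assms(2) by (simp add: card_image)
qed

text \<open>Every bypass flips the sign, creates one more orbit and leaves fewer moved points, until
  the identity with \<open>card A\<close> orbits is reached.\<close>

lemma sign_eq_orbits: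
  assumes "p permutes A" "finite A"
  shows "sign p = (- 1) ^ (card A + card (orbit p ` A))"
  using assms
proof (induction "card {x. p x \<noteq> x}" arbitrary: p rule: less_induct)
  case less
  have fin: "finite {x. p x \<noteq> x}"
    using less.prems by (auto intro!: finite_subset[of _ A] simp: permutes_def)
  show ?case
  proof (cases "\<exists>a. p a \<noteq> a")
    case False
    then have "p = id" by auto
    moreover have "orbit id ` A = (\<lambda>x. {x}) ` A"
      by (intro image_cong refl) (simp add: orbit_eq_singleton_iff)
    ultimately show ?thesis by (simp add: card_image mult_2[symmetric])
  next
    case True
    then obtain a where a: "p a \<noteq> a" by blast
    define q where "q = transpose a (p a) \<circ> p"
    have aA: "a \<in> A" "p a \<in> A"
      using less.prems(1) a permutes_not_in[of p A a] permutes_in_image[of p A a] by auto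
    have tr: "transpose a (p a) permutes A" using aA by (rule permutes_swap_id)
    have q: "q permutes A" unfolding q_def by (rule permutes_compose[OF less.prems(1) tr])
    have "q x = x" if "p x = x" for x
    proof -
      have "x \<noteq> a" "x \<noteq> p a" using that a permutes_inj[OF less.prems(1)] by (auto simp: inj_eq)
      then show ?thesis using that by (simp add: q_def)
    qed
    moreover have "q a = a" by (simp add: q_def)
    ultimately have "{x. q x \<noteq> x} \<subset> {x. p x \<noteq> x}" using a by auto
    then have "card {x. q x \<noteq> x} < card {x. p x \<noteq> x}" by (rule psubset_card_mono[OF fin])
    from less.hyps[OF this q less.prems(2)]
    have "sign q = (- 1) ^ (card A + Suc (card (orbit p ` A)))"
      unfolding q_def card_orbits_transpose_skip[OF less.prems a] .
    moreover have "sign q = - sign p"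
      unfolding q_def
      using less.prems tr a permutation_permutes[of p] permutation_permutes[of "transpose a (p a)"]
      by (subst sign_compose) (auto simp: sign_swap_id)
    ultimately show ?thesis by simp
  qed
qed

section \<open>Rotations from keys and keys from rotations\<close>

context multigraph
begin

text \<open>The key counts the steps of the rotation from a base arc chosen at each vertex, and the
  rotation starts over exactly when it returns to the base arc.\<close>

lemma rotation_key_if_rotation_system:
  assumes "rotation_system G s"
  shows "\<exists>key. rotation_key G s key"
proof -
  define b where "b v = (SOME a. a \<in> out_arcs G v)" for v
  define key where "key a = int (funpow_dist s (b (tail G a)) a)" for a
  have inj: "inj s" using assms permutes_inj unfolding rotation_system_def by blast
  have b: "b (tail G a) \<in> out_arcs G (tail G a)" if "a \<in> arcs G" for a
    unfolding b_def by (rule someI[of "\<lambda>c. c \<in> out_arcs G (tail G a)" a]) (simp add: that)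
  have orb: "out_arcs G (tail G a) = orbit s (b (tail G a))" if "a \<in> arcs G" for a
    using rotation_cyclic[OF assms that] b[OF that] unfolding cyclic_on_alldef by blast
  have reach: "(s ^^ funpow_dist s (b (tail G a)) a) (b (tail G a)) = a" if a: "a \<in> arcs G" for a
  proof (rule funpow_dist_prop)
    show "a \<in> orbit s (b (tail G a))" unfolding orb[OF a, symmetric] using a by simp
  qed
  have least: "funpow_dist s x y \<le> n" if "(s ^^ n) x = y" for x y n
    using funpow_dist_least[of n s x y] that by (meson not_le)
  show ?thesis
    unfolding rotation_key_def
  proof (intro exI[of _ key] conjI ballI)
    fix v assume "v \<in> verts G"
    show "inj_on key (out_arcs G v)"
    proof (rule inj_onI)
      fix x y assume "x \<in> out_arcs G v" "y \<in> out_arcs G v" "key x = key y"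
      then show "x = y" using reach[of x] reach[of y] by (simp add: key_def)
    qed
  next
    fix a assume a: "a \<in> arcs G"
    let ?b = "b (tail G a)"
    define d where "d = funpow_dist s ?b a"
    have sa: "s a \<in> arcs G" "tail G (s a) = tail G a" using rotation_tail[OF assms a] by auto
    have d: "(s ^^ d) ?b = a" using reach[OF a] by (simp add: d_def)
    show "(\<forall>c\<in>out_arcs G (tail G a). key c < key (s a) \<longleftrightarrow> key c \<le> key a) \<or>
        (\<forall>c\<in>out_arcs G (tail G a). key (s a) \<le> key c \<and> key c \<le> key a)"
    proof (cases "s a = ?b")
      case False
      have "funpow_dist s ?b (s a) = Suc d"
      proof (rule antisym)
        show "funpow_dist s ?b (s a) \<le> Suc d" using d by (intro least) simp
        show "Suc d \<le> funpow_dist s ?b (s a)"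
        proof (cases "funpow_dist s ?b (s a)")
          case 0
          then show ?thesis using reach[OF sa(1)] sa(2) False by simp
        next
          case (Suc m)
          then have "s ((s ^^ m) ?b) = s a" using reach[OF sa(1)] sa(2) by simp
          then have "(s ^^ m) ?b = a" using inj by (simp add: inj_eq)
          then have "d \<le> m" unfolding d_def by (rule least)
          then show ?thesis using Suc by simp
        qed
      qed
      then have "key (s a) = key a + 1" using sa by (simp add: key_def d_def)
      then show ?thesis by auto
    next
      case True
      \<comment> \<open>Distances from the base arc can be reduced modulo \<open>Suc d\<close>, so
        \<open>a\<close> is the farthest arc.\<close>
      have per: "(s ^^ Suc d) ?b = ?b" using d True by simp
      have "key c \<le> key a" if c: "c \<in> out_arcs G (tail G a)" for c
      proof -
        define n where "n = funpow_dist s ?b c"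
        have "(s ^^ (n mod Suc d)) ?b = (s ^^ n) ?b" by (rule funpow_mod_eq[OF per])
        also have "\<dots> = c" using reach[of c] c by (simp add: n_def)
        finally have "n \<le> n mod Suc d" unfolding n_def by (rule least)
        also have "\<dots> \<le> d" using mod_less_divisor[of "Suc d" n] by linarith
        finally show ?thesis using c by (simp add: key_def n_def d_def)
      qed
      moreover have "key (s a) = 0" using True sa by (simp add: key_def funpow_dist_0)
      ultimately show ?thesis by (simp add: key_def)
    qed
  qed
qed

text \<open>The arc of rank \<open>i\<close> at a vertex is sent to the arc of rank
  \<open>i + 1\<close> modulo the degree; ranks are used because keys may have gaps.\<close>

lemma rotation_system_if_key:
  assumes inj: "\<And>v. v \<in> verts G \<Longrightarrow> inj_on key (out_arcs G v)"
  shows "\<exists>s. rotation_system G s \<and> rotation_key G s (key :: 'b \<Rightarrow> int)"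
proof -
  define idx where "idx a = card {b \<in> out_arcs G (tail G a). key b < key a}" for a
  define n where "n a = card (out_arcs G (tail G a))" for a
  have lt: "idx a < idx b" if "a \<in> arcs G" "b \<in> arcs G" "tail G a = tail G b" "key a < key b" for a b
    unfolding idx_def using that by (intro psubset_card_mono) auto
  have eqkey: "a = b" if "a \<in> arcs G" "b \<in> arcs G" "tail G a = tail G b" "key a = key b" for a b
  proof (rule inj_onD[OF inj that(4)])
    show "tail G a \<in> verts G" using that by simp
  qed (use that in auto)
  have lt_iff: "idx a < idx b \<longleftrightarrow> key a < key b" if "a \<in> arcs G" "b \<in> arcs G" "tail G a = tail G b" for a b
  proof
    assume i: "idx a < idx b"
    show "key a < key b"
    proof (rule ccontr)
      assume "\<not> key a < key b"
      then consider "key b < key a" | "key a = key b" by linarith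
      then show False
      proof cases
        case 1
        then show False using lt[OF that(2,1) that(3)[symmetric]] i by simp
      next
        case 2
        then show False using eqkey[OF that] i by blast
      qed
    qed
  qed (rule lt[OF that])
  have idx_eq: "a = b" if "a \<in> arcs G" "b \<in> arcs G" "tail G a = tail G b" "idx a = idx b" for a b
  proof (rule eqkey[OF that(1-3)])
    show "key a = key b"
      using lt_iff[OF that(1-3)] lt_iff[OF that(2,1) that(3)[symmetric]] that(4) by linarith
  qed
  have idx_n: "idx a < n a" if "a \<in> arcs G" for a
    unfolding idx_def n_def
  proof (rule psubset_card_mono)
    have "a \<in> out_arcs G (tail G a)" using that by simp
    then show "{b \<in> out_arcs G (tail G a). key b < key a} \<subset> out_arcs G (tail G a)" by blast
  qed simp
  have img: "idx ` out_arcs G (tail G a) = {..<n a}" if "a \<in> arcs G" for a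
  proof (rule card_subset_eq)
    show "idx ` out_arcs G (tail G a) \<subseteq> {..<n a}"
    proof
      fix i assume "i \<in> idx ` out_arcs G (tail G a)"
      then obtain b where "b \<in> arcs G" "tail G b = tail G a" "i = idx b" by auto
      then show "i \<in> {..<n a}" using idx_n[of b] by (simp add: n_def)
    qed
    have "inj_on idx (out_arcs G (tail G a))" using idx_eq by (intro inj_onI) auto
    then show "card (idx ` out_arcs G (tail G a)) = card {..<n a}" by (simp add: card_image n_def)
  qed simp
  have "\<exists>b. b \<in> out_arcs G (tail G a) \<and> idx b = Suc (idx a) mod n a" if "a \<in> arcs G" for a
  proof -
    have "Suc (idx a) mod n a \<in> idx ` out_arcs G (tail G a)"
      unfolding img[OF that] using idx_n[OF that] by simp
    then show ?thesis by (auto simp: image_iff)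
  qed
  then obtain t where t: "\<And>a. a \<in> arcs G \<Longrightarrow> t a \<in> out_arcs G (tail G a) \<and> idx (t a) = Suc (idx a) mod n a"
    by metis
  define s where "s a = (if a \<in> arcs G then t a else a)" for a
  have s: "s a \<in> arcs G" "tail G (s a) = tail G a" "idx (s a) = Suc (idx a) mod n a" "n (s a) = n a"
    if "a \<in> arcs G" for a
    using t[OF that] that by (auto simp: s_def n_def)
  have pow: "(s ^^ k) a \<in> arcs G \<and> tail G ((s ^^ k) a) = tail G a \<and> idx ((s ^^ k) a) = (idx a + k) mod n a"
    if a: "a \<in> arcs G" for a k
  proof (induction k)
    case 0
    then show ?case using a idx_n[OF a] by simp
  next
    case (Suc k)
    then show ?case using s[of "(s ^^ k) a"] by (auto simp: n_def mod_Suc_eq)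
  qed
  have reach: "\<exists>k>0. (s ^^ k) a = b" if ab: "a \<in> arcs G" "b \<in> arcs G" "tail G a = tail G b" for a b
  proof -
    define k where "k = n a + idx b - idx a"
    have nn: "n a = n b" using ab by (simp add: n_def)
    have "k > 0" "idx a + k = n a + idx b" using idx_n[OF ab(1)] by (auto simp: k_def)
    moreover have "(n a + idx b) mod n a = idx b" using idx_n[OF ab(2)] nn by simp
    ultimately have "(s ^^ k) a = b" using pow[OF ab(1), of k] ab by (intro idx_eq) auto
    with \<open>k > 0\<close> show ?thesis by blast
  qed
  have "inj_on s (arcs G)"
  proof (rule inj_onI)
    fix a b assume ab: "a \<in> arcs G" "b \<in> arcs G" "s a = s b"
    have tt: "tail G a = tail G b" using s(2)[OF ab(1)] s(2)[OF ab(2)] ab(3) by simp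
    have nn: "n a = n b" using tt by (simp add: n_def)
    have "Suc (idx a) mod n a = Suc (idx b) mod n a"
      using s(3)[OF ab(1)] s(3)[OF ab(2)] ab(3) nn by simp
    then have "idx a = idx b"
      using idx_n[OF ab(1)] idx_n[OF ab(2)] nn
      by (cases "Suc (idx a) = n a"; cases "Suc (idx b) = n a") (auto simp: mod_Suc split: if_splits)
    then show "a = b" using idx_eq ab tt by blast
  qed
  moreover have "s ` arcs G \<subseteq> arcs G" using s by auto
  ultimately have "bij_betw s (arcs G) (arcs G)"
    by (simp add: bij_betw_def endo_inj_surj)
  then have perm: "s permutes arcs G" by (rule bij_imp_permutes) (simp add: s_def)
  have cyc: "cyclic_on s (out_arcs G v)" if v: "out_arcs G v \<noteq> {}" for v
  proof -
    obtain a where "a \<in> out_arcs G v" using v by blast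
    then have a: "a \<in> arcs G" "tail G a = v" by auto
    have "out_arcs G v = orbit s a"
    proof (intro equalityI subsetI)
      fix b assume "b \<in> out_arcs G v"
      then show "b \<in> orbit s a" using reach[of a b] a unfolding orbit_altdef by auto
    next
      fix b assume "b \<in> orbit s a"
      then show "b \<in> out_arcs G v" using pow[OF a(1)] a(2) unfolding orbit_altdef by auto
    qed
    then show ?thesis using a by (intro cyclic_on_singleI[of a]) auto
  qed
  have "rotation_key G s key"
    unfolding rotation_key_def
  proof (intro conjI ballI)
    fix a assume a: "a \<in> arcs G"
    let ?O = "out_arcs G (tail G a)"
    have le: "key b \<le> key a \<longleftrightarrow> idx b \<le> idx a" if "b \<in> ?O" for b
      using lt_iff[of a b] that a by auto
    have sl: "key b < key (s a) \<longleftrightarrow> idx b < idx (s a)" if "b \<in> ?O" for b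
      using lt_iff[of b "s a"] that s[OF a] by auto
    show "(\<forall>b\<in>?O. key b < key (s a) \<longleftrightarrow> key b \<le> key a) \<or> (\<forall>b\<in>?O. key (s a) \<le> key b \<and> key b \<le> key a)"
    proof (cases "Suc (idx a) = n a")
      case False
      then have "idx (s a) = Suc (idx a)" using s(3)[OF a] idx_n[OF a] by simp
      then show ?thesis using le sl by auto
    next
      case True
      then have s0: "idx (s a) = 0" using s(3)[OF a] by simp
      have "idx b \<le> idx a" if "b \<in> ?O" for b
        using idx_n[of b] that True by (auto simp: n_def)
      then show ?thesis using le sl s0 by force
    qed
  qed (rule inj)
  with perm cyc show ?thesis unfolding rotation_system_def by blast
qed

lemma rotation_system_exists: "\<exists>s. rotation_system G s"
proof -
  obtain key :: "'b \<Rightarrow> nat" where "inj_on key (arcs G)"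
    using finite_imp_inj_to_nat_seg[OF finite_arcs] by blast
  then have "inj_on (\<lambda>a. int (key a)) (out_arcs G v)" for v
    by (auto simp: inj_on_def)
  then show ?thesis using rotation_system_if_key[of "\<lambda>a. int (key a)"] by blast
qed

end

subsection \<open>Upper embeddability in terms of local forms\<close>

context multigraph
begin

text \<open>When the two arcs of a pair are neighbours in the rotation, exchanging them only changes
  the sign of their wedge in the form. The rotations obtained by all such exchanges realise one
  fixed form plus the wedges of the pairs with arbitrary signs, and some choice of signs is
  nondegenerate on \<open>U\<close>.\<close>

lemma rotation_if_even_coordinates:
  assumes "cut_connected G" and I: "even_coordinates G r I"
  shows "\<exists>s. rotation_system G s \<and> card (faces G r s) \<le> 2"
proof -
  let ?Z = "cycle_space G r"
  define K where "K = {z \<in> ?Z. \<forall>i\<in>I. z i = 0}"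
  have "subspace K" using subspace_cycle_space[of G r] unfolding K_def subspace_def by auto
  moreover have "dim_at_most (Suc 0) K" using I unfolding even_coordinates_def K_def by blast
  ultimately obtain f :: "('b \<Rightarrow> real) \<Rightarrow> real" where f: "linear f"
    "\<And>y. y \<in> K \<Longrightarrow> f y = 0 \<Longrightarrow> y = 0" "\<And>z. \<exists>k\<in>K. f z = f k"
    by (rule dim_at_most_1_functional) blast
  define U where "U = {z \<in> ?Z. f z = 0}"
  have U: "subspace U"
    using subspace_cycle_space[of G r] f(1)
    unfolding subspace_def U_def by (auto simp: linear_add linear_scale linear_0)
  have coord: "coordinates_on U I"
    unfolding coordinates_on_def
  proof (intro conjI allI ballI impI)
    fix t
    obtain z where z: "z \<in> ?Z" "\<forall>i\<in>I. z i = t i" using I unfolding even_coordinates_def by blast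
    obtain k where k: "k \<in> K" "f z = f k" using f(3) by blast
    have "z - k \<in> U"
      using z k f(1) subspace_diff[OF subspace_cycle_space z(1)] by (auto simp: U_def K_def linear_diff)
    moreover have "\<forall>i\<in>I. (z - k) i = t i" using z k by (simp add: K_def)
    ultimately show "\<exists>z\<in>U. \<forall>i\<in>I. z i = t i" by blast
  next
    fix z assume "z \<in> U" "\<forall>i\<in>I. z i = 0"
    then show "z = 0" using f(2)[of z] by (simp add: U_def K_def)
  qed
  have IG: "I \<subseteq> arcs G" using I unfolding even_coordinates_def by blast
  have "finite I" by (rule finite_subset[OF IG]) simp
  then obtain P where P: "finite P" "inj_on fst P" "inj_on snd P" "fst ` P \<inter> snd ` P = {}"
    "fst ` P \<union> snd ` P = I" "\<forall>(a, b)\<in>P. tail G a = tail G b"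
    using even_set_paired[of I "tail G"] I unfolding even_coordinates_def by blast
  obtain e :: "'b \<times> 'b \<Rightarrow> nat" where e: "inj_on e P"
    using finite_imp_inj_to_nat_seg[OF P(1)] by blast
  obtain h :: "'b \<Rightarrow> nat" where h: "inj_on h (arcs G)"
    using finite_imp_inj_to_nat_seg[OF finite_arcs] by blast
  define pr where "pr a = (THE p. p \<in> P \<and> (a = fst p \<or> a = snd p))" for a
  have pr: "pr a = p" if "p \<in> P" "a = fst p \<or> a = snd p" for a p
    unfolding pr_def
  proof (rule the_equality)
    fix p' assume p': "p' \<in> P \<and> (a = fst p' \<or> a = snd p')"
    have "fst p \<noteq> snd p'" "snd p \<noteq> fst p'" using that(1) p' P(4) by blast+
    then have "fst p = fst p' \<or> snd p = snd p'" using that(2) p' by metis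
    then show "p' = p" using inj_onD[OF P(2), of p' p] inj_onD[OF P(3), of p' p] that(1) p' by metis
  qed (use that in blast)
  define \<sigma> where "\<sigma> a = (if a \<in> fst ` P then - 1 else 1 :: int)" for a
  have \<sigma>: "\<sigma> (fst p) = - 1" "\<sigma> (snd p) = 1" if "p \<in> P" for p
    using that P(4) by (auto simp: \<sigma>_def)
  \<comment> \<open>Keys that make paired arcs consecutive, in an order prescribed by \<open>\<delta>\<close>.\<close>
  define key where "key \<delta> a = (if a \<in> I then 4 * int (e (pr a)) + \<delta> (pr a) * \<sigma> a else - (10 + int (h a)))"
    for \<delta> :: "'b \<times> 'b \<Rightarrow> int" and a
  have I_pair: "\<exists>p\<in>P. a = fst p \<or> a = snd p" if "a \<in> I" for a using that P(5) by blast
  \<comment> \<open>\<open>\<delta>\<close> affects the order within a pair only. Blocks of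
    different pairs are 4 apart while each arc moves by at most 1, and the arcs outside
    \<open>I\<close> have keys at most -10, below all blocks.\<close>
  have sgn_key: "sgn (key \<delta> b - key \<delta> a) = sgn (key (\<lambda>_. 0) b - key (\<lambda>_. 0) a)"
    if \<delta>: "\<And>p. \<bar>\<delta> p\<bar> \<le> 1" and ab: "\<not> (a \<in> I \<and> b \<in> I \<and> pr a = pr b)" for \<delta> a b
  proof -
    have small: "\<bar>\<delta> p * \<sigma> c\<bar> \<le> 1" for p c using \<delta>[of p] by (simp add: \<sigma>_def)
    show ?thesis
    proof (cases "a \<in> I \<and> b \<in> I")
      case True
      then have "e (pr a) \<noteq> e (pr b)"
        using ab I_pair[of a] I_pair[of b] pr inj_onD[OF e] by metis
      then consider "e (pr a) < e (pr b)" | "e (pr b) < e (pr a)" by linarith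
      then show ?thesis
        using small[of "pr a" a] small[of "pr b" b] True
        by cases (auto simp: key_def sgn_if)
    next
      case False
      then show ?thesis
        using small[of "pr a" a] small[of "pr b" b] by (auto simp: key_def sgn_if)
    qed
  qed
  have wedge_sum: "(\<Sum>p\<in>P. c p * arc_wedge (fst p) (snd p) a b)
      = (if (a, b) \<in> P then c (a, b) else 0) - (if (b, a) \<in> P then c (b, a) else 0)" for c :: "'b \<times> 'b \<Rightarrow> real" and a b
  proof -
    have "(\<Sum>p\<in>P. c p * arc_wedge (fst p) (snd p) a b)
        = (\<Sum>p\<in>P. (if p = (a, b) then c p else 0) - (if p = (b, a) then c p else 0))"
    proof (rule sum.cong)
      fix p :: "'b \<times> 'b"
      obtain f g where "p = (f, g)" by (cases p)
      then show "c p * arc_wedge (fst p) (snd p) a b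
          = (if p = (a, b) then c p else 0) - (if p = (b, a) then c p else 0)"
        by (cases "a = f"; cases "b = g"; cases "a = g"; cases "b = f") (simp_all add: arc_wedge_def)
    qed simp
    also have "\<dots> = (\<Sum>p\<in>P. if p = (a, b) then c p else 0) - (\<Sum>p\<in>P. if p = (b, a) then c p else 0)"
      by (rule sum_subtractf)
    finally show ?thesis unfolding sum.delta[OF P(1)] .
  qed
  have PD: "a \<in> arcs G \<and> b \<in> arcs G \<and> tail G a = tail G b \<and> a \<in> I \<and> b \<in> I \<and> pr a = pr b"
    if ab: "(a, b) \<in> P" for a b
  proof -
    have "fst (a, b) \<in> I" "snd (a, b) \<in> I" using ab P(5) by blast+
    moreover have "tail G a = tail G b" using ab P(6) by blast
    moreover have "pr a = (a, b)" "pr b = (a, b)" using pr[OF ab, of a] pr[OF ab, of b] by simp_all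
    ultimately show ?thesis using IG by auto
  qed
  \<comment> \<open>With \<open>\<delta>\<close> zero the two arcs of a pair have equal keys, so
    their coefficient is \<open>sgn 0 = 0\<close>. These tied keys give no rotation, but their
    matrix is the fixed part to which \<open>\<delta>\<close> adds the wedges.\<close>
  have coeff: "key_form G (key \<delta>) a b
      = key_form G (key (\<lambda>_. 0)) a b + (\<Sum>p\<in>P. of_int (\<delta> p) * arc_wedge (fst p) (snd p) a b)"
    if \<delta>: "\<And>p. \<bar>\<delta> p\<bar> \<le> 1" for \<delta> a b
  proof (cases "a \<in> arcs G \<and> b \<in> arcs G \<and> tail G a = tail G b")
    case False
    moreover have "(a, b) \<notin> P" "(b, a) \<notin> P" using False PD[of a b] PD[of b a] by metis+
    ultimately show ?thesis unfolding wedge_sum by (auto simp: key_form_def)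
  next
    case True
    show ?thesis
    proof (cases "a \<in> I \<and> b \<in> I \<and> pr a = pr b")
      case False
      then have "(a, b) \<notin> P" "(b, a) \<notin> P" using PD[of a b] PD[of b a] by metis+
      then show ?thesis unfolding wedge_sum using sgn_key[OF \<delta> False] by (simp add: key_form_def)
    next
      case same: True
      obtain p where p: "p \<in> P" "a = fst p \<or> a = snd p" using I_pair same by blast
      obtain p' where p': "p' \<in> P" "b = fst p' \<or> b = snd p'" using I_pair same by blast
      have "p' = p" using pr[OF p] pr[OF p'] same by simp
      then have b: "b = fst p \<or> b = snd p" using p' by simp
      have kd: "key \<delta> (snd p) - key \<delta> (fst p) = 2 * \<delta> p" for \<delta>
        using p(1) \<sigma>[OF p(1)] pr[OF p(1), of "fst p"] pr[OF p(1), of "snd p"] P(5) by (auto simp: key_def)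
      have sg: "sgn (2 * \<delta> p) = \<delta> p" using \<delta>[of p] by (auto simp: sgn_if abs_if split: if_splits)
      have sg': "sgn (- (2 * \<delta> p)) = - \<delta> p" using \<delta>[of p] by (auto simp: sgn_if abs_if split: if_splits)
      have notin: "(snd p, fst p) \<notin> P" "(c, c) \<notin> P" for c
        using p(1) P(4) by (metis disjoint_iff fst_conv image_eqI snd_conv)+
      consider "a = b" | "a = fst p" "b = snd p" | "a = snd p" "b = fst p" using p(2) b by blast
      then show ?thesis
      proof cases
        case 1
        then show ?thesis unfolding wedge_sum by (simp add: key_form_def notin)
      next
        case 2
        then show ?thesis
          unfolding wedge_sum using True kd[of \<delta>] kd[of "\<lambda>_. 0"] sg notin p(1) by (simp add: key_form_def)
      next
        case 3
        have "key \<delta> (fst p) - key \<delta> (snd p) = - (2 * \<delta> p)" for \<delta> using kd[of \<delta>] by linarith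
        then show ?thesis
          unfolding wedge_sum using 3 True sg' notin p(1) by (simp add: key_form_def)
      qed
    qed
  qed
  have P_arcs: "fst p \<in> arcs G" "snd p \<in> arcs G" if "p \<in> P" for p using that P(5) IG by auto
  have form: "form_of G (key_form G (key \<delta>)) = (\<lambda>z w. form_of G (key_form G (key (\<lambda>_. 0))) z w
      + (\<Sum>p\<in>P. of_int (\<delta> p) * wedge (\<lambda>z. z (fst p)) (\<lambda>z. z (snd p)) z w))" if \<delta>: "\<And>p. \<bar>\<delta> p\<bar> \<le> 1" for \<delta>
    unfolding coeff[OF \<delta>] form_of_add form_of_sum
    by (intro ext arg_cong2[of _ _ _ _ "(+)"] refl sum.cong) (simp add: form_of_arc_wedge P_arcs)
  obtain \<epsilon> :: "'b \<times> 'b \<Rightarrow> real" where \<epsilon>: "\<forall>p. \<epsilon> p = 1 \<or> \<epsilon> p = - 1"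
    "nondegenerate_on (\<lambda>z w. form_of G (key_form G (key (\<lambda>_. 0))) z w
      + (\<Sum>(a, b)\<in>P. \<epsilon> (a, b) * wedge (\<lambda>z. z a) (\<lambda>z. z b) z w)) U"
    using nondegenerate_signs[OF P(1-4) skew_form_form_of[OF local_form_key_form] U] coord P(5) by blast
  define \<delta> where "\<delta> p = (if \<epsilon> p = 1 then 1 else - 1 :: int)" for p
  have \<delta>\<epsilon>: "of_int (\<delta> p) = \<epsilon> p" for p using \<epsilon>(1)[rule_format, of p] by (auto simp: \<delta>_def)
  have \<delta>1: "\<bar>\<delta> p\<bar> \<le> 1" for p by (simp add: \<delta>_def)
  have nd: "nondegenerate_on (form_of G (key_form G (key \<delta>))) U"
    unfolding form[OF \<delta>1] \<delta>\<epsilon> using \<epsilon>(2) by (simp add: case_prod_unfold)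
  have "dim_at_most (Suc 0) (form_radical G r (key_form G (key \<delta>)))"
  proof (rule dim_at_most_codim_one[OF _ f(1)])
    show "subspace (form_radical G r (key_form G (key \<delta>)))"
      unfolding form_radical_def
      by (rule subspace_radical[OF skew_form_form_of[OF local_form_key_form] subspace_cycle_space])
  next
    fix y assume "y \<in> form_radical G r (key_form G (key \<delta>))" "f y = 0"
    then have "y \<in> radical (form_of G (key_form G (key \<delta>))) U"
      by (auto simp: form_radical_def radical_def U_def)
    then show "y = 0" using nd unfolding nondegenerate_on_def by blast
  qed
  moreover have "inj_on (key \<delta>) (arcs G)"
  proof (rule inj_onI)
    fix a b assume ab: "a \<in> arcs G" "b \<in> arcs G" "key \<delta> a = key \<delta> b"
    have small: "\<bar>\<delta> p * \<sigma> c\<bar> \<le> 1" for p c using \<delta>1[of p] by (simp add: \<sigma>_def)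
    have nz: "\<delta> p \<noteq> 0" for p by (simp add: \<delta>_def)
    show "a = b"
    proof (cases "a \<in> I \<and> b \<in> I")
      case True
      then have "4 * int (e (pr a)) + \<delta> (pr a) * \<sigma> a = 4 * int (e (pr b)) + \<delta> (pr b) * \<sigma> b"
        using ab by (simp add: key_def)
      moreover from this have ee: "e (pr a) = e (pr b)"
        using small[of "pr a" a] small[of "pr b" b] by linarith
      ultimately have ss: "\<delta> (pr a) * \<sigma> a = \<delta> (pr b) * \<sigma> b" by simp
      obtain p where p: "p \<in> P" "a = fst p \<or> a = snd p" using I_pair True by blast
      obtain p' where p': "p' \<in> P" "b = fst p' \<or> b = snd p'" using I_pair True by blast
      have "p' = p" using ee pr[OF p] pr[OF p'] inj_onD[OF e, of p' p] p p' by simp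
      moreover have "\<sigma> a = \<sigma> b" using ss nz[of p] pr[OF p] pr[OF p'] \<open>p' = p\<close> by simp
      ultimately show ?thesis using p p' \<sigma>[OF p(1)] by auto
    next
      case False
      then show ?thesis
        using ab small[of "pr a" a] small[of "pr b" b] inj_onD[OF h, of a b]
        by (auto simp: key_def split: if_splits)
    qed
  qed
  then have "inj_on (key \<delta>) (out_arcs G v)" for v
    by (rule inj_on_subset) auto
  then obtain s where "rotation_system G s" "rotation_key G s (key \<delta>)"
    using rotation_system_if_key[of "key \<delta>"] by blast
  ultimately show ?thesis using two_faces_if_dim_radical[OF assms(1)] by blast
qed

section \<open>Euler characteristic: parity and bound\<close>

lemma card_orbits_rotation:
  assumes "rotation_system G s" "\<forall>v\<in>verts G. out_arcs G v \<noteq> {}"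
  shows "card (orbit s ` arcs G) = card (verts G)"
proof -
  have orb: "orbit s a = out_arcs G (tail G a)" if a: "a \<in> arcs G" for a
  proof -
    have "a \<in> out_arcs G (tail G a)" using a by simp
    then show ?thesis using rotation_cyclic[OF assms(1) a] unfolding cyclic_on_alldef by blast
  qed
  have "orbit s ` arcs G = out_arcs G ` verts G"
  proof (intro equalityI subsetI)
    fix X assume "X \<in> orbit s ` arcs G"
    then show "X \<in> out_arcs G ` verts G" using orb by auto
  next
    fix X assume "X \<in> out_arcs G ` verts G"
    then obtain v where v: "v \<in> verts G" "X = out_arcs G v" by blast
    then obtain a where "a \<in> out_arcs G v" using assms(2) by blast
    then have "a \<in> arcs G" "X = orbit s a" using orb[of a] v by auto
    then show "X \<in> orbit s ` arcs G" by blast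
  qed
  moreover have "inj_on (out_arcs G) (verts G)"
  proof (rule inj_onI)
    fix u v assume uv: "u \<in> verts G" "v \<in> verts G" "out_arcs G u = out_arcs G v"
    obtain a where "a \<in> out_arcs G u" using assms(2) uv(1) by blast
    moreover then have "a \<in> out_arcs G v" using uv(3) by simp
    ultimately show "u = v" by auto
  qed
  ultimately show ?thesis by (simp add: card_image)
qed

lemma orbit_reversal: "orbit r a = {a, r a}"
proof (intro equalityI subsetI)
  fix b assume "b \<in> orbit r a"
  then show "b \<in> {a, r a}" by induction auto
next
  fix b assume "b \<in> {a, r a}"
  then show "b \<in> orbit r a" using orbit.base[of r a] orbit.step[of "r a" r a] by auto
qed

lemma card_orbits_reversal: "2 * card (orbit r ` arcs G) = card (arcs G)"
proof -
  note orb = orbit_reversal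
  have union: "\<Union> (orbit r ` arcs G) = arcs G" unfolding orb by auto
  have "2 * card (orbit r ` arcs G) = card (\<Union> (orbit r ` arcs G))"
  proof (rule card_partition)
    fix X assume "X \<in> orbit r ` arcs G"
    then show "card X = 2" unfolding orb using arev_neq by fastforce
  next
    fix X Y assume "X \<in> orbit r ` arcs G" "Y \<in> orbit r ` arcs G" "X \<noteq> Y"
    then show "X \<inter> Y = {}" unfolding orb by (auto simp: arev_eq_iff)
  qed (simp_all add: union)
  then show ?thesis unfolding union .
qed

lemma num_edges_double: "2 * num_edges G = card (arcs G)"
  using card_orbits_reversal unfolding num_edges_def by presburger

text \<open>Multiplicativity of the sign on \<open>s \<circ> r\<close>: the cycles of
  \<open>s\<close>, \<open>r\<close> and \<open>s \<circ> r\<close> are the vertices, edges and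
  faces, and the number of arcs is even.\<close>

lemma euler_parity:
  assumes "rotation_system G s" "\<forall>v\<in>verts G. out_arcs G v \<noteq> {}"
  shows "even (card (verts G) + num_edges G + card (faces G r s))"
proof -
  have s: "s permutes arcs G" using assms(1) by (simp add: rotation_system_def)
  have perm: "permutation s" "permutation r"
    using s arev_permutes_arcs finite_arcs permutation_permutes by blast+
  have "sign (s \<circ> r) = sign s * sign r" using perm by (rule sign_compose)
  moreover have "card (orbit r ` arcs G) = num_edges G" using card_orbits_reversal num_edges_double by simp
  moreover have cv: "card (orbit s ` arcs G) = card (verts G)"
    using assms by (rule card_orbits_rotation)
  ultimately have "(- 1) ^ (card (arcs G) + card (faces G r s))
      = (- 1) ^ (card (arcs G) + card (verts G)) * ((- 1) ^ (card (arcs G) + num_edges G) :: int)"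
    unfolding sign_eq_orbits[OF s finite_arcs] sign_eq_orbits[OF arev_permutes_arcs finite_arcs]
      sign_eq_orbits[OF face_perm_permutes[OF assms(1)] finite_arcs] faces_def
      cv by simp
  moreover have "even (card (arcs G))" using num_edges_double by (metis dvd_triv_left)
  moreover have "even m \<longleftrightarrow> even n" if "(- 1) ^ m = (- 1 :: int) ^ n" for m n
    using that by (simp add: minus_one_power_iff split: if_splits)
  ultimately have "even (card (arcs G) + card (faces G r s))
      \<longleftrightarrow> even ((card (arcs G) + card (verts G)) + (card (arcs G) + num_edges G))"
    unfolding power_add[symmetric] by blast
  with \<open>even (card (arcs G))\<close> show ?thesis by simp
qed

text \<open>Cuts and boundaries of face functions are orthogonal spaces of dimensions \<open>V - 1\<close> and \<open>F - 1\<close>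
  of antisymmetric functions on the arcs.\<close>

lemma euler_inequality:
  assumes "cut_connected G" "rotation_system G s" "v0 \<in> verts G" "arcs G \<noteq> {}"
  shows "card (verts G) + card (faces G r s) \<le> num_edges G + 2"
proof (rule ccontr)
  assume contra: "\<not> ?thesis"
  let ?f = "s \<circ> r"
  obtain key where key: "rotation_key G s key" using rotation_key_if_rotation_system[OF assms(2)] by blast
  obtain a0 where a0: "a0 \<in> arcs G" using assms(4) by blast
  define X0 where "X0 = orbit ?f a0"
  have X0: "X0 \<in> faces G r s" using a0 by (simp add: X0_def faces_def)
  have finF: "finite (faces G r s)" by (simp add: faces_def)
  define V where "V = verts G - {v0}"
  define F where "F = faces G r s - {X0}"
  \<comment> \<open>One arc of every edge, enough to test an antisymmetric function.\<close>
  define J where "J = (\<lambda>X. SOME a. a \<in> X) ` (orbit r ` arcs G)"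
  have J: "a \<in> J \<or> r a \<in> J" if "a \<in> arcs G" for a
  proof -
    have "(SOME b. b \<in> orbit r a) \<in> orbit r a"
      by (rule someI[of "\<lambda>b. b \<in> orbit r a" a]) (simp add: orbit_reversal)
    moreover have "(SOME b. b \<in> orbit r a) \<in> J" using that by (simp add: J_def)
    ultimately show ?thesis by (auto simp: orbit_reversal)
  qed
  have JG: "J \<subseteq> arcs G"
  proof
    fix b assume "b \<in> J"
    then obtain a where a: "a \<in> arcs G" "b = (SOME b. b \<in> orbit r a)" by (auto simp: J_def)
    have "b \<in> orbit r a"
      unfolding a(2) by (rule someI[of "\<lambda>b. b \<in> orbit r a" a]) (simp add: orbit_reversal)
    then show "b \<in> arcs G" using a(1) by (auto simp: orbit_reversal)
  qed
  have "card J \<le> num_edges G"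
    using card_image_le[of "orbit r ` arcs G" "\<lambda>X. SOME a. a \<in> X"] card_orbits_reversal num_edges_double
    by (simp add: J_def)
  moreover have "card (V <+> F) = (card (verts G) - 1) + (card (faces G r s) - 1)"
    using assms(3) X0 finF by (simp add: V_def F_def card_Plus)
  moreover have "card (verts G) \<ge> 1" "card (faces G r s) \<ge> 1"
    using assms(3) X0 finF by (auto simp: Suc_le_eq card_gt_0_iff)
  \<comment> \<open>One vertex and one face are left out because constants have no jumps. The
    unknowns are potentials of the remaining vertices and faces, and there is one equation per
    edge.\<close>
  ultimately have "card J < card (V <+> F)" using contra by linarith
  moreover have finVF: "finite V" "finite F" using finF by (simp_all add: V_def F_def)
  moreover have "finite J" by (simp add: J_def)
  ultimately obtain c :: "'a + 'b set \<Rightarrow> real" where c: "\<exists>i\<in>V <+> F. c i \<noteq> 0"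
    "\<And>a. a \<in> J \<Longrightarrow> (\<Sum>i\<in>V <+> F. c i * (case i of Inl v \<Rightarrow> of_bool (tail G a = v) - of_bool (head G a = v)
        | Inr X \<Rightarrow> of_bool (orbit ?f (s a) = X) - of_bool (orbit ?f a = X))) = 0"
    using homogeneous_system_nontrivial_solution[of J "V <+> F" "\<lambda>i a. case i of
        Inl v \<Rightarrow> of_bool (tail G a = v) - of_bool (head G a = v)
      | Inr X \<Rightarrow> of_bool (orbit ?f (s a) = X) - of_bool (orbit ?f a = X)"] by auto
  define \<phi> where "\<phi> v = (if v \<in> V then c (Inl v) else 0)" for v
  define \<psi> where "\<psi> a = (if orbit ?f a \<in> F then c (Inr (orbit ?f a)) else 0)" for a
  define z where "z a = (if a \<in> arcs G then \<psi> (s a) - \<psi> a else 0)" for a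
  have delta: "(\<Sum>v\<in>S. h v * of_bool (x = v)) = (if x \<in> S then h x else (0::real))"
    if "finite S" for S :: "'x set" and h x
    using that by (simp add: of_bool_def if_distrib[of "\<lambda>t. _ * t"] sum.delta' cong: if_cong)
  have rel: "\<phi> (tail G a) - \<phi> (head G a) + z a = 0" if "a \<in> J" for a
  proof -
    have "(\<Sum>v\<in>V. c (Inl v) * (of_bool (tail G a = v) - of_bool (head G a = v)))
        = \<phi> (tail G a) - \<phi> (head G a)"
      unfolding right_diff_distrib sum_subtractf delta[OF finVF(1)] \<phi>_def by simp
    moreover have "(\<Sum>X\<in>F. c (Inr X) * (of_bool (orbit ?f (s a) = X) - of_bool (orbit ?f a = X))) = z a"
      unfolding right_diff_distrib sum_subtractf delta[OF finVF(2)] z_def \<psi>_def using that JG by auto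
    moreover have "(\<Sum>v\<in>V. c (Inl v) * (of_bool (tail G a = v) - of_bool (head G a = v)))
        + (\<Sum>X\<in>F. c (Inr X) * (of_bool (orbit ?f (s a) = X) - of_bool (orbit ?f a = X))) = 0"
      using c(2)[OF that] finVF by (simp add: sum.Plus)
    ultimately show ?thesis by linarith
  qed
  have inv: "\<psi> (s (r a)) = \<psi> a" for a
    using permutation_orbit_step[OF face_perm_permutation[OF assms(2)], of a] by (simp add: \<psi>_def)
  have "z \<in> form_radical G r (key_form G key)"
    unfolding z_def by (rule face_function_radical[OF assms(2) key, where \<psi> = \<psi>]) (rule inv)
  then have z: "z \<in> cycle_space G r" by (simp add: form_radical_def radical_def)
  have rel': "z a = \<phi> (head G a) - \<phi> (tail G a)" if a: "a \<in> arcs G" for a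
    using J[OF a]
  proof
    assume "a \<in> J"
    then show ?thesis using rel[of a] by simp
  next
    assume "r a \<in> J"
    then show ?thesis using rel[of "r a"] cycle_space_rev[OF z a] a by simp
  qed
  \<comment> \<open>\<open>z\<close> is a cycle and a cut at once, hence orthogonal to
    itself.\<close>
  have "(\<Sum>a\<in>arcs G. z a * z a) = (\<Sum>a\<in>arcs G. \<phi> (tail G (r a)) * z a - \<phi> (tail G a) * z a)"
    using rel' by (intro sum.cong) (auto simp: left_diff_distrib)
  also have "\<dots> = 0"
    unfolding sum_subtractf
    using sum_reverse_cycle[OF z, of "\<lambda>a. \<phi> (tail G a)"] cut_orthogonal_cycle[OF z, of \<phi>] by simp
  finally have z0: "z a = 0" if "a \<in> arcs G" for a
    using that by (simp add: sum_nonneg_eq_0_iff)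
  have \<phi>0: "\<phi> v = 0" if "v \<in> verts G" for v
  proof -
    have "\<phi> v = \<phi> v0"
      by (rule cut_connectedD[OF assms(1) that assms(3), where \<phi> = \<phi>]) (use rel' z0 in auto)
    then show ?thesis by (simp add: \<phi>_def V_def)
  qed
  have \<psi>0: "\<psi> a = 0" if "a \<in> arcs G" for a
  proof -
    have "\<psi> a = \<psi> a0"
    proof (rule rotation_face_invariant_const[OF assms(1,2), where \<chi> = \<psi>])
      show "\<psi> (s b) = \<psi> b" if "b \<in> arcs G" for b using z0[OF that] that by (simp add: z_def)
    qed (use inv that a0 in auto)
    then show ?thesis by (simp add: \<psi>_def F_def X0_def)
  qed
  have "c i = 0" if i: "i \<in> V <+> F" for i
  proof (cases i)
    case (Inl v)
    then have "v \<in> V" using i by auto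
    then show ?thesis using \<phi>0[of v] Inl by (simp add: \<phi>_def V_def)
  next
    case (Inr X)
    then have "X \<in> F" using i by auto
    then obtain a where "a \<in> arcs G" "X = orbit ?f a" by (auto simp: F_def faces_def)
    then show ?thesis using \<psi>0[of a] \<open>X \<in> F\<close> Inr by (simp add: \<psi>_def)
  qed
  then show False using c(1) by blast
qed

text \<open>By Euler's formula the Betti number is \<open>2 * k\<close> plus the number of faces
  minus one, so \<open>k\<close> is its rounded half exactly for one or two faces. Parity and bound
  guarantee that each rotation has a natural number as its genus, so that \<open>GREATEST\<close>
  ranges over a nonempty bounded set.\<close>

lemma upper_embeddable_iff_two_faces:
  assumes "cut_connected G" "v0 \<in> verts G" "\<forall>v\<in>verts G. out_arcs G v \<noteq> {}"
  shows "upper_embeddable G r \<longleftrightarrow> (\<exists>s. rotation_system G s \<and> card (faces G r s) \<le> 2)"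
proof -
  have "out_arcs G v0 \<noteq> {}" using assms(2,3) by blast
  then have ne: "arcs G \<noteq> {}" by auto
  have nf: "num_faces G r s = card (faces G r s)" for s using ne by (simp add: num_faces_def)
  have pos: "card (faces G r s) \<ge> 1" for s using ne by (simp add: faces_def Suc_le_eq card_gt_0_iff)
  have par: "even (card (verts G) + num_edges G + card (faces G r s))"
    and ineq: "card (verts G) + card (faces G r s) \<le> num_edges G + 2" if "rotation_system G s" for s
    using euler_parity[OF that] euler_inequality[OF assms(1) that assms(2) ne] assms(3) by blast+
  have emb: "embeds_in_genus G r k \<longleftrightarrow>
      (\<exists>s. rotation_system G s \<and> card (verts G) + card (faces G r s) + 2 * k = num_edges G + 2)" for k
    unfolding embeds_in_genus_def nf by (intro ex_cong1 conj_cong refl) linarith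
  have ex: "\<exists>k. embeds_in_genus G r k \<and> card (verts G) + card (faces G r s) + 2 * k = num_edges G + 2"
    if "rotation_system G s" for s
  proof -
    define m where "m = num_edges G + 2 - (card (verts G) + card (faces G r s))"
    have "even m" using par[OF that] ineq[OF that] unfolding m_def by presburger
    then obtain k where "m = 2 * k" by blast
    then show ?thesis using that ineq[OF that] emb unfolding m_def by (intro exI[of _ k]) auto
  qed
  have bound: "int k \<le> betti G div 2" if k: "embeds_in_genus G r k" for k
  proof -
    obtain s where "card (verts G) + card (faces G r s) + 2 * k = num_edges G + 2" using k emb by blast
    then show ?thesis using pos[of s] unfolding betti_def by linarith
  qed
  show ?thesis
  proof
    assume ue: "upper_embeddable G r"
    obtain s0 where "rotation_system G s0" using rotation_system_exists by blast
    then obtain k0 where "embeds_in_genus G r k0" using ex by blast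
    moreover have "k \<le> nat (betti G div 2)" if "embeds_in_genus G r k" for k
      using bound[OF that] by linarith
    ultimately have "embeds_in_genus G r (max_genus G r)"
      unfolding max_genus_def by (metis (mono_tags, lifting) GreatestI_nat)
    then obtain s where s: "rotation_system G s"
      "card (verts G) + card (faces G r s) + 2 * max_genus G r = num_edges G + 2"
      using emb by blast
    then have "card (faces G r s) \<le> 2"
      using ue unfolding upper_embeddable_def betti_def by linarith
    with s show "\<exists>s. rotation_system G s \<and> card (faces G r s) \<le> 2" by blast
  next
    assume "\<exists>s. rotation_system G s \<and> card (faces G r s) \<le> 2"
    then obtain s k where s: "card (faces G r s) \<le> 2" and k: "embeds_in_genus G r k"
      "card (verts G) + card (faces G r s) + 2 * k = num_edges G + 2"
      using ex by blast
    have kb: "int k = betti G div 2" using k(2) s pos[of s] unfolding betti_def by linarith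
    have "max_genus G r = k"
      unfolding max_genus_def
    proof (rule Greatest_equality[where P = "embeds_in_genus G r"])
      fix m assume "embeds_in_genus G r m"
      then show "m \<le> k" using bound[of m] kb by linarith
    qed (rule k(1))
    then show "upper_embeddable G r" using kb by (simp add: upper_embeddable_def)
  qed
qed

text \<open>The implications form a circle: a rotation gives a form, a form gives coordinates, and
  coordinates give a rotation.\<close>

theorem upper_embeddable_iff_form:
  assumes "cut_connected G" "v0 \<in> verts G" "\<forall>v\<in>verts G. out_arcs G v \<noteq> {}"
  shows "upper_embeddable G r \<longleftrightarrow> (\<exists>x. local_form G x \<and> dim_at_most (Suc 0) (form_radical G r x))"
    and "upper_embeddable G r \<longleftrightarrow> (\<exists>I. even_coordinates G r I)"
proof -
  have "out_arcs G v0 \<noteq> {}" using assms(2,3) by blast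
  then have ne: "arcs G \<noteq> {}" by auto
  note iff = upper_embeddable_iff_two_faces[OF assms]
  have 1: "\<exists>x. local_form G x \<and> dim_at_most (Suc 0) (form_radical G r x)" if ue: "upper_embeddable G r"
  proof -
    obtain s where s: "rotation_system G s" "card (faces G r s) \<le> 2" using ue iff by blast
    obtain key where "rotation_key G s key" using rotation_key_if_rotation_system[OF s(1)] by blast
    then show ?thesis
      using dim_radical_if_two_faces[OF s(1) _ s(2) ne] local_form_key_form by blast
  qed
  have 2: "\<exists>I. even_coordinates G r I" if "\<exists>x. local_form G x \<and> dim_at_most (Suc 0) (form_radical G r x)"
    using that even_coordinates_if_form by blast
  have 3: "upper_embeddable G r" if "\<exists>I. even_coordinates G r I"
    using that rotation_if_even_coordinates[OF assms(1)] iff by blast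
  show "upper_embeddable G r \<longleftrightarrow> (\<exists>x. local_form G x \<and> dim_at_most (Suc 0) (form_radical G r x))"
    using 1 2 3 by blast
  show "upper_embeddable G r \<longleftrightarrow> (\<exists>I. even_coordinates G r I)"
    using 1 2 3 by blast
qed

end

subsection \<open>Extremal forms\<close>

context multigraph
begin

definition support :: "('b \<Rightarrow> 'b \<Rightarrow> real) \<Rightarrow> 'b set" where
  "support x = {p \<in> arcs G. \<exists>z\<in>form_radical G r x. z p \<noteq> 0}"

definition support_cycles :: "('b \<Rightarrow> 'b \<Rightarrow> real) \<Rightarrow> ('b \<Rightarrow> real) set" where
  "support_cycles x = {z \<in> cycle_space G r. \<forall>p. p \<notin> support x \<longrightarrow> z p = 0}"

text \<open>Contains the radical but may be larger, as orthogonality is demanded only against cycles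
  on the support. The vectors that represent arcs outside the support lie here.\<close>

definition support_radical :: "('b \<Rightarrow> 'b \<Rightarrow> real) \<Rightarrow> ('b \<Rightarrow> real) set" where
  "support_radical x = radical (form_of G x) (support_cycles x)"

text \<open>\<open>a\<close> and \<open>b\<close> will be the two arcs that lose their partners in
  the splitting; the bound three is the corank that this loss leaves.\<close>

definition admissible :: "'b \<Rightarrow> 'b \<Rightarrow> ('b \<Rightarrow> 'b \<Rightarrow> real) \<Rightarrow> bool" where
  "admissible a b x \<longleftrightarrow> local_form G x \<and> dim_at_most (Suc (Suc (Suc 0))) (form_radical G r x) \<and>
     independent_on (form_radical G r x) (\<lambda>z. z a) (\<lambda>z. z b)"

lemma form_radical_subset: "form_radical G r x \<subseteq> cycle_space G r"
  by (auto simp: form_radical_def radical_def)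

lemma subspace_support_radical:
  assumes "local_form G x"
  shows "subspace (support_radical x)"
  unfolding support_radical_def
proof (rule subspace_radical[OF skew_form_form_of[OF assms]])
  show "subspace (support_cycles x)"
    using subspace_cycle_space[of G r] unfolding support_cycles_def subspace_def by auto
qed

lemma form_radical_outside_support:
  assumes "z \<in> form_radical G r x" "p \<notin> support x"
  shows "z p = 0"
proof (cases "p \<in> arcs G")
  case True
  then show ?thesis using assms by (auto simp: support_def)
next
  case False
  moreover have "z \<in> cycle_space G r" using assms(1) form_radical_subset by blast
  ultimately show ?thesis by (simp add: cycle_space_outside)
qed

lemma form_radical_subset_support_radical: "form_radical G r x \<subseteq> support_radical x"
proof
  fix z assume z: "z \<in> form_radical G r x"
  then show "z \<in> support_radical x"
    using form_radical_outside_support[OF z]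
    by (auto simp: support_radical_def support_cycles_def form_radical_def radical_def)
qed

text \<open>Otherwise adding the wedge of \<open>f\<close> and \<open>g\<close> would lower the
  corank from three to one.\<close>

lemma form_radical_wedge_dependent:
  assumes no: "\<forall>x. local_form G x \<longrightarrow> \<not> dim_at_most (Suc 0) (form_radical G r x)"
    and x: "local_form G x" "dim_at_most (Suc (Suc (Suc 0))) (form_radical G r x)"
    and fg: "f \<in> arcs G" "g \<in> arcs G" "tail G f = tail G g"
    and zw: "z \<in> form_radical G r x" "w \<in> form_radical G r x"
  shows "z f * w g = w f * z g"
proof (rule ccontr)
  assume "\<not> ?thesis"
  with zw have ind: "independent_on (form_radical G r x) (\<lambda>z. z f) (\<lambda>z. z g)"
    unfolding independent_on_def by blast
  let ?x = "\<lambda>a b. x a b + 1 * arc_wedge f g a b"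
  have "form_radical G r ?x \<subseteq> {z \<in> form_radical G r x. z f = 0 \<and> z g = 0}"
    unfolding form_radical_def form_of_add_wedge[OF finite_arcs fg(1,2)]
    by (rule radical_add_wedge_subset[OF skew_form_form_of[OF x(1)]])
      (use ind in \<open>simp_all add: form_radical_def\<close>)
  then have "dim_at_most (Suc 0) (form_radical G r ?x)"
    by (rule dim_at_most_subset[OF dim_at_most_kernel[OF linear_apply linear_apply ind x(2)]])
  with no local_form_add_wedge[OF x(1) fg, of 1] show False by blast
qed

text \<open>Adding a multiple of a wedge at a vertex shears the radical along a vector \<open>u\<close>. As the
  support was as large as possible, \<open>u\<close> vanishes outside of it.\<close>

lemma form_radical_perturb:
  assumes no: "\<forall>x. local_form G x \<longrightarrow> \<not> dim_at_most (Suc 0) (form_radical G r x)"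
    and adm: "admissible a b x"
    and max: "\<forall>y. admissible a b y \<longrightarrow> card (support y) \<le> card (support x)"
    and fg: "f \<in> support x" "g \<in> arcs G" "tail G f = tail G g"
  shows "\<exists>s u k. s \<noteq> 0 \<and> u \<in> support_cycles x \<and>
    (\<forall>w\<in>cycle_space G r. form_of G x u w = w g - k * w f) \<and>
    (\<forall>z\<in>form_radical G r x. z g = k * z f) \<and>
    admissible a b (\<lambda>p q. x p q + s * arc_wedge f g p q) \<and>
    support (\<lambda>p q. x p q + s * arc_wedge f g p q) = support x"
proof -
  let ?Z = "cycle_space G r" and ?R = "form_radical G r x" and ?\<omega> = "form_of G x"
  have x: "local_form G x" "dim_at_most (Suc (Suc (Suc 0))) ?R"
    "independent_on ?R (\<lambda>z. z a) (\<lambda>z. z b)"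
    using adm by (auto simp: admissible_def)
  have skew: "skew_form ?\<omega>" by (rule skew_form_form_of[OF x(1)])
  note lin = skew_form_linear_left[OF skew]
  have fA: "f \<in> arcs G" using fg(1) by (simp add: support_def)
  obtain z0 where z0: "z0 \<in> ?R" "z0 f \<noteq> 0" using fg(1) by (auto simp: support_def)
  define k where "k = z0 g / z0 f"
  have k: "z g = k * z f" if "z \<in> ?R" for z
    using form_radical_wedge_dependent[OF no x(1,2) fA fg(2,3) z0(1) that] z0(2)
    by (simp add: k_def field_simps)
  obtain B where B: "finite B" "?Z = span B"
  proof (rule subspace_finitely_spanned[OF subspace_cycle_space[of G r] finite_arcs])
    show "z p = 0" if "z \<in> ?Z" "p \<notin> arcs G" for z p using that by (rule cycle_space_outside)
  qed
  have linh: "linear (\<lambda>w. w g - k * w f)" by (rule linearI) (auto simp: algebra_simps)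
  have "w g - k * w f = 0" if "w \<in> radical ?\<omega> ?Z" for w
    using k[of w] that by (simp add: form_radical_def)
  then obtain u0 where u0: "u0 \<in> ?Z" "\<And>w. w \<in> ?Z \<Longrightarrow> ?\<omega> u0 w = w g - k * w f"
    using functional_representable[OF skew B linh] by blast
  have z0Z: "z0 \<in> ?Z" using z0 form_radical_subset by blast
  \<comment> \<open>Subtracting a radical vector does not change the represented functional and
    normalises \<open>u\<close> to vanish at \<open>f\<close>, as the shear requires.\<close>
  define u where "u = u0 - (u0 f / z0 f) *\<^sub>R z0"
  have uZ: "u \<in> ?Z"
    unfolding u_def by (intro subspace_diff subspace_scale subspace_cycle_space u0(1) z0Z)
  have uf: "u f = 0" using z0(2) by (simp add: u_def)
  have u\<omega>: "?\<omega> u w = w g - k * w f" if "w \<in> ?Z" for w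
  proof -
    have "?\<omega> z0 w = 0" using z0(1) that by (simp add: form_radical_def radical_def)
    then show ?thesis
      unfolding u_def linear_diff[OF lin] linear_scale[OF lin] using u0(2)[OF that] by simp
  qed
  define x' where "x' s p q = x p q + s * arc_wedge f g p q" for s p q
  have loc': "local_form G (x' s)" for s
    using local_form_add_wedge[OF x(1) fA fg(2,3), of s] by (simp add: x'_def[abs_def])
  have R': "form_radical G r (x' s) = (\<lambda>z. z - (s * z f) *\<^sub>R u) ` ?R" if "s \<noteq> 0" for s
  proof -
    have "form_of G (x' s) = (\<lambda>z w. ?\<omega> z w + s * wedge (\<lambda>z. z f) (\<lambda>z. z g) z w)"
      using form_of_add_wedge[OF finite_arcs fA fg(2), of x s] by (simp add: x'_def[abs_def])
    moreover have "radical (\<lambda>z w. ?\<omega> z w + s * wedge (\<lambda>z. z f) (\<lambda>z. z g) z w) ?Z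
        = (\<lambda>z. z - (s * z f) *\<^sub>R u) ` radical ?\<omega> ?Z"
    proof (rule radical_add_wedge_shear[where k = k and p = z0 and f = "\<lambda>z. z f" and g = "\<lambda>z. z g"])
      show "?\<omega> u w = w g - k * w f" if "w \<in> ?Z" for w using that by (rule u\<omega>)
      show "z g = k * z f" if "z \<in> radical ?\<omega> ?Z" for z using that k by (simp add: form_radical_def)
    qed (use skew subspace_cycle_space linear_apply that uZ uf z0 in \<open>auto simp: form_radical_def\<close>)
    ultimately show ?thesis unfolding form_radical_def by simp
  qed
  have "\<forall>p\<in>support x. \<exists>z. z \<in> ?R \<and> z p \<noteq> 0" by (auto simp: support_def)
  then obtain y where y: "\<And>p. p \<in> support x \<Longrightarrow> y p \<in> ?R \<and> y p p \<noteq> 0" by metis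
  obtain p1 p2 where p12: "p1 \<in> ?R" "p2 \<in> ?R" "p1 a * p2 b \<noteq> p2 a * p1 b"
    using x(3) unfolding independent_on_def by blast
  define \<Delta> where "\<Delta> = p1 a * p2 b - p2 a * p1 b"
  \<comment> \<open>The coefficient of \<open>- s\<close> in the minor of the sheared vectors at
    \<open>a\<close> and \<open>b\<close>; the terms quadratic in \<open>s\<close> cancel.\<close>
  define \<Delta>1 where "\<Delta>1 = p1 a * p2 f * u b + p1 f * u a * p2 b - p2 a * p1 f * u b - p2 f * u a * p1 b"
  \<comment> \<open>The multiples to avoid: zero, the one at which \<open>a\<close> and
    \<open>b\<close> become dependent, and those at which an arc \<open>p\<close> could drop out of
    the support. A zero denominator yields 0 and excludes nothing further.\<close>
  define Bad where "Bad = {0, \<Delta> / \<Delta>1} \<union> (\<lambda>p. y p p / (y p f * u p)) ` support x"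
  have "finite (support x)" by (rule finite_subset[OF _ finite_arcs]) (auto simp: support_def)
  then have "finite Bad" by (simp add: Bad_def)
  then obtain s where s: "s \<notin> Bad" using ex_new_if_finite[OF infinite_UNIV_char_0] by blast
  then have s0: "s \<noteq> 0" by (simp add: Bad_def)
  have sup: "support x \<subseteq> support (x' s)"
  proof
    fix p assume p: "p \<in> support x"
    have "y p p / (y p f * u p) \<in> Bad" using p by (simp add: Bad_def)
    then have "s \<noteq> y p p / (y p f * u p)" using s by blast
    then have "y p p - (s * y p f) * u p \<noteq> 0"
      using y[OF p] by (cases "y p f * u p = 0") (auto simp: field_simps)
    then show "p \<in> support (x' s)"
      using y[OF p] p unfolding support_def R'[OF s0] by auto
  qed
  have dim': "dim_at_most (Suc (Suc (Suc 0))) (form_radical G r (x' s))"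
    unfolding R'[OF s0]
    by (rule dim_at_most_linear_image[OF _ x(2)]) (rule linearI, auto simp: fun_eq_iff algebra_simps)
  have ind': "independent_on (form_radical G r (x' s)) (\<lambda>z. z a) (\<lambda>z. z b)"
  proof -
    let ?T = "\<lambda>z. z - (s * z f) *\<^sub>R u"
    have "?T p1 a * ?T p2 b - ?T p2 a * ?T p1 b = \<Delta> - s * \<Delta>1"
      by (simp add: \<Delta>_def \<Delta>1_def algebra_simps)
    moreover have "\<Delta> - s * \<Delta>1 \<noteq> 0"
    proof (cases "\<Delta>1 = 0")
      case True
      then show ?thesis using p12(3) by (simp add: \<Delta>_def)
    next
      case False
      then show ?thesis using s by (auto simp: Bad_def field_simps)
    qed
    ultimately have "?T p1 a * ?T p2 b \<noteq> ?T p2 a * ?T p1 b" by linarith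
    then show ?thesis unfolding independent_on_def R'[OF s0] using p12(1,2) by blast
  qed
  have adm': "admissible a b (x' s)" using loc' dim' ind' by (simp add: admissible_def)
  have eq: "support (x' s) = support x"
  proof (rule sym, rule card_seteq[OF _ sup])
    show "finite (support (x' s))" by (rule finite_subset[OF _ finite_arcs]) (auto simp: support_def)
    show "card (support (x' s)) \<le> card (support x)" using max adm' by blast
  qed
  \<comment> \<open>The support has not grown, so \<open>z0\<close> and its sheared copy both vanish
    at \<open>p\<close>; they differ by a nonzero multiple of \<open>u\<close>.\<close>
  have "u p = 0" if p: "p \<notin> support x" for p
  proof -
    have "z0 - (s * z0 f) *\<^sub>R u \<in> form_radical G r (x' s)" unfolding R'[OF s0] using z0(1) by blast
    then have "(z0 - (s * z0 f) *\<^sub>R u) p = 0"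
      by (rule form_radical_outside_support) (simp add: eq p)
    then show ?thesis using form_radical_outside_support[OF z0(1) p] s0 z0(2) by simp
  qed
  then have "u \<in> support_cycles x" using uZ by (simp add: support_cycles_def)
  moreover have "\<forall>w\<in>?Z. ?\<omega> u w = w g - k * w f" using u\<omega> by blast
  moreover have "\<forall>z\<in>?R. z g = k * z f" using k by blast
  ultimately show ?thesis using s0 adm' eq unfolding x'_def[abs_def] by blast
qed

text \<open>The form has largest support among the admissible ones and, among those, the least
  dimension bound for \<open>support_radical\<close>. The third conclusion uses the second choice:
  an additional wedge would lower that bound by two. The last one uses the first choice, through the
  perturbation lemma.\<close>

lemma extremal_form:
  assumes no: "\<forall>x. local_form G x \<longrightarrow> \<not> dim_at_most (Suc 0) (form_radical G r x)"
    and x0: "admissible a b x0"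
  obtains x where "local_form G x" "independent_on (form_radical G r x) (\<lambda>z. z a) (\<lambda>z. z b)"
    "\<And>p q t t'. tail G p = tail G q \<Longrightarrow> t \<in> support_radical x \<Longrightarrow> t' \<in> support_radical x \<Longrightarrow> t p * t' q = t' p * t q"
    "\<And>p g. p \<in> support x \<Longrightarrow> g \<in> arcs G - support x \<Longrightarrow> tail G p = tail G g \<Longrightarrow>
      \<exists>u\<in>support_radical x. \<forall>w\<in>cycle_space G r. form_of G x u w = w g"
proof -
  have cS: "card (support x) \<le> card (arcs G)" for x
    by (rule card_mono) (auto simp: support_def)
  obtain x1 where x1: "admissible a b x1" "\<And>y. admissible a b y \<Longrightarrow> card (support y) \<le> card (support x1)"
    using ex_has_greatest_nat[of "admissible a b", OF x0, of "\<lambda>x. card (support x)" "Suc (card (arcs G))"] le_imp_less_Suc[OF cS]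
    by blast
  define opt where "opt x \<longleftrightarrow> admissible a b x \<and> card (support x) = card (support x1)" for x
  define Q where "Q n \<longleftrightarrow> (\<exists>x. opt x \<and> dim_at_most n (support_radical x))" for n
  have "Q (card (arcs G))"
    unfolding Q_def
  proof (intro exI[of _ x1] conjI)
    show "opt x1" using x1 by (simp add: opt_def)
    show "dim_at_most (card (arcs G)) (support_radical x1)"
      unfolding dim_at_most_def
    proof (intro allI impI)
      fix z :: "nat \<Rightarrow> 'b \<Rightarrow> real" assume z: "\<forall>i\<le>card (arcs G). z i \<in> support_radical x1"
      obtain c where c: "\<exists>i\<in>{..card (arcs G)}. c i \<noteq> 0"
        "\<forall>p\<in>arcs G. (\<Sum>i\<in>{..card (arcs G)}. c i * z i p) = 0"
        using homogeneous_system_nontrivial_solution[of "arcs G" "{..card (arcs G)}" z] by auto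
      have "(\<Sum>i\<le>card (arcs G). c i *\<^sub>R z i) p = 0" for p
      proof (cases "p \<in> arcs G")
        case True
        then show ?thesis using c(2) by (simp add: sum_fun_apply)
      next
        case False
        have "z i p = 0" if "i \<le> card (arcs G)" for i
          using z that False by (auto simp: support_radical_def radical_def support_cycles_def cycle_space_outside)
        then show ?thesis by (simp add: sum_fun_apply)
      qed
      then have "(\<Sum>i\<le>card (arcs G). c i *\<^sub>R z i) = 0" by (simp add: fun_eq_iff)
      then show "\<exists>c. (\<exists>i\<le>card (arcs G). c i \<noteq> 0) \<and> (\<Sum>i\<le>card (arcs G). c i *\<^sub>R z i) = 0"
        using c(1) by auto
    qed
  qed
  define n where "n = (LEAST n. Q n)"
  have "Q n" unfolding n_def using \<open>Q (card (arcs G))\<close> by (rule LeastI)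
  then obtain x where x: "opt x" "dim_at_most n (support_radical x)" unfolding Q_def by blast
  have min: "n \<le> m" if "Q m" for m unfolding n_def using that by (rule Least_le)
  have xa: "local_form G x" "dim_at_most (Suc (Suc (Suc 0))) (form_radical G r x)"
    "independent_on (form_radical G r x) (\<lambda>z. z a) (\<lambda>z. z b)"
    using x(1) by (auto simp: opt_def admissible_def)
  have xmax: "\<forall>y. admissible a b y \<longrightarrow> card (support y) \<le> card (support x)"
    using x1(2) x(1) by (simp add: opt_def)
  have xadm: "admissible a b x" using x(1) by (simp add: opt_def)
  note perturb = form_radical_perturb[OF no xadm xmax]
  show ?thesis
  proof (rule that[OF xa(1,3)])
    fix p q t t'
    assume pq: "tail G p = tail G q" and t: "t \<in> support_radical x" "t' \<in> support_radical x"
    show "t p * t' q = t' p * t q"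
    proof (rule ccontr)
      assume ne: "\<not> ?thesis"
      have out: "t c = 0" "t' c = 0" if "c \<notin> support x" for c
        using t that by (auto simp: support_radical_def radical_def support_cycles_def)
      have p: "p \<in> support x" by (rule ccontr) (use ne out[of p] in simp)
      have q: "q \<in> support x" by (rule ccontr) (use ne out[of q] in simp)
      have pA: "p \<in> arcs G" "q \<in> arcs G" using p q by (auto simp: support_def)
      have ind: "independent_on (support_radical x) (\<lambda>z. z p) (\<lambda>z. z q)"
        unfolding independent_on_def using ne t by blast
      obtain s where s: "s \<noteq> 0"
        "admissible a b (\<lambda>c e. x c e + s * arc_wedge p q c e)"
        "support (\<lambda>c e. x c e + s * arc_wedge p q c e) = support x"
        using perturb[OF p pA(2) pq] by blast
      let ?x = "\<lambda>c e. x c e + s * arc_wedge p q c e"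
      have "support_radical ?x \<subseteq> {z \<in> support_radical x. z p = 0 \<and> z q = 0}"
        unfolding support_radical_def support_cycles_def s(3) form_of_add_wedge[OF finite_arcs pA]
        by (rule radical_add_wedge_subset[OF skew_form_form_of[OF xa(1)] s(1)])
          (use ind in \<open>simp add: support_radical_def support_cycles_def\<close>)
      moreover obtain m where m: "n = Suc (Suc m)"
        using independent_on_not_dim_at_most_1[OF linear_apply linear_apply ind x(2)] by blast
      ultimately have "dim_at_most m (support_radical ?x)"
        using dim_at_most_kernel[OF linear_apply linear_apply ind x(2)[unfolded m]] dim_at_most_subset by blast
      moreover have "opt ?x"
        using s x(1) unfolding opt_def by simp
      ultimately have "Q m" unfolding Q_def by blast
      then show False using min m by fastforce
    qed
  next
    fix p g assume p: "p \<in> support x" and g: "g \<in> arcs G - support x" and pg: "tail G p = tail G g"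
    have gA: "g \<in> arcs G" using g by blast
    obtain u k where u: "u \<in> support_cycles x"
      "\<forall>w\<in>cycle_space G r. form_of G x u w = w g - k * w p"
      "\<forall>z\<in>form_radical G r x. z g = k * z p"
      using perturb[OF p gA pg] by blast
    obtain z where z: "z \<in> form_radical G r x" "z p \<noteq> 0" using p by (auto simp: support_def)
    have "z g = 0" using z(1) g by (auto simp: support_def)
    \<comment> \<open>All radical vectors vanish at \<open>g\<close>, but not all at
      \<open>p\<close>; so the represented functional is the plain value at \<open>g\<close>, which
      is zero on cycles on the support.\<close>
    then have k: "k = 0" using bspec[OF u(3) z(1)] z(2) by simp
    have "form_of G x u w = 0" if "w \<in> support_cycles x" for w
      using u(2) that g k by (auto simp: support_cycles_def)
    then have "u \<in> support_radical x" using u(1) by (simp add: support_radical_def radical_def)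
    then show "\<exists>u\<in>support_radical x. \<forall>w\<in>cycle_space G r. form_of G x u w = w g"
      using u(2) k by (intro bexI[of _ u]) auto
  qed
qed

lemma form_of_eq_functional:
  "form_of G x y w = (\<Sum>p\<in>arcs G. (\<Sum>q\<in>arcs G. x q p * y q) * w p)"
proof -
  have "form_of G x y w = (\<Sum>p\<in>arcs G. \<Sum>q\<in>arcs G. x q p * y q * w p)"
    unfolding form_of_def by (rule sum.swap)
  then show ?thesis by (simp add: sum_distrib_right)
qed

text \<open>\<open>N\<close> is the support of the radical of an extremal form. Within
  \<open>X\<close>, the nonconstant potential \<open>\<phi>\<close> may jump only along the
  splitting-edge and along spokes outside \<open>N\<close>; an application has to connect
  \<open>X\<close> by other edges to reach a contradiction.\<close>

lemma separating_potential:
  fixes d :: 'b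
  assumes no: "\<forall>x. local_form G x \<longrightarrow> \<not> dim_at_most (Suc 0) (form_radical G r x)"
    and adm: "admissible a b x0"
    and v: "v' \<noteq> v''" "d \<in> arcs G" "tail G d = v'" "head G d = v''"
    and ab: "a \<in> arcs G" "tail G a = v'" "b \<in> arcs G" "tail G b = v''"
    and X: "finite X" "v' \<in> X" "v'' \<in> X"
    and spoke: "\<forall>x\<in>X - {v', v''}. spoke x \<in> arcs G \<and> tail G (spoke x) \<in> {v', v''} \<and> head G (spoke x) = x"
  shows "\<exists>(\<phi> :: 'a \<Rightarrow> real) N. a \<in> N \<and> b \<in> N \<and> (\<exists>x\<in>X. \<phi> x \<noteq> \<phi> v') \<and>
    (\<forall>p\<in>arcs G. tail G p \<in> X \<and> head G p \<in> X \<and> p \<noteq> d \<and> r p \<noteq> d \<and>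
      (p \<in> N \<or> (\<forall>x\<in>X - {v', v''}. p \<noteq> spoke x \<and> r p \<noteq> spoke x)) \<longrightarrow> \<phi> (tail G p) = \<phi> (head G p))"
proof -
  obtain x where x: "local_form G x" and ind: "independent_on (form_radical G r x) (\<lambda>z. z a) (\<lambda>z. z b)"
    and dep: "\<And>p q t t'. tail G p = tail G q \<Longrightarrow> t \<in> support_radical x \<Longrightarrow> t' \<in> support_radical x \<Longrightarrow> t p * t' q = t' p * t q"
    and rep: "\<And>p g. p \<in> support x \<Longrightarrow> g \<in> arcs G - support x \<Longrightarrow> tail G p = tail G g \<Longrightarrow>
      \<exists>u\<in>support_radical x. \<forall>w\<in>cycle_space G r. form_of G x u w = w g"
    by (rule extremal_form[OF no adm]) blast
  define R where "R = form_radical G r x"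
  define T where "T = support_radical x"
  define N where "N = support x"
  have RT: "R \<subseteq> T" unfolding R_def T_def by (rule form_radical_subset_support_radical)
  have subT: "subspace T" unfolding T_def by (rule subspace_support_radical[OF x])
  have TZ: "t \<in> cycle_space G r" if "t \<in> T" for t
    using that by (simp add: T_def support_radical_def radical_def support_cycles_def)
  have Tout: "t p = 0" if "t \<in> T" "p \<notin> N" for t p
    using that by (simp add: T_def N_def support_radical_def radical_def support_cycles_def)
  have NG: "N \<subseteq> arcs G" by (auto simp: N_def support_def)
  have Nz: "\<exists>z\<in>R. z p \<noteq> 0" if "p \<in> N" for p using that by (simp add: N_def support_def R_def)
  have NI: "p \<in> N" if "p \<in> arcs G" "z \<in> R" "z p \<noteq> 0" for p z
    using that unfolding N_def support_def R_def by blast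
  have Nr: "r p \<in> N" if p: "p \<in> N" for p
  proof -
    obtain z where z: "z \<in> R" "z p \<noteq> 0" using Nz[OF p] by blast
    have pA: "p \<in> arcs G" using p NG by blast
    then have "z (r p) \<noteq> 0" using z TZ RT cycle_space_rev[of z G r p] by auto
    then show ?thesis using NI[of "r p" z] z(1) pA by simp
  qed
  obtain z1 z2 where z12: "z1 \<in> R" "z2 \<in> R" "z1 a * z2 b \<noteq> z2 a * z1 b"
    using ind unfolding independent_on_def R_def by blast
  have aN: "a \<in> N"
  proof (rule ccontr)
    assume "a \<notin> N"
    then have "z1 a = 0" "z2 a = 0" using NI[OF ab(1)] z12(1,2) by blast+
    then show False using z12(3) by simp
  qed
  have bN: "b \<in> N"
  proof (rule ccontr)
    assume "b \<notin> N"
    then have "z1 b = 0" "z2 b = 0" using NI[OF ab(3)] z12(1,2) by blast+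
    then show False using z12(3) by simp
  qed
  \<comment> \<open>\<open>d\<close> shares its tail with \<open>a\<close>, and its reverse shares
    its tail with \<open>b\<close>. If \<open>d\<close> were supported, the values at
    \<open>a\<close> and \<open>b\<close> would both be proportional to that at \<open>d\<close> on
    the radical, hence dependent.\<close>
  have dN: "d \<notin> N"
  proof
    assume "d \<in> N"
    then obtain z where z: "z \<in> R" "z d \<noteq> 0" using Nz by blast
    have rev: "t (r d) = - t d" if "t \<in> R" for t
      using cycle_space_rev[OF TZ v(2)] that RT by blast
    have "t a * z d = z a * t d \<and> t b * z d = z b * t d" if t: "t \<in> R" for t
    proof -
      have T: "t \<in> support_radical x" "z \<in> support_radical x" using t z(1) RT by (auto simp: T_def)
      show ?thesis
        using dep[OF _ T, of a d] dep[OF _ T, of b "r d"] rev[OF t] rev[OF z(1)] v ab by simp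
    qed
    from this[OF z12(1)] this[OF z12(2)]
    have "(z1 a * z2 b - z2 a * z1 b) * (z d * z d) = 0" by algebra
    then show False using z(2) z12(3) by simp
  qed
  \<comment> \<open>Vanishing spreads: from one supported arc to all arcs at its tail, because
    values at a vertex are proportional, then by antisymmetry to the other end of a supported edge,
    and so through a whole component.\<close>
  define van where "van t u \<longleftrightarrow> (\<forall>p\<in>arcs G. tail G p = u \<longrightarrow> t p = 0)" for t :: "'b \<Rightarrow> real" and u
  have vanI: "van t (tail G p)" if tT: "t \<in> T" and pN: "p \<in> N" and t0: "t p = 0" for t p
    unfolding van_def
  proof (intro ballI impI)
    fix q assume q: "q \<in> arcs G" "tail G q = tail G p"
    obtain z where z: "z \<in> R" "z p \<noteq> 0" using Nz[OF pN] by blast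
    have "t p * z q = z p * t q" using dep[of p q t z] tT z(1) RT q by (auto simp: T_def)
    then show "t q = 0" using t0 z(2) by simp
  qed
  define E where "E = {(tail G p, head G p) | p. p \<in> N}"
  have "sym E"
  proof (rule symI)
    fix u w assume "(u, w) \<in> E"
    then obtain p where p: "p \<in> N" "u = tail G p" "w = head G p" by (auto simp: E_def)
    have "p \<in> arcs G" using p NG by blast
    then have "w = tail G (r p)" "u = head G (r p)" using p by simp_all
    then show "(w, u) \<in> E" using Nr[OF p(1)] unfolding E_def by blast
  qed
  then have symE: "sym (E\<^sup>*)" by (rule sym_rtrancl)
  have van_rtrancl: "van t w" if "(u, w) \<in> E\<^sup>*" "t \<in> T" "van t u" for t u w
    using that
  proof (induction rule: rtrancl_induct)
    case (step w y)
    then obtain p where p: "p \<in> N" "w = tail G p" "y = head G p" by (auto simp: E_def)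
    have pA: "p \<in> arcs G" using p NG by blast
    have "t p = 0" using step.IH step.prems p pA by (auto simp: van_def)
    then have "t (r p) = 0" using cycle_space_rev[OF TZ[OF step.prems(1)] pA] by simp
    then show ?case using vanI[OF step.prems(1) Nr[OF p(1)]] p(3) pA by simp
  qed simp
  define comp where "comp u = E\<^sup>* `` {u}" for u
  have comp_eq: "comp u = comp w \<longleftrightarrow> (u, w) \<in> E\<^sup>*" for u w
  proof
    assume "comp u = comp w"
    then have "w \<in> comp u" by (simp add: comp_def)
    then show "(u, w) \<in> E\<^sup>*" by (simp add: comp_def)
  next
    assume uw: "(u, w) \<in> E\<^sup>*"
    then have "(w, u) \<in> E\<^sup>*" using symE by (auto dest: symD)
    with uw show "comp u = comp w" unfolding comp_def by (auto intro: rtrancl_trans)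
  qed
  define S where "S = {u \<in> X. \<exists>p\<in>N. tail G p = u}"
  define \<D> where "\<D> = comp ` S"
  have finD: "finite \<D>" using X(1) by (simp add: \<D>_def S_def)
  have vS: "v' \<in> S" "v'' \<in> S" using X ab aN bN by (auto simp: S_def)
  \<comment> \<open>In a common component, the combination of \<open>z1\<close> and
    \<open>z2\<close> that vanishes at \<open>a\<close> would vanish at \<open>b\<close> as well,
    contrary to independence.\<close>
  have CC: "comp v' \<noteq> comp v''"
  proof
    assume "comp v' = comp v''"
    then have vv: "(v', v'') \<in> E\<^sup>*" by (simp add: comp_eq)
    define z where "z = z2 a *\<^sub>R z1 - z1 a *\<^sub>R z2"
    have zT: "z \<in> T"
      using z12 RT subT unfolding z_def by (intro subspace_diff subspace_scale) auto
    have "z a = 0" by (simp add: z_def)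
    then have "van z v'" using vanI[OF zT aN] ab by simp
    then have "van z v''" using van_rtrancl[OF vv zT] by blast
    then have "z b = 0" using ab by (simp add: van_def)
    then show False using z12(3) by (simp add: z_def)
  qed
  define \<D>' where "\<D>' = \<D> - {comp v', comp v''}"
  have "\<forall>D\<in>\<D>. \<exists>p. p \<in> N \<and> comp (tail G p) = D" by (auto simp: \<D>_def S_def)
  \<comment> \<open>One supported arc for each component: a vector of \<open>T\<close> that vanishes
    there vanishes throughout, so each component costs one equation.\<close>
  then obtain e where e: "\<And>D. D \<in> \<D> \<Longrightarrow> e D \<in> N \<and> comp (tail G (e D)) = D" by metis
  have "\<forall>D\<in>\<D>'. \<exists>x. x \<in> S \<and> comp x = D" by (auto simp: \<D>'_def \<D>_def)
  then obtain c where c: "\<And>D. D \<in> \<D>' \<Longrightarrow> c D \<in> S \<and> comp (c D) = D" by metis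
  have cX: "c D \<in> X - {v', v''}" if "D \<in> \<D>'" for D
    using c[OF that] that by (auto simp: S_def \<D>'_def)
  define g where "g D = spoke (c D)" for D
  have g: "g D \<in> arcs G" "tail G (g D) \<in> {v', v''}" "head G (g D) = c D" if "D \<in> \<D>'" for D
    using spoke cX[OF that] by (auto simp: g_def)
  \<comment> \<open>A supported spoke would put \<open>c D\<close> into the component of
    \<open>v'\<close> or of \<open>v''\<close>.\<close>
  have gN: "g D \<notin> N" if D: "D \<in> \<D>'" for D
  proof
    assume "g D \<in> N"
    then have "(tail G (g D), c D) \<in> E" using g(3)[OF D] unfolding E_def by force
    then have "comp (tail G (g D)) = comp (c D)" by (simp add: comp_eq r_into_rtrancl)
    then have "D = comp v' \<or> D = comp v''" using c[OF D] g(2)[OF D] by auto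
    then show False using D by (simp add: \<D>'_def)
  qed
  have "\<exists>u\<in>T. \<forall>w\<in>cycle_space G r. form_of G x u w = w (g D)" if D: "D \<in> \<D>'" for D
  proof -
    obtain p where "p \<in> N" "tail G p = tail G (g D)" using g(2)[OF D] aN bN ab by auto
    then show ?thesis using rep[of p "g D"] g(1)[OF D] gN[OF D] by (simp add: N_def T_def)
  qed
  then have "\<forall>D\<in>\<D>'. \<exists>u. u \<in> T \<and> (\<forall>w\<in>cycle_space G r. form_of G x u w = w (g D))" by blast
  then obtain U where U: "\<And>D. D \<in> \<D>' \<Longrightarrow> U D \<in> T \<and> (\<forall>w\<in>cycle_space G r. form_of G x (U D) w = w (g D))"
    by metis
  obtain ud where ud: "ud \<in> T" "\<And>w. w \<in> cycle_space G r \<Longrightarrow> form_of G x ud w = w d"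
    using rep[of a d] aN dN v ab by (auto simp: N_def T_def)
  \<comment> \<open>The unknowns: 0 stands for the vector of \<open>d\<close>, 1 and 2 for
    \<open>z1\<close> and \<open>z2\<close>, the rest for the spokes. Two components have no spoke,
    so there are \<open>3 + (card \<D> - 2)\<close> unknowns, one more than equations.\<close>
  define I where "I = {0, 1, 2 :: nat} <+> \<D>'"
  define Y where "Y i = (case i of Inl n \<Rightarrow> (if n = 0 then ud else if n = 1 then z1 else z2) | Inr D \<Rightarrow> U D)"
    for i :: "nat + 'a set"
  have finD': "finite \<D>'" using finD by (simp add: \<D>'_def)
  have finI: "finite I" using finD' by (simp add: I_def)
  have "card {comp v', comp v''} \<le> card \<D>" using vS finD by (intro card_mono) (auto simp: \<D>_def)
  moreover have "card \<D>' = card \<D> - card {comp v', comp v''}"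
    unfolding \<D>'_def using vS by (intro card_Diff_subset) (auto simp: \<D>_def)
  ultimately have "card I = Suc (card \<D>)"
    using finD' CC by (simp add: I_def card_Plus)
  then obtain k where k: "\<exists>i\<in>I. k i \<noteq> 0" "\<And>D. D \<in> \<D> \<Longrightarrow> (\<Sum>i\<in>I. k i * Y i (e D)) = 0"
    using homogeneous_system_nontrivial_solution[OF finD finI, of "\<lambda>i D. Y i (e D)"] by auto
  have YT: "Y i \<in> T" if "i \<in> I" for i
    using that ud(1) z12(1,2) RT U by (auto simp: I_def Y_def)
  define y where "y = (\<Sum>i\<in>I. k i *\<^sub>R Y i)"
  have yT: "y \<in> T" unfolding y_def using YT by (intro subspace_sum subspace_scale subT)
  have van_y: "van y u" if u: "u \<in> X" for u
  proof (cases "u \<in> S")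
    case True
    then have D: "comp u \<in> \<D>" by (simp add: \<D>_def)
    have "y (e (comp u)) = 0" using k(2)[OF D] by (simp add: y_def sum_fun_apply)
    then have "van y (tail G (e (comp u)))" using vanI[OF yT] e[OF D] by blast
    moreover have "(tail G (e (comp u)), u) \<in> E\<^sup>*" using e[OF D] by (simp add: comp_eq[symmetric])
    ultimately show ?thesis using van_rtrancl yT by blast
  next
    case False
    then show ?thesis using u Tout[OF yT] by (auto simp: van_def S_def)
  qed
  note lin = skew_form_linear_left[OF skew_form_form_of[OF x]]
  have \<omega>y: "form_of G x y w = k (Inl 0) * w d + (\<Sum>D\<in>\<D>'. k (Inr D) * w (g D))"
    if w: "w \<in> cycle_space G r" for w
  proof -
    have R0: "form_of G x z w = 0" if "z \<in> R" for z
      using that w by (simp add: R_def form_radical_def radical_def)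
    have "form_of G x y w = (\<Sum>i\<in>I. k i * form_of G x (Y i) w)"
      unfolding y_def by (simp add: linear_sum[OF lin] linear_scale[OF lin])
    also have "\<dots> = (\<Sum>n\<in>{0, 1, 2}. k (Inl n) * form_of G x (Y (Inl n)) w)
        + (\<Sum>D\<in>\<D>'. k (Inr D) * form_of G x (Y (Inr D)) w)"
      unfolding I_def using finD' by (subst sum.Plus) auto
    also have "(\<Sum>n\<in>{0, 1, 2}. k (Inl n) * form_of G x (Y (Inl n)) w) = k (Inl 0) * w d"
      using ud(2)[OF w] R0[OF z12(1)] R0[OF z12(2)] by (simp add: Y_def)
    also have "(\<Sum>D\<in>\<D>'. k (Inr D) * form_of G x (Y (Inr D)) w) = (\<Sum>D\<in>\<D>'. k (Inr D) * w (g D))"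
      using U w by (intro sum.cong) (auto simp: Y_def)
    finally show ?thesis .
  qed
  \<comment> \<open>\<open>Q\<close> is the coefficient vector of the functional of
    \<open>y\<close>, and \<open>L\<close> that of the combination of arcs; they agree on cycles, so
    the antisymmetric part of their difference is a cut.\<close>
  define Q where "Q p = (\<Sum>q\<in>arcs G. x q p * y q)" for p
  define L where "L p = k (Inl 0) * of_bool (p = d) + (\<Sum>D\<in>\<D>'. k (Inr D) * of_bool (p = g D))" for p
  have "(\<Sum>p\<in>arcs G. (Q p - L p) * w p) = 0" if w: "w \<in> cycle_space G r" for w
  proof -
    have delta: "(\<Sum>p\<in>arcs G. of_bool (p = c) * w p) = w c" if "c \<in> arcs G" for c
      using that by (simp add: of_bool_def if_distrib[of "\<lambda>t. t * _"] sum.delta cong: if_cong)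
    have "(\<Sum>p\<in>arcs G. L p * w p) = k (Inl 0) * (\<Sum>p\<in>arcs G. of_bool (p = d) * w p)
        + (\<Sum>p\<in>arcs G. \<Sum>D\<in>\<D>'. k (Inr D) * (of_bool (p = g D) * w p))"
      unfolding L_def distrib_right sum.distrib sum_distrib_left sum_distrib_right mult.assoc ..
    also have "(\<Sum>p\<in>arcs G. \<Sum>D\<in>\<D>'. k (Inr D) * (of_bool (p = g D) * w p))
        = (\<Sum>D\<in>\<D>'. k (Inr D) * (\<Sum>p\<in>arcs G. of_bool (p = g D) * w p))"
      unfolding sum_distrib_left by (rule sum.swap)
    also have "\<dots> = (\<Sum>D\<in>\<D>'. k (Inr D) * w (g D))"
      using delta g(1) by (intro sum.cong) auto
    finally have "(\<Sum>p\<in>arcs G. L p * w p) = form_of G x y w" using delta[OF v(2)] \<omega>y[OF w] by simp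
    then show ?thesis
      unfolding left_diff_distrib sum_subtractf form_of_eq_functional[of x y w] Q_def by simp
  qed
  then obtain \<phi> where \<phi>: "\<And>p. p \<in> arcs G \<Longrightarrow> (Q p - L p) - (Q (r p) - L (r p)) = \<phi> (tail G p) - \<phi> (head G p)"
    using orthogonal_to_cycles_imp_cut[of "\<lambda>p. Q p - L p"] by blast
  \<comment> \<open>By locality the coefficient at \<open>p\<close> involves only values of
    \<open>y\<close> at arcs with the same tail, and these vanish on \<open>X\<close>.\<close>
  have Q0: "Q p = 0" if "tail G p \<in> X" for p
    unfolding Q_def
  proof (intro sum.neutral ballI)
    fix q assume q: "q \<in> arcs G"
    show "x q p * y q = 0"
    proof (cases "x q p = 0")
      case False
      then have "tail G q = tail G p" using local_form_nonzeroD[OF x] by blast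
      then show ?thesis using van_y[OF that] q by (simp add: van_def)
    qed simp
  qed
  have \<phi>L: "L (r p) - L p = \<phi> (tail G p) - \<phi> (head G p)"
    if "p \<in> arcs G" "tail G p \<in> X" "head G p \<in> X" for p
    using \<phi>[OF that(1)] Q0[of p] Q0[of "r p"] that by simp
  have prop1: "\<phi> (tail G p) = \<phi> (head G p)"
    if p: "p \<in> arcs G" "tail G p \<in> X" "head G p \<in> X" "p \<noteq> d" "r p \<noteq> d"
      "p \<in> N \<or> (\<forall>x\<in>X - {v', v''}. p \<noteq> spoke x \<and> r p \<noteq> spoke x)" for p
  proof -
    have ne: "p \<noteq> g D \<and> r p \<noteq> g D" if D: "D \<in> \<D>'" for D
      using p(6)
    proof
      assume "p \<in> N"
      then show ?thesis using gN[OF D] Nr by metis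
    next
      assume "\<forall>x\<in>X - {v', v''}. p \<noteq> spoke x \<and> r p \<noteq> spoke x"
      then show ?thesis using cX[OF D] by (simp add: g_def)
    qed
    have "L p = 0" "L (r p) = 0" using ne p(4,5) by (auto simp: L_def intro!: sum.neutral)
    then show ?thesis using \<phi>L[OF p(1-3)] by simp
  qed
  \<comment> \<open>Without jumps \<open>L\<close> would be symmetric under reversal, although it
    contains \<open>d\<close> and each spoke in one direction only; this kills their coefficients.
    What remains is a combination of \<open>z1\<close> and \<open>z2\<close> that vanishes at
    \<open>a\<close> and \<open>b\<close>, so all unknowns would be zero.\<close>
  have prop2: "\<exists>x\<in>X. \<phi> x \<noteq> \<phi> v'"
  proof (rule ccontr)
    assume "\<not> ?thesis"
    then have const: "\<phi> u = \<phi> w" if "u \<in> X" "w \<in> X" for u w using that by metis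
    have Lr: "L (r p) = L p" if "p \<in> arcs G" "tail G p \<in> X" "head G p \<in> X" for p
      using \<phi>L[OF that] const[OF that(2,3)] by simp
    have rd: "r d \<noteq> d" using arev_neq[OF v(2)] .
    have gd: "d \<noteq> g D" "r d \<noteq> g D" if D: "D \<in> \<D>'" for D
    proof -
      have "head G (g D) \<noteq> v'" "head G (g D) \<noteq> v''" using g(3)[OF D] cX[OF D] by auto
      moreover have "head G (r d) = v'" using head_arev[OF v(2)] v(3) by simp
      ultimately show "d \<noteq> g D" "r d \<noteq> g D" using v(4) by auto
    qed
    have "L d = k (Inl 0)" "L (r d) = 0" using gd rd by (auto simp: L_def intro!: sum.neutral)
    then have k0: "k (Inl 0) = 0" using Lr[OF v(2)] v X by simp
    have kD: "k (Inr D) = 0" if D: "D \<in> \<D>'" for D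
    proof -
      have inj: "g D = g D' \<longleftrightarrow> D' = D" if "D' \<in> \<D>'" for D'
        using c[OF D] c[OF that] g(3)[OF D] g(3)[OF that] by metis
      have "r (g D) \<noteq> g D'" if "D' \<in> \<D>'" for D'
        using g[OF D] g(2)[OF that] cX[OF D] by (metis DiffD2 tail_arev)
      then have "L (r (g D)) = 0" using k0 by (auto simp: L_def intro!: sum.neutral)
      moreover have "L (g D) = (\<Sum>D'\<in>\<D>'. if D' = D then k (Inr D') else 0)"
      proof -
        have "(\<Sum>D'\<in>\<D>'. k (Inr D') * of_bool (g D = g D')) = (\<Sum>D'\<in>\<D>'. if D' = D then k (Inr D') else 0)"
          by (rule sum.cong) (use inj in auto)
        then show ?thesis by (simp only: L_def k0)
      qed
      then have "L (g D) = k (Inr D)" using finD' D by (simp add: sum.delta)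
      moreover have "tail G (g D) \<in> X" "head G (g D) \<in> X" using g[OF D] X cX[OF D] by auto
      ultimately show ?thesis using Lr[OF g(1)[OF D]] by simp
    qed
    have "y = (\<Sum>n\<in>{0, 1, 2}. k (Inl n) *\<^sub>R Y (Inl n)) + (\<Sum>D\<in>\<D>'. k (Inr D) *\<^sub>R Y (Inr D))"
      unfolding y_def I_def using finD' by (subst sum.Plus) auto
    then have y12: "y = k (Inl 1) *\<^sub>R z1 + k (Inl 2) *\<^sub>R z2"
      using k0 kD by (simp add: Y_def)
    have "y a = 0" "y b = 0" using van_y[OF X(2)] van_y[OF X(3)] ab by (auto simp: van_def)
    then have "k (Inl 1) * z1 a + k (Inl 2) * z2 a = 0" "k (Inl 1) * z1 b + k (Inl 2) * z2 b = 0"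
      by (simp_all add: y12)
    then have "k (Inl 1) * (z1 a * z2 b - z2 a * z1 b) = 0" "k (Inl 2) * (z1 a * z2 b - z2 a * z1 b) = 0"
      by algebra+
    then have "k (Inl 1) = 0" "k (Inl 2) = 0" using z12(3) by auto
    with k0 kD have "k i = 0" if "i \<in> I" for i using that by (auto simp: I_def)
    then show False using k(1) by blast
  qed
  show ?thesis
    using aN bN prop1 prop2 by (intro exI[of _ \<phi>] exI[of _ N]) blast
qed

end

subsection \<open>Vertex splitting\<close>

locale splitting =
  G: multigraph G r + H: multigraph H q
  for G H :: "('a, 'b) pre_digraph" and r q :: "'b \<Rightarrow> 'b" +
  fixes v v' v'' :: 'a and d d' :: 'b
  assumes v: "v \<in> verts G" and v'v'': "v' \<noteq> v''"
    and new: "v' \<notin> verts G - {v}" "v'' \<notin> verts G - {v}"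
    and verts_H: "verts H = (verts G - {v}) \<union> {v', v''}"
    and dd: "d \<noteq> d'" "d \<notin> arcs G" "d' \<notin> arcs G"
    and arcs_H: "arcs H = arcs G \<union> {d, d'}"
    and q: "q = r(d := d', d' := d)"
    and d_ends: "tail H d = v'" "head H d = v''"
    and ends_away: "\<And>a. a \<in> arcs G \<Longrightarrow> tail G a \<noteq> v \<Longrightarrow> head G a \<noteq> v \<Longrightarrow>
      tail H a = tail G a \<and> head H a = head G a"
    and ends_spoke: "\<And>a. a \<in> arcs G \<Longrightarrow> tail G a = v \<Longrightarrow> head G a \<noteq> v \<Longrightarrow>
      (tail H a = v' \<or> tail H a = v'') \<and> head H a = head G a"
    and ends_loop: "\<And>a. a \<in> arcs G \<Longrightarrow> tail G a = v \<Longrightarrow> head G a = v \<Longrightarrow> {tail H a, head H a} = {v', v''}"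
begin

lemma q_arc: "a \<in> arcs G \<Longrightarrow> q a = r a"
  using dd by (auto simp: q)

lemma q_d [simp]: "q d = d'" "q d' = d"
  using dd by (auto simp: q)

lemma d_arcs [simp]: "d \<in> arcs H" "d' \<in> arcs H"
  by (simp_all add: arcs_H)

lemma d'_ends: "tail H d' = v''" "head H d' = v'"
  using H.tail_arev[OF d_arcs(1)] H.head_arev[OF d_arcs(1)] d_ends by simp_all

lemma arc_H: "a \<in> arcs G \<Longrightarrow> a \<in> arcs H"
  by (simp add: arcs_H)

text \<open>The splitting prescribes only the arcs that leave \<open>v\<close>; those that enter
  \<open>v\<close> are controlled through their reversal.\<close>

lemma tail_H_away:
  assumes a: "a \<in> arcs G" "tail G a \<noteq> v"
  shows "tail H a = tail G a"
proof (cases "head G a = v")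
  case False
  then show ?thesis using ends_away a by blast
next
  case True
  then have "head H (r a) = head G (r a)" using ends_spoke[of "r a"] a by simp
  moreover have "head H (r a) = tail H a" using H.head_arev[OF arc_H[OF a(1)]] q_arc[OF a(1)] by simp
  ultimately show ?thesis using a by simp
qed

lemma tail_H_at:
  assumes "a \<in> arcs G" "tail G a = v"
  shows "tail H a = v' \<or> tail H a = v''"
  using ends_spoke[of a] ends_loop[of a] assms by (cases "head G a = v") blast+

lemma head_H_away:
  assumes a: "a \<in> arcs G" "head G a \<noteq> v"
  shows "head H a = head G a"
  using tail_H_away[of "r a"] a H.tail_arev[OF arc_H[OF a(1)]] q_arc[OF a(1)] by simp

text \<open>A new vertex may reuse the name \<open>v\<close>, so freshness is available only against
  the other vertices of \<open>G\<close>.\<close>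

lemma tail_H_new:
  assumes "a \<in> arcs G"
  shows "tail H a = v' \<or> tail H a = v'' \<longleftrightarrow> tail G a = v"
proof (cases "tail G a = v")
  case True
  then show ?thesis using tail_H_at[OF assms] by simp
next
  case False
  then have "tail G a \<in> verts G - {v}" using assms by simp
  then show ?thesis using tail_H_away[OF assms False] new False by auto
qed

definition side :: "'a \<Rightarrow> 'b set" where
  "side u = {a \<in> arcs G. tail H a = u}"

lemma side_arcs: "side u \<subseteq> arcs G"
  by (auto simp: side_def)

lemma finite_side [simp]: "finite (side u)"
  by (rule finite_subset[OF side_arcs]) simp

lemma out_arcs_v: "out_arcs G v = side v' \<union> side v''" "side v' \<inter> side v'' = {}"
proof -
  have "a \<in> out_arcs G v \<longleftrightarrow> a \<in> side v' \<union> side v''" for a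
    using tail_H_new[of a] by (auto simp: side_def)
  then show "out_arcs G v = side v' \<union> side v''" by blast
  show "side v' \<inter> side v'' = {}" using v'v'' by (auto simp: side_def)
qed

lemma out_arcs_H_v': "out_arcs H v' = insert d (side v')" "d \<notin> side v'"
  using d_ends d'_ends v'v'' dd by (auto simp: side_def arcs_H)

lemma out_arcs_H_v'': "out_arcs H v'' = insert d' (side v'')" "d' \<notin> side v''"
  using d_ends d'_ends v'v'' dd by (auto simp: side_def arcs_H)

lemma out_arcs_H_away:
  assumes "u \<noteq> v'" "u \<noteq> v''" "u \<in> verts G - {v}"
  shows "out_arcs H u = out_arcs G u"
proof -
  have "tail H a = u \<longleftrightarrow> tail G a = u" if "a \<in> arcs G" for a
    using tail_H_away[OF that] tail_H_at[OF that] assms by (cases "tail G a = v") auto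
  then have "a \<in> out_arcs H u \<longleftrightarrow> a \<in> out_arcs G u" for a
    using assms(1,2) d_ends d'_ends by (cases "a \<in> arcs G") (auto simp: arcs_H)
  then show ?thesis by blast
qed

lemma cut_connected_H:
  assumes "cut_connected G"
  shows "cut_connected H"
  unfolding cut_connected_def
proof (intro allI impI)
  fix S assume S: "\<forall>a\<in>arcs H. tail H a \<in> S \<longleftrightarrow> head H a \<in> S"
  have vv: "v' \<in> S \<longleftrightarrow> v'' \<in> S" using S d_ends d_arcs by metis
  define S' where "S' = {u. if u = v then v' \<in> S else u \<in> S}"
  have tl: "tail G a \<in> S' \<longleftrightarrow> tail H a \<in> S" if "a \<in> arcs G" for a
    using tail_H_away[OF that] tail_H_at[OF that] vv by (auto simp: S'_def)
  have hd: "head G a \<in> S' \<longleftrightarrow> head H a \<in> S" if a: "a \<in> arcs G" for a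
    using tl[of "r a"] a q_arc[OF a] H.tail_arev[OF arc_H[OF a]] by simp
  have "\<forall>a\<in>arcs G. tail G a \<in> S' \<longleftrightarrow> head G a \<in> S'"
    using S tl hd arc_H by blast
  then have "verts G \<subseteq> S' \<or> verts G \<inter> S' = {}" using assms unfolding cut_connected_def by blast
  then show "verts H \<subseteq> S \<or> verts H \<inter> S = {}"
  proof
    assume sub: "verts G \<subseteq> S'"
    then have "v' \<in> S" using v by (auto simp: S'_def)
    moreover have "u \<in> S" if "u \<in> verts G - {v}" for u using sub that by (auto simp: S'_def)
    ultimately show ?thesis using vv unfolding verts_H by blast
  next
    assume dis: "verts G \<inter> S' = {}"
    then have "v' \<notin> S" using v by (auto simp: S'_def)
    moreover have "u \<notin> S" if "u \<in> verts G - {v}" for u using dis that by (auto simp: S'_def)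
    ultimately show ?thesis using vv unfolding verts_H by blast
  qed
qed

lemma out_arcs_H_nonempty:
  assumes "\<forall>u\<in>verts G. out_arcs G u \<noteq> {}" "u \<in> verts H"
  shows "out_arcs H u \<noteq> {}"
proof (cases "u = v' \<or> u = v''")
  case True
  then show ?thesis using out_arcs_H_v' out_arcs_H_v'' by auto
next
  case False
  then have "u \<in> verts G - {v}" using assms(2) by (auto simp: verts_H)
  then show ?thesis using out_arcs_H_away[of u] False assms(1) by auto
qed

text \<open>The sum condition at \<open>v'\<close> and at \<open>v''\<close> forces the values on
  the splitting-edge. The formula is linear on all functions, not only on cycles, so that it can
  also be applied to unit vectors.\<close>

definition lift :: "('b \<Rightarrow> real) \<Rightarrow> 'b \<Rightarrow> real" where
  "lift z a = (if a = d then - (\<Sum>b\<in>side v'. z b) else if a = d' then - (\<Sum>b\<in>side v''. z b)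
     else if a \<in> arcs G then z a else 0)"

definition restrict :: "('b \<Rightarrow> real) \<Rightarrow> 'b \<Rightarrow> real" where
  "restrict z a = (if a \<in> arcs G then z a else 0)"

lemma lift_arc: "a \<in> arcs G \<Longrightarrow> lift z a = z a"
  using dd by (auto simp: lift_def)

lemma linear_lift: "linear lift"
  by (rule linearI)
    (auto simp: lift_def fun_eq_iff sum.distrib sum_distrib_left)

lemma sum_sides:
  "(\<Sum>a\<in>out_arcs G v. z a) = (\<Sum>a\<in>side v'. z a) + (\<Sum>a\<in>side v''. (z a :: real))"
  unfolding out_arcs_v(1) using out_arcs_v(2) by (simp add: sum.union_disjoint)

lemma lift_cycle:
  assumes z: "z \<in> cycle_space G r"
  shows "lift z \<in> cycle_space H q"
  unfolding cycle_space_def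
proof (intro CollectI conjI allI ballI impI)
  fix a assume "a \<notin> arcs H"
  then show "lift z a = 0" by (auto simp: lift_def arcs_H)
next
  have sides: "(\<Sum>a\<in>side v'. z a) = - (\<Sum>a\<in>side v''. z a)"
    using cycle_space_sum[OF z v] sum_sides[of z] by simp
  fix a assume "a \<in> arcs H"
  then consider "a = d" | "a = d'" | "a \<in> arcs G" by (auto simp: arcs_H)
  then show "lift z (q a) = - lift z a"
  proof cases
    case 3
    then show ?thesis using lift_arc[of a] lift_arc[of "r a"] q_arc[of a] cycle_space_rev[OF z] by simp
  qed (use sides dd in \<open>auto simp: lift_def\<close>)
next
  have sd: "(\<Sum>a\<in>side u. lift z a) = (\<Sum>a\<in>side u. z a)" for u
    using side_arcs lift_arc by (intro sum.cong) auto
  fix u assume u: "u \<in> verts H"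
  show "(\<Sum>a\<in>out_arcs H u. lift z a) = 0"
  proof -
    consider "u = v'" | "u = v''" | "u \<noteq> v'" "u \<noteq> v''" "u \<in> verts G - {v}"
      using u by (auto simp: verts_H)
    then show ?thesis
    proof cases
      case 1
      then show ?thesis using out_arcs_H_v' sd[of v'] by (simp add: lift_def)
    next
      case 2
      then show ?thesis using out_arcs_H_v'' sd[of v''] dd by (simp add: lift_def)
    next
      case 3
      have "(\<Sum>a\<in>out_arcs G u. lift z a) = (\<Sum>a\<in>out_arcs G u. z a)"
        using lift_arc by (intro sum.cong) auto
      then show ?thesis using out_arcs_H_away[OF 3] cycle_space_sum[OF z] 3 by simp
    qed
  qed
qed

lemma cycle_H_d:
  assumes z: "z \<in> cycle_space H q"
  shows "z d = - (\<Sum>b\<in>side v'. z b)" "z d' = - (\<Sum>b\<in>side v''. z b)"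
proof -
  have "v' \<in> verts H" "v'' \<in> verts H" by (simp_all add: verts_H)
  then show "z d = - (\<Sum>b\<in>side v'. z b)" "z d' = - (\<Sum>b\<in>side v''. z b)"
    using cycle_space_sum[OF z, of v'] cycle_space_sum[OF z, of v''] out_arcs_H_v' out_arcs_H_v''
    by simp_all
qed

lemma restrict_cycle:
  assumes z: "z \<in> cycle_space H q"
  shows "restrict z \<in> cycle_space G r" "lift (restrict z) = z"
proof -
  have sd: "(\<Sum>a\<in>side u. restrict z a) = (\<Sum>a\<in>side u. z a)" for u
    using side_arcs by (intro sum.cong) (auto simp: restrict_def)
  have zd: "z d' = - z d" using cycle_space_rev[OF z d_arcs(1)] by simp
  show "restrict z \<in> cycle_space G r"
    unfolding cycle_space_def
  proof (intro CollectI conjI allI ballI impI)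
    fix a assume "a \<in> arcs G"
    then show "restrict z (r a) = - restrict z a"
      using cycle_space_rev[OF z arc_H[of a]] q_arc[of a] by (simp add: restrict_def)
  next
    fix u assume u: "u \<in> verts G"
    show "(\<Sum>a\<in>out_arcs G u. restrict z a) = 0"
    proof (cases "u = v")
      case True
      then show ?thesis using sum_sides[of "restrict z"] sd cycle_H_d[OF z] zd by simp
    next
      case False
      then have u': "u \<noteq> v'" "u \<noteq> v''" "u \<in> verts G - {v}" "u \<in> verts H" using u new by (auto simp: verts_H)
      have "(\<Sum>a\<in>out_arcs G u. restrict z a) = (\<Sum>a\<in>out_arcs G u. z a)"
        by (intro sum.cong) (auto simp: restrict_def)
      then show ?thesis using out_arcs_H_away[OF u'(1-3)] cycle_space_sum[OF z u'(4)] by simp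
    qed
  qed (simp add: restrict_def)
  show "lift (restrict z) = z"
  proof
    fix a
    show "lift (restrict z) a = z a"
      using sd cycle_H_d[OF z] cycle_space_outside[OF z, of a]
      by (auto simp: lift_def restrict_def arcs_H)
  qed
qed

text \<open>The form is pulled back along \<open>lift\<close>, an isomorphism of cycle spaces. Its
  matrix is read off at unit vectors, which are no cycles; it stays local because the lift of the
  unit at \<open>a\<close> lives on \<open>a\<close> and possibly the splitting arc with the same
  tail, and a common tail in \<open>H\<close> implies one in \<open>G\<close>.\<close>

lemma form_G_if_form_H:
  assumes x: "local_form H x" "dim_at_most (Suc 0) (form_radical H q x)"
  shows "\<exists>y. local_form G y \<and> dim_at_most (Suc 0) (form_radical G r y)"
proof -
  define unit where "unit a b = (of_bool (b = a) :: real)" for a b :: 'b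
  define y where "y a b = (if a \<in> arcs G \<and> b \<in> arcs G then form_of H x (lift (unit a)) (lift (unit b)) else 0)" for a b
  have skew: "skew_form (form_of H x)" by (rule skew_form_form_of[OF x(1)])
  note lin = skew_form_linear_left[OF skew] and linR = skew_form_linear_right[OF skew]
  have supp: "tail H p = tail H a" if "lift (unit a) p \<noteq> 0" "a \<in> arcs G" for a p
  proof -
    have side0: "(\<Sum>b\<in>side u. unit a b) = of_bool (a \<in> side u)" for u
      by (simp add: unit_def of_bool_def sum.delta)
    have "p = a \<or> p = d \<and> a \<in> side v' \<or> p = d' \<and> a \<in> side v''"
      using that unfolding lift_def side0 by (auto simp: unit_def split: if_splits)
    then show ?thesis using d_ends d'_ends by (auto simp: side_def)
  qed
  have "local_form G y"
    unfolding local_form_def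
  proof (intro conjI allI impI)
    fix a b
    show "y b a = - y a b"
      using skew_form_swap[OF skew, of "lift (unit b)" "lift (unit a)"] by (auto simp: y_def)
    assume ne: "y a b \<noteq> 0"
    then show ab: "a \<in> arcs G" "b \<in> arcs G" by (auto simp: y_def split: if_splits)
    have "form_of H x (lift (unit a)) (lift (unit b)) \<noteq> 0" using ne ab by (simp add: y_def)
    then obtain p where "(\<Sum>t\<in>arcs H. x p t * lift (unit a) p * lift (unit b) t) \<noteq> 0"
      unfolding form_of_def by (meson sum.neutral)
    then obtain t where "x p t * lift (unit a) p * lift (unit b) t \<noteq> 0" by (meson sum.neutral)
    then have "x p t \<noteq> 0" "tail H p = tail H a" "tail H t = tail H b" using supp ab by auto
    then have "tail H a = tail H b" using local_form_nonzeroD[OF x(1)] by metis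
    then show "tail G a = tail G b"
      using tail_H_new[OF ab(1)] tail_H_new[OF ab(2)] tail_H_away[OF ab(1)] tail_H_away[OF ab(2)] by metis
  qed
  have expand: "z = (\<Sum>a\<in>arcs G. z a *\<^sub>R unit a)" if "z \<in> cycle_space G r" for z
    using cycle_space_outside[OF that]
    by (auto simp: fun_eq_iff sum_fun_apply unit_def of_bool_def if_distrib[of "\<lambda>t. _ * t"] sum.delta' cong: if_cong)
  have form: "form_of G y z w = form_of H x (lift z) (lift w)"
    if z: "z \<in> cycle_space G r" and w: "w \<in> cycle_space G r" for z w
  proof -
    have lz: "lift z = (\<Sum>a\<in>arcs G. z a *\<^sub>R lift (unit a))" if "z \<in> cycle_space G r" for z
    proof -
      have "lift z = lift (\<Sum>a\<in>arcs G. z a *\<^sub>R unit a)" using expand[OF that] by simp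
      then show ?thesis by (simp add: linear_sum[OF linear_lift] linear_scale[OF linear_lift])
    qed
    have "form_of H x (lift z) (lift w)
        = (\<Sum>b\<in>arcs G. \<Sum>a\<in>arcs G. w b * (z a * form_of H x (lift (unit a)) (lift (unit b))))"
      unfolding lz[OF z] lz[OF w]
      by (simp add: linear_sum[OF lin] linear_scale[OF lin] linear_sum[OF linR] linear_scale[OF linR] sum_distrib_left)
    also have "\<dots> = (\<Sum>a\<in>arcs G. \<Sum>b\<in>arcs G. w b * (z a * form_of H x (lift (unit a)) (lift (unit b))))"
      by (rule sum.swap)
    also have "\<dots> = form_of G y z w"
      unfolding form_of_def[of G] by (intro sum.cong refl) (simp add: y_def)
    finally show ?thesis by simp
  qed
  have rad: "lift z \<in> form_radical H q x" if z: "z \<in> form_radical G r y" for z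
  proof -
    have zZ: "z \<in> cycle_space G r" using z by (simp add: form_radical_def radical_def)
    have "form_of H x (lift z) w = 0" if w: "w \<in> cycle_space H q" for w
      using form[OF zZ restrict_cycle(1)[OF w]] restrict_cycle[OF w] z by (simp add: form_radical_def radical_def)
    then show ?thesis using lift_cycle[OF zZ] by (simp add: form_radical_def radical_def)
  qed
  have "dim_at_most (Suc 0) (form_radical G r y)"
    unfolding dim_at_most_1_iff
  proof (intro ballI)
    fix z w assume zw: "z \<in> form_radical G r y" "w \<in> form_radical G r y"
    obtain c e where ce: "c \<noteq> 0 \<or> e \<noteq> 0" "c *\<^sub>R lift z + e *\<^sub>R lift w = 0"
      using x(2) rad[OF zw(1)] rad[OF zw(2)] unfolding dim_at_most_1_iff by blast
    have "c * z a + e * w a = 0" for a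
    proof (cases "a \<in> arcs G")
      case True
      then show ?thesis using fun_cong[OF ce(2), of a] lift_arc[OF True] by simp
    next
      case False
      then have "z a = 0" "w a = 0"
        using zw cycle_space_outside[of _ G r a] by (auto simp: form_radical_def radical_def)
      then show ?thesis by simp
    qed
    then show "\<exists>c d. (c \<noteq> 0 \<or> d \<noteq> 0) \<and> c *\<^sub>R z + d *\<^sub>R w = 0"
      using ce(1) by (intro exI[of _ c] exI[of _ e]) (auto simp: fun_eq_iff)
  qed
  with \<open>local_form G y\<close> show ?thesis by blast
qed

section \<open>Transfer of coordinates to the split graph\<close>

lemma surj_H:
  assumes "even_coordinates G r I"
  shows "\<exists>z\<in>cycle_space H q. \<forall>i\<in>I. z i = t i"
proof -
  obtain z where z: "z \<in> cycle_space G r" "\<forall>i\<in>I. z i = t i"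
    using assms unfolding even_coordinates_def by blast
  have "\<forall>i\<in>I. lift z i = t i"
    using z(2) lift_arc assms unfolding even_coordinates_def by auto
  then show ?thesis using lift_cycle[OF z(1)] by blast
qed

lemma dim_H:
  assumes "even_coordinates G r I"
  shows "dim_at_most (Suc 0) {z \<in> cycle_space H q. \<forall>i\<in>I. z i = 0}"
proof -
  have "dim_at_most (Suc 0) (lift ` {z \<in> cycle_space G r. \<forall>i\<in>I. z i = 0})"
    using assms unfolding even_coordinates_def by (intro dim_at_most_linear_image linear_lift) blast
  moreover have "{z \<in> cycle_space H q. \<forall>i\<in>I. z i = 0} \<subseteq> lift ` {z \<in> cycle_space G r. \<forall>i\<in>I. z i = 0}"
  proof
    fix z assume "z \<in> {z \<in> cycle_space H q. \<forall>i\<in>I. z i = 0}"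
    then have z: "z \<in> cycle_space H q" "\<forall>i\<in>I. z i = 0" by auto
    have "restrict z i = 0" if "i \<in> I" for i using z(2) that by (simp add: restrict_def)
    then have "restrict z \<in> {z \<in> cycle_space G r. \<forall>i\<in>I. z i = 0}" using restrict_cycle(1)[OF z(1)] by blast
    then show "z \<in> lift ` {z \<in> cycle_space G r. \<forall>i\<in>I. z i = 0}"
      by (rule image_eqI[where f = lift, rotated]) (simp add: restrict_cycle(2)[OF z(1)])
  qed
  ultimately show ?thesis by (rule dim_at_most_subset)
qed

lemma even_away:
  assumes I: "even_coordinates G r I" and u: "u \<noteq> v'" "u \<noteq> v''"
  shows "even (card {i \<in> I. tail H i = u})"
proof (cases "u = v")
  case True
  have IG: "I \<subseteq> arcs G" using I unfolding even_coordinates_def by blast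
  have "tail H i \<noteq> v" if "i \<in> I" for i
  proof -
    have "tail H i \<in> verts H" using that IG arc_H by auto
    then show ?thesis using u True by (auto simp: verts_H)
  qed
  then have none: "{i \<in> I. tail H i = u} = {}" using True by auto
  show ?thesis unfolding none by simp
next
  case False
  have IG: "I \<subseteq> arcs G" using I unfolding even_coordinates_def by blast
  have "tail H i = u \<longleftrightarrow> tail G i = u" if "i \<in> I" for i
  proof -
    have i: "i \<in> arcs G" using that IG by blast
    show ?thesis
      using tail_H_away[OF i] tail_H_at[OF i] u False by (cases "tail G i = v") auto
  qed
  then have "{i \<in> I. tail H i = u} = {i \<in> I. tail G i = u}" by blast
  then show ?thesis using I unfolding even_coordinates_def by simp
qed

text \<open>The parity at \<open>v''\<close> follows from those at \<open>v\<close> and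
  \<open>v'\<close>, so \<open>I\<close> itself still works.\<close>

lemma even_coordinates_H:
  assumes I: "even_coordinates G r I" and even: "even (card {i \<in> I. tail H i = v'})"
  shows "even_coordinates H q I"
proof -
  have IG: "I \<subseteq> arcs G" using I unfolding even_coordinates_def by blast
  have "even (card {i \<in> I. tail H i = u})" for u
  proof -
    have evG: "even (card {i \<in> I. tail G i = w})" for w using I unfolding even_coordinates_def by blast
    have finI: "finite I" by (rule finite_subset[OF IG]) simp
    consider "u = v'" | "u = v''" | "u \<noteq> v'" "u \<noteq> v''" by blast
    then show ?thesis
    proof cases
      case 2
      have "{i \<in> I. tail G i = v} = {i \<in> I. tail H i = v'} \<union> {i \<in> I. tail H i = v''}"
        using tail_H_new IG by blast
      moreover have "{i \<in> I. tail H i = v'} \<inter> {i \<in> I. tail H i = v''} = {}" using v'v'' by auto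
      ultimately have "card {i \<in> I. tail G i = v} = card {i \<in> I. tail H i = v'} + card {i \<in> I. tail H i = v''}"
        using finI by (simp add: card_Un_disjoint)
      then show ?thesis using evG[of v] even 2 by simp
    next
      case 3
      then show ?thesis by (rule even_away[OF I])
    qed (simp add: even)
  qed
  then show ?thesis
    unfolding even_coordinates_def using IG arc_H surj_H[OF I] dim_H[OF I] by blast
qed

text \<open>Both sides have an odd number of selected arcs. One arc on each side, \<open>a\<close>
  and \<open>b\<close>, is set aside, and the others are paired. The radical of the sum of these
  wedges consists of the cycles that vanish on \<open>J\<close>.\<close>

lemma admissible_form_H:
  assumes I: "even_coordinates G r I" and odd: "odd (card {i \<in> I. tail H i = v'})"
  obtains a b x where "a \<in> arcs G" "tail H a = v'" "b \<in> arcs G" "tail H b = v''" "H.admissible a b x"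
proof -
  have IG: "I \<subseteq> arcs G" using I unfolding even_coordinates_def by blast
  have finI: "finite I" by (rule finite_subset[OF IG]) simp
  let ?A = "{i \<in> I. tail H i = v'}" and ?B = "{i \<in> I. tail H i = v''}"
  have evG: "even (card {i \<in> I. tail G i = w})" for w using I unfolding even_coordinates_def by blast
  have vAB: "{i \<in> I. tail G i = v} = ?A \<union> ?B" using tail_H_new IG by blast
  have AB: "?A \<inter> ?B = {}" using v'v'' by auto
  have "card {i \<in> I. tail G i = v} = card ?A + card ?B"
    unfolding vAB using finI AB by (intro card_Un_disjoint) auto
  then have oddB: "odd (card ?B)" using evG[of v] odd by simp
  have "?A \<noteq> {}" "?B \<noteq> {}" using odd oddB by (metis card.empty even_zero)+
  then obtain a b where a: "a \<in> I" "tail H a = v'" and b: "b \<in> I" "tail H b = v''" by blast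
  have ab: "a \<noteq> b" using a b v'v'' by auto
  define J where "J = I - {a, b}"
  have finJ: "finite J" using finI by (simp add: J_def)
  have Ieq: "I = insert a (insert b J)" "a \<notin> J" "b \<notin> J" using a b by (auto simp: J_def)
  have JI: "J \<subseteq> I" by (auto simp: J_def)
  have "even (card {i \<in> J. tail H i = u})" for u
  proof -
    consider "u = v'" | "u = v''" | "u \<noteq> v'" "u \<noteq> v''" by blast
    then show ?thesis
    proof cases
      case 1
      have "?A = insert a {i \<in> J. tail H i = v'}" using a b v'v'' by (auto simp: J_def)
      then have "card ?A = Suc (card {i \<in> J. tail H i = v'})" using finJ Ieq by simp
      then show ?thesis using odd 1 by simp
    next
      case 2
      have "?B = insert b {i \<in> J. tail H i = v''}" using a b v'v'' by (auto simp: J_def)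
      then have "card ?B = Suc (card {i \<in> J. tail H i = v''})" using finJ Ieq by simp
      then show ?thesis using oddB 2 by simp
    next
      case 3
      then have "{i \<in> J. tail H i = u} = {i \<in> I. tail H i = u}" using a b by (auto simp: J_def)
      then show ?thesis using even_away[OF I 3] by simp
    qed
  qed
  then obtain P where P: "finite P" "inj_on fst P" "inj_on snd P" "fst ` P \<inter> snd ` P = {}"
    "fst ` P \<union> snd ` P = J" "\<forall>(i, j)\<in>P. tail H i = tail H j"
    using even_set_paired[OF finJ, of "tail H"] by blast
  have PJ: "fst p \<in> J" "snd p \<in> J" if "p \<in> P" for p using that P(5) by blast+
  have PH: "fst p \<in> arcs H" "snd p \<in> arcs H" if "p \<in> P" for p
    using PJ[OF that] JI IG arc_H by blast+
  define x where "x i j = (\<Sum>p\<in>P. 1 * arc_wedge (fst p) (snd p) i j)" for i j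
  have loc: "local_form H x"
    unfolding x_def
  proof (rule local_form_sum)
    fix p assume p: "p \<in> P"
    have "local_form H (\<lambda>i j. 0 + 1 * arc_wedge (fst p) (snd p) i j)"
    proof (rule local_form_add_wedge)
      show "tail H (fst p) = tail H (snd p)" using P(6) p by (auto simp: case_prod_unfold)
    qed (use PH[OF p] in \<open>auto simp: local_form_def\<close>)
    then show "local_form H (\<lambda>i j. 1 * arc_wedge (fst p) (snd p) i j)" by simp
  qed
  have form: "form_of H x z w = (\<Sum>p\<in>P. z (fst p) * w (snd p) - z (snd p) * w (fst p))" for z w
  proof -
    have "form_of H x z w = (\<Sum>p\<in>P. form_of H (\<lambda>i j. 1 * arc_wedge (fst p) (snd p) i j) z w)"
      unfolding x_def by (rule form_of_sum)
    also have "\<dots> = (\<Sum>p\<in>P. z (fst p) * w (snd p) - z (snd p) * w (fst p))"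
    proof (rule sum.cong)
      fix p assume p: "p \<in> P"
      show "form_of H (\<lambda>i j. 1 * arc_wedge (fst p) (snd p) i j) z w
          = z (fst p) * w (snd p) - z (snd p) * w (fst p)"
        unfolding form_of_arc_wedge[OF H.finite_arcs PH(1)[OF p] PH(2)[OF p]] by (simp add: wedge_def)
    qed simp
    finally show ?thesis .
  qed
  let ?Z = "cycle_space H q"
  define L where "L = {z \<in> ?Z. \<forall>i\<in>J. z i = 0}"
  have subL: "subspace L" using subspace_cycle_space[of H q] unfolding L_def subspace_def by auto
  have rad: "form_radical H q x = L"
  proof (intro equalityI subsetI)
    fix z assume z: "z \<in> form_radical H q x"
    have zZ: "z \<in> ?Z" using z by (simp add: form_radical_def radical_def)
    have z0: "z (fst p) = 0 \<and> z (snd p) = 0" if p: "p \<in> P" for p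
    proof
      have ne: "fst p' \<noteq> snd p''" if "p' \<in> P" "p'' \<in> P" for p' p'' using that P(4) by blast
      \<comment> \<open>The cycle dual to the partner \<open>snd p\<close>: pairing it with
        \<open>z\<close> isolates \<open>z (fst p)\<close>.\<close>
      obtain w where w: "w \<in> ?Z" "\<forall>i\<in>I. w i = of_bool (i = snd p)"
        using surj_H[OF I, of "\<lambda>i. of_bool (i = snd p)"] by blast
      have wv: "w i = of_bool (i = snd p)" if "i \<in> J" for i using w(2) JI that by blast
      have "form_of H x z w = (\<Sum>p'\<in>P. if p' = p then z (fst p') else 0)"
        unfolding form
      proof (rule sum.cong)
        fix p' assume p': "p' \<in> P"
        have "snd p' = snd p \<longleftrightarrow> p' = p" using inj_onD[OF P(3) _ p' p] by blast
        then show "z (fst p') * w (snd p') - z (snd p') * w (fst p') = (if p' = p then z (fst p') else 0)"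
          using wv[OF PJ(1)[OF p']] wv[OF PJ(2)[OF p']] ne[OF p' p] by simp
      qed simp
      moreover have "form_of H x z w = 0" using z w(1) by (simp add: form_radical_def radical_def)
      ultimately show "z (fst p) = 0" using P(1) p by simp
      obtain w where w: "w \<in> ?Z" "\<forall>i\<in>I. w i = of_bool (i = fst p)"
        using surj_H[OF I, of "\<lambda>i. of_bool (i = fst p)"] by blast
      have wv: "w i = of_bool (i = fst p)" if "i \<in> J" for i using w(2) JI that by blast
      have "form_of H x z w = (\<Sum>p'\<in>P. if p' = p then - z (snd p') else 0)"
        unfolding form
      proof (rule sum.cong)
        fix p' assume p': "p' \<in> P"
        have "fst p' = fst p \<longleftrightarrow> p' = p" using inj_onD[OF P(2) _ p' p] by blast
        then show "z (fst p') * w (snd p') - z (snd p') * w (fst p') = (if p' = p then - z (snd p') else 0)"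
          using wv[OF PJ(1)[OF p']] wv[OF PJ(2)[OF p']] ne[OF p p'] by simp
      qed simp
      moreover have "form_of H x z w = 0" using z w(1) by (simp add: form_radical_def radical_def)
      ultimately show "z (snd p) = 0" using P(1) p by simp
    qed
    have "z i = 0" if i: "i \<in> J" for i
    proof -
      obtain p where "p \<in> P" "i = fst p \<or> i = snd p" using i P(5) by blast
      then show ?thesis using z0 by blast
    qed
    then show "z \<in> L" using zZ by (simp add: L_def)
  next
    fix z assume "z \<in> L"
    then have z: "z \<in> ?Z" "\<And>i. i \<in> J \<Longrightarrow> z i = 0" by (auto simp: L_def)
    have "form_of H x z w = 0" for w unfolding form using z(2) PJ by (simp add: sum.neutral)
    then show "z \<in> form_radical H q x" using z(1) by (simp add: form_radical_def radical_def)
  qed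
  have dim3: "dim_at_most (Suc (Suc (Suc 0))) L"
  proof -
    define K where "K = {z \<in> ?Z. \<forall>i\<in>I. z i = 0}"
    have "subspace K" using subspace_cycle_space[of H q] unfolding K_def subspace_def by auto
    moreover have "dim_at_most (Suc 0) K" unfolding K_def by (rule dim_H[OF I])
    ultimately obtain f :: "('b \<Rightarrow> real) \<Rightarrow> real" where f: "linear f" "\<And>y. y \<in> K \<Longrightarrow> f y = 0 \<Longrightarrow> y = 0"
      by (rule dim_at_most_1_functional) blast
    \<comment> \<open>The values at \<open>a\<close> and \<open>b\<close> and the functional
      \<open>f\<close> together separate the points of \<open>L\<close>, which bounds its dimension
      by three.\<close>
    define l where "l n y = (if n = 0 then y a else if n = 1 then y b else f y)" for n :: nat and y
    have lin: "linear (l n)" for n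
      unfolding l_def using f(1) linear_apply[of a] linear_apply[of b] by (cases "n = 0"; cases "n = 1") auto
    show ?thesis
      unfolding dim_at_most_def
    proof (intro allI impI)
      fix z :: "nat \<Rightarrow> 'b \<Rightarrow> real" assume z: "\<forall>i\<le>Suc (Suc (Suc 0)). z i \<in> L"
      obtain c where c: "\<exists>i\<in>{..Suc (Suc (Suc 0))}. c i \<noteq> 0"
        "\<forall>n\<in>{0, 1, 2}. (\<Sum>i\<in>{..Suc (Suc (Suc 0))}. c i * l n (z i)) = 0"
        using homogeneous_system_nontrivial_solution[of "{0, 1, 2}" "{..Suc (Suc (Suc 0))}" "\<lambda>i n. l n (z i)"]
        by auto
      define y where "y = (\<Sum>i\<le>Suc (Suc (Suc 0)). c i *\<^sub>R z i)"
      have yL: "y \<in> L" unfolding y_def using z by (intro subspace_sum subspace_scale subL) auto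
      have ly: "l n y = 0" if "n \<in> {0, 1, 2}" for n
        using bspec[OF c(2) that] unfolding y_def linear_sum[OF lin] linear_scale[OF lin] by simp
      have "y a = 0" "y b = 0" "f y = 0" using ly[of 0] ly[of 1] ly[of 2] by (simp_all add: l_def)
      moreover from this have "y \<in> K" using yL unfolding K_def L_def Ieq(1) by auto
      ultimately have "y = 0" using f(2) by blast
      then show "\<exists>c. (\<exists>i\<le>Suc (Suc (Suc 0)). c i \<noteq> 0) \<and> (\<Sum>i\<le>Suc (Suc (Suc 0)). c i *\<^sub>R z i) = 0"
        using c(1) unfolding y_def by (intro exI[of _ c]) auto
    qed
  qed
  have "independent_on L (\<lambda>z. z a) (\<lambda>z. z b)"
  proof -
    obtain za where za: "za \<in> ?Z" "\<forall>i\<in>I. za i = of_bool (i = a)" using surj_H[OF I, of "\<lambda>i. of_bool (i = a)"] by blast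
    obtain zb where zb: "zb \<in> ?Z" "\<forall>i\<in>I. zb i = of_bool (i = b)" using surj_H[OF I, of "\<lambda>i. of_bool (i = b)"] by blast
    have "za \<in> L" "zb \<in> L" using za zb Ieq by (auto simp: L_def)
    moreover have "za a * zb b \<noteq> zb a * za b" using za(2) zb(2) a(1) b(1) ab by simp
    ultimately show ?thesis unfolding independent_on_def by blast
  qed
  then have "H.admissible a b x" using loc dim3 by (simp add: H.admissible_def rad)
  then show ?thesis using that[of a b x] a b IG by blast
qed

text \<open>The potential is shown to be constant on \<open>X\<close>. A loop at \<open>v\<close>
  turns into an edge parallel to the splitting-edge and settles the matter at once; without loops,
  the connected local subgraph and the supported arcs \<open>a\<close> and \<open>b\<close> do
  it.\<close>

lemma form_H_if_even_coordinates_G: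
  assumes I: "even_coordinates G r I" and loc: "connected (local_subgraph G v)"
  shows "(\<exists>I. even_coordinates H q I) \<or> (\<exists>x. local_form H x \<and> dim_at_most (Suc 0) (form_radical H q x))"
proof (rule ccontr)
  assume contra: "\<not> ?thesis"
  then have no: "\<forall>x. local_form H x \<longrightarrow> \<not> dim_at_most (Suc 0) (form_radical H q x)" by blast
  have "odd (card {i \<in> I. tail H i = v'})" using even_coordinates_H[OF I] contra by blast
  then obtain a b x0 where a: "a \<in> arcs G" "tail H a = v'" and b: "b \<in> arcs G" "tail H b = v''"
    and adm: "H.admissible a b x0"
    by (rule admissible_form_H[OF I])
  note sep = H.separating_potential[OF no adm v'v'' d_arcs(1) d_ends arc_H[OF a(1)] a(2) arc_H[OF b(1)] b(2)]
  have old: "p \<noteq> d" "q p \<noteq> d" if "p \<in> arcs G" for p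
    using that dd q_arc[OF that] G.arev_in_arcs[OF that] by auto
  show False
  proof (cases "\<exists>l\<in>arcs G. tail G l = v \<and> head G l = v")
    case True
    then obtain l where l: "l \<in> arcs G" "tail G l = v" "head G l = v" by blast
    have ends: "{tail H l, head H l} = {v', v''}" by (rule ends_loop[OF l])
    have X: "finite {v', v''}" "v' \<in> {v', v''}" "v'' \<in> {v', v''}" by auto
    \<comment> \<open>\<open>X\<close> contains no vertex besides \<open>v'\<close> and
      \<open>v''\<close>, so there are no spokes to choose.\<close>
    obtain \<phi> :: "'a \<Rightarrow> real" and N where \<phi>: "\<exists>x\<in>{v', v''}. \<phi> x \<noteq> \<phi> v'"
      "\<forall>p\<in>arcs H. tail H p \<in> {v', v''} \<and> head H p \<in> {v', v''} \<and> p \<noteq> d \<and> q p \<noteq> d \<and>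
        (p \<in> N \<or> (\<forall>x\<in>{v', v''} - {v', v''}. p \<noteq> undefined x \<and> q p \<noteq> undefined x)) \<longrightarrow> \<phi> (tail H p) = \<phi> (head H p)"
      using sep[OF X, of undefined] by auto
    have "tail H l \<in> {v', v''}" "head H l \<in> {v', v''}" using ends by blast+
    then have "\<phi> (tail H l) = \<phi> (head H l)" using \<phi>(2) arc_H[OF l(1)] old[OF l(1)] by blast
    then have "\<phi> v' = \<phi> v''" using ends by (auto simp: doubleton_eq_iff)
    then show False using \<phi>(1) by auto
  next
    case False
    let ?N = "neighbours G v"
    define X where "X = {v', v''} \<union> ?N"
    have nb: "u \<in> ?N \<longleftrightarrow> (\<exists>e\<in>arcs G. tail G e = v \<and> head G e = u)" for u
      by (auto simp: neighbours_def arcs_ends_def arc_to_ends_def)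
    have Nv: "u \<in> verts G - {v}" if "u \<in> ?N" for u
      using that False unfolding nb by auto
    then have Nnew: "u \<noteq> v'" "u \<noteq> v''" if "u \<in> ?N" for u using that new by blast+
    have "\<forall>u\<in>?N. \<exists>e. e \<in> arcs G \<and> tail G e = v \<and> head G e = u" using nb by blast
    then obtain spoke where spoke: "\<And>u. u \<in> ?N \<Longrightarrow> spoke u \<in> arcs G \<and> tail G (spoke u) = v \<and> head G (spoke u) = u"
      by metis
    have spokeH: "\<forall>u\<in>X - {v', v''}. spoke u \<in> arcs H \<and> tail H (spoke u) \<in> {v', v''} \<and> head H (spoke u) = u"
    proof
      fix u assume "u \<in> X - {v', v''}"
      then have u: "u \<in> ?N" by (simp add: X_def)
      then have "u \<noteq> v" using Nv by blast
      with spoke[OF u] show "spoke u \<in> arcs H \<and> tail H (spoke u) \<in> {v', v''} \<and> head H (spoke u) = u"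
        using ends_spoke[of "spoke u"] arc_H by auto
    qed
    have "finite ?N" by (rule finite_subset[of _ "verts G"]) (auto simp: neighbours_def)
    then have X: "finite X" "v' \<in> X" "v'' \<in> X" by (auto simp: X_def)
    obtain \<phi> :: "'a \<Rightarrow> real" and N where \<phi>: "a \<in> N" "b \<in> N" "\<exists>x\<in>X. \<phi> x \<noteq> \<phi> v'"
      "\<And>p. p \<in> arcs H \<Longrightarrow> tail H p \<in> X \<Longrightarrow> head H p \<in> X \<Longrightarrow> p \<noteq> d \<Longrightarrow> q p \<noteq> d \<Longrightarrow>
        p \<in> N \<or> (\<forall>x\<in>X - {v', v''}. p \<noteq> spoke x \<and> q p \<noteq> spoke x) \<Longrightarrow> \<phi> (tail H p) = \<phi> (head H p)"
      using sep[OF X spokeH] by blast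
    \<comment> \<open>Applied to \<open>a\<close> and \<open>b\<close>: being supported, they carry
      the potential of \<open>v'\<close> and of \<open>v''\<close> to neighbours of
      \<open>v\<close>, even if they are among the chosen spokes.\<close>
    have at_new: "head H p \<in> ?N \<and> \<phi> (tail H p) = \<phi> (head H p)"
      if p: "p \<in> arcs G" "tail H p = v' \<or> tail H p = v''" "p \<in> N" for p
    proof -
      have tp: "tail G p = v" using tail_H_new p by blast
      then have "head G p \<noteq> v" using False p(1) by blast
      then have "head H p = head G p" using head_H_away p(1) by blast
      then have hN: "head H p \<in> ?N" using p(1) tp unfolding nb by auto
      then have "\<phi> (tail H p) = \<phi> (head H p)"
        using p old[OF p(1)] arc_H X by (intro \<phi>(4)) (auto simp: X_def)
      with hN show ?thesis by blast
    qed
    \<comment> \<open>Edges between neighbours of \<open>v\<close> are distinct from the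
      splitting-edge and, since spokes start at \<open>v'\<close> or \<open>v''\<close>, from all
      spokes in either direction.\<close>
    have inner: "\<phi> (tail G e) = \<phi> (head G e)" if e: "e \<in> arcs G" "tail G e \<in> ?N" "head G e \<in> ?N" for e
    proof -
      have t: "tail H e = tail G e" and h: "head H e = head G e"
        using tail_H_away[OF e(1)] head_H_away[OF e(1)] Nv[OF e(2)] Nv[OF e(3)] by auto
      have qe: "tail H (q e) = head G e" using H.tail_arev[OF arc_H[OF e(1)]] h by simp
      have "e \<noteq> spoke u \<and> q e \<noteq> spoke u" if "u \<in> X - {v', v''}" for u
      proof -
        have "tail H (spoke u) \<in> {v', v''}" using spokeH that by blast
        then show ?thesis using t qe Nnew[OF e(2)] Nnew[OF e(3)] by auto
      qed
      then have "\<phi> (tail H e) = \<phi> (head H e)"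
        using e old[OF e(1)] arc_H t h by (intro \<phi>(4)) (auto simp: X_def)
      then show ?thesis by (simp add: t h)
    qed
    have const: "\<phi> u = \<phi> w" if "u \<in> ?N" "w \<in> ?N" for u w
    proof (rule cut_connectedD[OF cut_connected_if_connected[OF loc], where \<phi> = \<phi>])
      show "u \<in> verts (local_subgraph G v)" "w \<in> verts (local_subgraph G v)"
        using that by (simp_all add: local_subgraph_def)
      show "\<phi> (tail (local_subgraph G v) e) = \<phi> (head (local_subgraph G v) e)"
        if "e \<in> arcs (local_subgraph G v)" for e
        using inner[of e] that by (simp add: local_subgraph_def)
    qed
    have "\<phi> (head H a) = \<phi> v'" "\<phi> (head H b) = \<phi> v''" "head H a \<in> ?N" "head H b \<in> ?N"
      using at_new[of a] at_new[of b] a b \<phi>(1,2) by auto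
    then have "\<phi> u = \<phi> v'" if "u \<in> X" for u
      using that const[of u "head H a"] const[of "head H b" "head H a"] by (auto simp: X_def)
    then show False using \<phi>(3) by blast
  qed
qed

end

lemma splitting_if_vertex_splitting:
  assumes "vertex_splitting G r v H q v' v''"
  shows "\<exists>d d'. splitting G H r q v v' v'' d d'"
proof -
  from assms obtain d d' where *: "multigraph G r" "multigraph H q" "d \<noteq> d'" "d \<notin> arcs G" "d' \<notin> arcs G"
    "arcs H = arcs G \<union> {d, d'}" "q = r(d := d', d' := d)" "tail H d = v'" "head H d = v''"
    unfolding vertex_splitting_def by blast
  show ?thesis
  proof (intro exI)
    show "splitting G H r q v v' v'' d d'"
      unfolding splitting_def
    proof (intro conjI *(1,2))
      show "splitting_axioms G H r q v v' v'' d d'"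
        using * assms unfolding splitting_axioms_def vertex_splitting_def by auto
    qed
  qed
qed

theorem theorem2p1:
  fixes G H :: "('a, 'b) pre_digraph" and r q :: "'b \<Rightarrow> 'b" and v v' v'' :: 'a
  assumes "multigraph G r"
    and "connected G"
    and "\<forall>u \<in> verts G. 3 \<le> out_degree G u"
    and "v \<in> verts G" and "4 \<le> out_degree G v"
    and "vertex_splitting G r v H q v' v''"
    and "connected (local_subgraph G v)"
  shows "upper_embeddable G r \<longleftrightarrow> upper_embeddable H q"
proof -
  obtain d d' where "splitting G H r q v v' v'' d d'"
    using splitting_if_vertex_splitting[OF assms(6)] by blast
  then interpret S: splitting G H r q v v' v'' d d' .
  have outG: "\<forall>u\<in>verts G. out_arcs G u \<noteq> {}"
  proof
    fix u assume "u \<in> verts G"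
    with assms(3) have "3 \<le> card (out_arcs G u)" by (simp add: out_degree_def)
    then show "out_arcs G u \<noteq> {}" by auto
  qed
  then have outH: "\<forall>u\<in>verts H. out_arcs H u \<noteq> {}" using S.out_arcs_H_nonempty by blast
  have cG: "cut_connected G" by (rule cut_connected_if_connected[OF assms(2)])
  have cH: "cut_connected H" by (rule S.cut_connected_H[OF cG])
  have vH: "v' \<in> verts H" by (simp add: S.verts_H)
  note G_iff = S.G.upper_embeddable_iff_form[OF cG assms(4) outG]
  note H_iff = S.H.upper_embeddable_iff_form[OF cH vH outH]
  show ?thesis
  proof
    assume "upper_embeddable G r"
    then obtain I where "even_coordinates G r I" using G_iff(2) by blast
    from S.form_H_if_even_coordinates_G[OF this assms(7)] show "upper_embeddable H q"
      using H_iff by blast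
  next
    assume "upper_embeddable H q"
    then obtain x where "local_form H x" "dim_at_most (Suc 0) (form_radical H q x)" using H_iff(1) by blast
    from S.form_G_if_form_H[OF this] show "upper_embeddable G r" using G_iff(1) by blast
  qed
qed

end
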